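(* The category $\mathit{Bicat}$ of (small) bicategories and strong homomorphisms is a retract of the category $\mathit{Weak\_2\_Cat}$ of weak $2$-categories and omega functors: there are functors $U_B^W:\mathit{Weak\_2\_Cat}\to\mathit{Bicat}$ and $S_W^B:\mathit{Bicat}\to\mathit{Weak\_2\_Cat}$ with $U_B^W\circ S_W^B\cong 1_{\mathit{Bicat}}$.
   Context: A globular set $X$ is a sequence of sets $X_i$ ($i\ge 0$; elements are called $i$-cells) with functions $dom_{i-1}^i,cod_{i-1}^i:X_i\to X_{i-1}$ ($i>0$) satisfying $dom_{i-1}^i dom_i^{i+1}=dom_{i-1}^i cod_i^{i+1}$ and $cod_{i-1}^i dom_i^{i+1}=cod_{i-1}^i cod_i^{i+1}$. For $i<j$, $dom_i^j,cod_i^j:X_j\to X_i$ are the iterated composites. An omega graph is a globular set with functions $id_i^{i-1}:X_{i-1}\to X_i$ ($i>0$) with $dom_{i-1}^i id_i^{i-1}x=x=cod_{i-1}^i id_i^{i-1}x$; $id_j^i$ denotes the iterated composite $X_i\to X_j$. Cells in the image of $id_i^{i-1}$ are identity cells; an omega graph is $n$-skeletal if every cell of dimension $>n$ is an identity cell. An omega magma is an omega graph with, for all $0\le i<j$, a partial binary operation $a\circ_i^j b$ on $j$-cells, defined exactly when $cod_i^j a=dom_i^j b$, such that: if $i+1=j$, then $dom_i^j(a\circ_i^j b)=dom_i^j a$ and $cod_i^j(a\circ_i^j b)=cod_i^j b$; if $i+1<j$, then $dom_{j-1}^j(a\circ_i^j b)=dom_{j-1}^ja\circ_i^{j-1}dom_{j-1}^jb$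 and likewise for $cod_{j-1}^j$. Morphisms of globular sets, omega graphs and omega magmas preserve all the respective structure. A strict omega category is an omega magma in which (whenever the composites are defined) $(a\circ_i^jb)\circ_i^jc=a\circ_i^j(b\circ_i^jc)$; $(a\circ_j^kb)\circ_i^k(c\circ_j^kd)=(a\circ_i^kc)\circ_j^k(b\circ_i^kd)$ for $i<j<k$; $a=id_j^i(dom_i^ja)\circ_i^ja=a\circ_i^jid_j^i(cod_i^ja)$; and $id_{j+1}^j(a)\circ_i^{j+1}id_{j+1}^j(b)=id_{j+1}^j(a\circ_i^jb)$ for $i<j$. Two $i$-cells $a,b$ are parallel, $a\parallel b$, if they have the same $dom_{i-1}^i$ and the same $cod_{i-1}^i$; any two $0$-cells are parallel. A bridge relation $R$ on an omega graph (or omega magma) $X$ is a sequence $R_i\subseteq X_i\times X_i\times X_{i+1}$ ($i\ge0$) such that: $(a,b,c)\in R_i$ implies $a\parallel b$, $dom_i^{i+1}c=a$, $cod_i^{i+1}c=b$; $(a,a,id_{i+1}^ia)\in R_i$ for all $a\in X_i$; $(a,b,c),(a,b,d)\in R_i$ implies $c=d$. The diagonal bridge relation $R^\Delta$ consists of all triples $(a,a,id_{i+1}^ia)$. A bridge morphism $F:(X,R^X)\to(Y,R^Y)$ is an omega magma morphism with $(a,b,c)\in R_i^X\Rightarrow(Fa,Fb,Fc)\in R_i^Y$. A categorical Penon morphism is a bridge morphism $F:(X,R^X)\to(Y,R^Y)$ such that $Y$ is a strict omega category, $R^Y=R^\Delta$; $(a,b,c)\in R_i^X$ implies $Fa=Fb$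 and $Fc=id_{i+1}^i(Fa)$; and if $a,b\in X_i$, $a\parallel b$, $Fa=Fb$, then there is $c$ with $(a,b,c)\in R_i^X$. A weak omega category $\mathbf X$ consists of omega magmas $X_1$ (the underlying magma) and $X_2$, an omega magma morphism $\lambda^X:X_2\to X_1$, a morphism $\rho^X:X_1\to X_2$ of omega graphs with $\lambda^X\circ\rho^X=1$ (as omega graph morphisms), a bridge relation $R^X$ on $X_2$, a strict omega category $X_3$, and a categorical Penon morphism $\kappa^X:(X_2,R^X)\to(X_3,R^\Delta)$. An omega functor $\mathbf F:\mathbf X\to\mathbf Y$ is a triple of omega magma morphisms $F_i:X_i\to Y_i$ ($i=1,2,3$) with $F_2$ a bridge morphism $(X_2,R^X)\to(Y_2,R^Y)$, $F_1\lambda^X=\lambda^YF_2$, $F_3\kappa^X=\kappa^YF_2$, and $F_2\rho^X=\rho^YF_1$ (as omega graph morphisms). A weak $2$-category is a (small) weak omega category $\mathbf X$ with $X_1$ $2$-skeletal; $\mathit{Weak\_2\_Cat}$ is the full subcategory of the category of weak omega categories and omega functors on these objects. A strong homomorphism of bicategories is one preserving the operations and identities (and coherence isomorphisms) "on the nose", not just up to isomorphism; it is also called a strict homomorphism. *)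

theory Defs
  imports "HOL-Library.FuncSet" "HOL-Library.Equipollence"
begin

text \<open>
  Conventions. All maps carrying structure are extensional (\<^term>\<open>undefined\<close> off their domain
  of definition), so that HOL equality of structures and of morphisms is equality of the
  mathematical objects. All sets are subsets of a type \<^typ>\<open>'u\<close> playing the role of a
  Grothendieck universe; they are small if they have fewer elements than the universe.
\<close>

definition small :: "'u set \<Rightarrow> bool" where
  "small A \<longleftrightarrow> A \<prec> (UNIV :: 'u set)"


section \<open>Categories, functors, natural isomorphisms\<close>

text \<open>Hom-sets need not be disjoint; \<open>Cmp C A B D g f\<close> is the composite of \<open>f : A \<rightarrow> B\<close> and
  \<open>g : B \<rightarrow> D\<close>.\<close>

record ('o, 'a) category =
  Ob :: "'o set"
  Hom :: "'o \<Rightarrow> 'o \<Rightarrow> 'a set"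
  Idn :: "'o \<Rightarrow> 'a"
  Cmp :: "'o \<Rightarrow> 'o \<Rightarrow> 'o \<Rightarrow> 'a \<Rightarrow> 'a \<Rightarrow> 'a"

locale category =
  fixes C :: "('o, 'a, 'm) category_scheme"
  assumes Idn_in_Hom: "A \<in> Ob C \<Longrightarrow> Idn C A \<in> Hom C A A"
    and Cmp_in_Hom: "\<lbrakk>A \<in> Ob C; B \<in> Ob C; D \<in> Ob C; f \<in> Hom C A B; g \<in> Hom C B D\<rbrakk>
      \<Longrightarrow> Cmp C A B D g f \<in> Hom C A D"
    and Cmp_Idn_right: "\<lbrakk>A \<in> Ob C; B \<in> Ob C; f \<in> Hom C A B\<rbrakk> \<Longrightarrow> Cmp C A A B f (Idn C A) = f"
    and Cmp_Idn_left: "\<lbrakk>A \<in> Ob C; B \<in> Ob C; f \<in> Hom C A B\<rbrakk> \<Longrightarrow> Cmp C A B B (Idn C B) f = f"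
    and Cmp_assoc: "\<lbrakk>A \<in> Ob C; B \<in> Ob C; D \<in> Ob C; E \<in> Ob C;
        f \<in> Hom C A B; g \<in> Hom C B D; h \<in> Hom C D E\<rbrakk>
      \<Longrightarrow> Cmp C A D E h (Cmp C A B D g f) = Cmp C A B E (Cmp C B D E h g) f"

definition full_subcategory :: "('o, 'a) category \<Rightarrow> ('o \<Rightarrow> bool) \<Rightarrow> ('o, 'a) category" where
  "full_subcategory C P = C\<lparr>Ob := {A \<in> Ob C. P A}\<rparr>"

record ('o, 'a, 'p, 'b) functor_data =
  obj_map :: "'o \<Rightarrow> 'p"
  arr_map :: "'o \<Rightarrow> 'o \<Rightarrow> 'a \<Rightarrow> 'b"

locale is_functor = source: category C + target: category D
  for C :: "('o, 'a) category" and D :: "('p, 'b) category" +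
  fixes F :: "('o, 'a, 'p, 'b) functor_data"
  assumes obj_map_in: "A \<in> Ob C \<Longrightarrow> obj_map F A \<in> Ob D"
    and arr_map_in: "\<lbrakk>A \<in> Ob C; B \<in> Ob C; f \<in> Hom C A B\<rbrakk>
      \<Longrightarrow> arr_map F A B f \<in> Hom D (obj_map F A) (obj_map F B)"
    and arr_map_Idn: "A \<in> Ob C \<Longrightarrow> arr_map F A A (Idn C A) = Idn D (obj_map F A)"
    and arr_map_Cmp: "\<lbrakk>A \<in> Ob C; B \<in> Ob C; E \<in> Ob C; f \<in> Hom C A B; g \<in> Hom C B E\<rbrakk>
      \<Longrightarrow> arr_map F A E (Cmp C A B E g f) =
          Cmp D (obj_map F A) (obj_map F B) (obj_map F E) (arr_map F B E g) (arr_map F A B f)"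

definition id_functor :: "('o, 'a, 'o, 'a) functor_data" where
  "id_functor = \<lparr>obj_map = (\<lambda>A. A), arr_map = (\<lambda>A B f. f)\<rparr>"

definition comp_functor :: "('p, 'b, 'q, 'c) functor_data \<Rightarrow> ('o, 'a, 'p, 'b) functor_data
    \<Rightarrow> ('o, 'a, 'q, 'c) functor_data" where
  "comp_functor G F =
    \<lparr>obj_map = (\<lambda>A. obj_map G (obj_map F A)),
     arr_map = (\<lambda>A B f. arr_map G (obj_map F A) (obj_map F B) (arr_map F A B f))\<rparr>"

definition iso_in :: "('o, 'a) category \<Rightarrow> 'o \<Rightarrow> 'o \<Rightarrow> 'a \<Rightarrow> bool" where
  "iso_in C A B f \<longleftrightarrow> f \<in> Hom C A B \<and>
    (\<exists>g \<in> Hom C B A. Cmp C A B A g f = Idn C A \<and> Cmp C B A B f g = Idn C B)"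

definition naturally_isomorphic :: "('o, 'a) category \<Rightarrow> ('p, 'b) category \<Rightarrow>
    ('o, 'a, 'p, 'b) functor_data \<Rightarrow> ('o, 'a, 'p, 'b) functor_data \<Rightarrow> bool" where
  "naturally_isomorphic C D F G \<longleftrightarrow>
    (\<exists>\<eta>. (\<forall>A \<in> Ob C. iso_in D (obj_map F A) (obj_map G A) (\<eta> A)) \<and>
      (\<forall>A \<in> Ob C. \<forall>B \<in> Ob C. \<forall>f \<in> Hom C A B.
        Cmp D (obj_map F A) (obj_map F B) (obj_map G B) (\<eta> B) (arr_map F A B f) =
        Cmp D (obj_map F A) (obj_map G A) (obj_map G B) (arr_map G A B f) (\<eta> A)))"


section \<open>Globular sets, omega graphs, omega magmas, strict omega categories\<close>

text \<open>\<open>Dom X i\<close> and \<open>Cod X i\<close> go from dimension \<open>i + 1\<close> to \<open>i\<close>, and \<open>Unit X i\<close> from \<open>i\<close>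
  to \<open>i + 1\<close>.\<close>

record 'u globular_set =
  cells :: "nat \<Rightarrow> 'u set"
  Dom :: "nat \<Rightarrow> 'u \<Rightarrow> 'u"
  Cod :: "nat \<Rightarrow> 'u \<Rightarrow> 'u"

record 'u omega_graph = "'u globular_set" +
  Unit :: "nat \<Rightarrow> 'u \<Rightarrow> 'u"

record 'u omega_magma = "'u omega_graph" +
  ocomp :: "nat \<Rightarrow> nat \<Rightarrow> 'u \<Rightarrow> 'u \<Rightarrow> 'u"

text \<open>\<open>dom_it X i j\<close> and \<open>cod_it X i j\<close> go from dimension \<open>j\<close> to \<open>i\<close>, and \<open>unit_it X i j\<close>
  from \<open>i\<close> to \<open>j\<close>; they are meant for \<open>i \<le> j\<close> and are the identity for \<open>i = j\<close>.\<close>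

fun dom_it :: "('u, 'm) globular_set_scheme \<Rightarrow> nat \<Rightarrow> nat \<Rightarrow> 'u \<Rightarrow> 'u" where
  "dom_it X i 0 a = a"
| "dom_it X i (Suc j) a = (if i \<le> j then dom_it X i j (Dom X j a) else a)"

fun cod_it :: "('u, 'm) globular_set_scheme \<Rightarrow> nat \<Rightarrow> nat \<Rightarrow> 'u \<Rightarrow> 'u" where
  "cod_it X i 0 a = a"
| "cod_it X i (Suc j) a = (if i \<le> j then cod_it X i j (Cod X j a) else a)"

fun unit_it :: "('u, 'm) omega_graph_scheme \<Rightarrow> nat \<Rightarrow> nat \<Rightarrow> 'u \<Rightarrow> 'u" where
  "unit_it X i 0 a = a"
| "unit_it X i (Suc j) a = (if i \<le> j then Unit X j (unit_it X i j a) else a)"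

locale globular_set =
  fixes X :: "('u, 'm) globular_set_scheme"
  assumes Dom_in: "Dom X i \<in> cells X (Suc i) \<rightarrow>\<^sub>E cells X i"
    and Cod_in: "Cod X i \<in> cells X (Suc i) \<rightarrow>\<^sub>E cells X i"
    and Dom_Dom: "a \<in> cells X (Suc (Suc i)) \<Longrightarrow> Dom X i (Dom X (Suc i) a) = Dom X i (Cod X (Suc i) a)"
    and Cod_Dom: "a \<in> cells X (Suc (Suc i)) \<Longrightarrow> Cod X i (Dom X (Suc i) a) = Cod X i (Cod X (Suc i) a)"

locale omega_graph = globular_set X
  for X :: "('u, 'm) omega_graph_scheme" +
  assumes Unit_in: "Unit X i \<in> cells X i \<rightarrow>\<^sub>E cells X (Suc i)"
    and Dom_Unit: "a \<in> cells X i \<Longrightarrow> Dom X i (Unit X i a) = a"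
    and Cod_Unit: "a \<in> cells X i \<Longrightarrow> Cod X i (Unit X i a) = a"

definition skeletal :: "nat \<Rightarrow> ('u, 'm) omega_graph_scheme \<Rightarrow> bool" where
  "skeletal n X \<longleftrightarrow> (\<forall>i \<ge> n. \<forall>a \<in> cells X (Suc i). a \<in> Unit X i ` cells X i)"

definition composable :: "('u, 'm) globular_set_scheme \<Rightarrow> nat \<Rightarrow> nat \<Rightarrow> 'u \<Rightarrow> 'u \<Rightarrow> bool" where
  "composable X i j a b \<longleftrightarrow>
    i < j \<and> a \<in> cells X j \<and> b \<in> cells X j \<and> cod_it X i j a = dom_it X i j b"

locale omega_magma = omega_graph X
  for X :: "('u, 'm) omega_magma_scheme" +
  assumes comp_in: "composable X i j a b \<Longrightarrow> ocomp X i j a b \<in> cells X j"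
    and comp_undefined: "\<not> composable X i j a b \<Longrightarrow> ocomp X i j a b = undefined"
    and Dom_comp_top: "composable X i (Suc i) a b \<Longrightarrow> Dom X i (ocomp X i (Suc i) a b) = Dom X i a"
    and Cod_comp_top: "composable X i (Suc i) a b \<Longrightarrow> Cod X i (ocomp X i (Suc i) a b) = Cod X i b"
    and Dom_comp: "\<lbrakk>i < j; composable X i (Suc j) a b\<rbrakk>
      \<Longrightarrow> Dom X j (ocomp X i (Suc j) a b) = ocomp X i j (Dom X j a) (Dom X j b)"
    and Cod_comp: "\<lbrakk>i < j; composable X i (Suc j) a b\<rbrakk>
      \<Longrightarrow> Cod X j (ocomp X i (Suc j) a b) = ocomp X i j (Cod X j a) (Cod X j b)"

text \<open>In an omega magma, definedness of the inner composites below entails that of the outer ones.\<close>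

locale strict_omega_category = omega_magma X
  for X :: "('u, 'm) omega_magma_scheme" +
  assumes comp_assoc: "\<lbrakk>composable X i j a b; composable X i j b c\<rbrakk>
      \<Longrightarrow> ocomp X i j (ocomp X i j a b) c = ocomp X i j a (ocomp X i j b c)"
    and interchange: "\<lbrakk>i < j; j < k; composable X j k a b; composable X j k c d;
        composable X i k a c; composable X i k b d\<rbrakk>
      \<Longrightarrow> ocomp X i k (ocomp X j k a b) (ocomp X j k c d) = ocomp X j k (ocomp X i k a c) (ocomp X i k b d)"
    and comp_unit_left: "\<lbrakk>i < j; a \<in> cells X j\<rbrakk>
      \<Longrightarrow> ocomp X i j (unit_it X i j (dom_it X i j a)) a = a"
    and comp_unit_right: "\<lbrakk>i < j; a \<in> cells X j\<rbrakk>
      \<Longrightarrow> ocomp X i j a (unit_it X i j (cod_it X i j a)) = a"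
    and comp_Unit_Unit: "composable X i j a b
      \<Longrightarrow> ocomp X i (Suc j) (Unit X j a) (Unit X j b) = Unit X j (ocomp X i j a b)"

locale globular_morphism =
  fixes X :: "('u, 'm) globular_set_scheme" and Y :: "('u, 'n) globular_set_scheme"
    and F :: "nat \<Rightarrow> 'u \<Rightarrow> 'u"
  assumes map_in: "F i \<in> cells X i \<rightarrow>\<^sub>E cells Y i"
    and map_Dom: "a \<in> cells X (Suc i) \<Longrightarrow> F i (Dom X i a) = Dom Y i (F (Suc i) a)"
    and map_Cod: "a \<in> cells X (Suc i) \<Longrightarrow> F i (Cod X i a) = Cod Y i (F (Suc i) a)"

locale omega_graph_morphism = globular_morphism X Y F
  for X :: "('u, 'm) omega_graph_scheme" and Y :: "('u, 'n) omega_graph_scheme"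
    and F :: "nat \<Rightarrow> 'u \<Rightarrow> 'u" +
  assumes map_Unit: "a \<in> cells X i \<Longrightarrow> F (Suc i) (Unit X i a) = Unit Y i (F i a)"

locale omega_magma_morphism = omega_graph_morphism X Y F
  for X :: "('u, 'm) omega_magma_scheme" and Y :: "('u, 'n) omega_magma_scheme"
    and F :: "nat \<Rightarrow> 'u \<Rightarrow> 'u" +
  assumes map_comp: "composable X i j a b \<Longrightarrow> F j (ocomp X i j a b) = ocomp Y i j (F j a) (F j b)"

definition mor_id :: "('u, 'm) globular_set_scheme \<Rightarrow> nat \<Rightarrow> 'u \<Rightarrow> 'u" where
  "mor_id X = (\<lambda>i. \<lambda>a\<in>cells X i. a)"

text \<open>\<open>mor_comp X G F\<close> is \<open>G \<circ> F\<close>, where \<open>X\<close> is the source of \<open>F\<close>.\<close>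

definition mor_comp :: "('u, 'm) globular_set_scheme \<Rightarrow> (nat \<Rightarrow> 'u \<Rightarrow> 'u) \<Rightarrow> (nat \<Rightarrow> 'u \<Rightarrow> 'u)
    \<Rightarrow> nat \<Rightarrow> 'u \<Rightarrow> 'u" where
  "mor_comp X G F = (\<lambda>i. compose (cells X i) (G i) (F i))"


section \<open>Bridge relations and categorical Penon morphisms\<close>

definition parallel :: "('u, 'm) globular_set_scheme \<Rightarrow> nat \<Rightarrow> 'u \<Rightarrow> 'u \<Rightarrow> bool" where
  "parallel X i a b \<longleftrightarrow> a \<in> cells X i \<and> b \<in> cells X i \<and>
    (case i of 0 \<Rightarrow> True | Suc k \<Rightarrow> Dom X k a = Dom X k b \<and> Cod X k a = Cod X k b)"

type_synonym 'u relation_family = "nat \<Rightarrow> ('u \<times> 'u \<times> 'u) set"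

locale bridge_relation =
  fixes X :: "('u, 'm) omega_graph_scheme" and R :: "'u relation_family"
  assumes bridge_cells: "(a, b, c) \<in> R i \<Longrightarrow>
      a \<in> cells X i \<and> b \<in> cells X i \<and> c \<in> cells X (Suc i)"
    and bridge_parallel: "(a, b, c) \<in> R i \<Longrightarrow> parallel X i a b"
    and bridge_Dom: "(a, b, c) \<in> R i \<Longrightarrow> Dom X i c = a"
    and bridge_Cod: "(a, b, c) \<in> R i \<Longrightarrow> Cod X i c = b"
    and bridge_refl: "a \<in> cells X i \<Longrightarrow> (a, a, Unit X i a) \<in> R i"
    and bridge_unique: "\<lbrakk>(a, b, c) \<in> R i; (a, b, d) \<in> R i\<rbrakk> \<Longrightarrow> c = d"

definition diagonal_bridge :: "('u, 'm) omega_graph_scheme \<Rightarrow> 'u relation_family" where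
  "diagonal_bridge X = (\<lambda>i. {(a, a, Unit X i a) | a. a \<in> cells X i})"

locale bridge_morphism = omega_magma_morphism X Y F
  for X :: "('u, 'm) omega_magma_scheme" and R :: "'u relation_family"
    and Y :: "('u, 'n) omega_magma_scheme" and S :: "'u relation_family"
    and F :: "nat \<Rightarrow> 'u \<Rightarrow> 'u" +
  assumes map_bridge: "(a, b, c) \<in> R i \<Longrightarrow> (F i a, F i b, F (Suc i) c) \<in> S i"

locale categorical_Penon_morphism =
  source: omega_magma X + bridge: bridge_relation X R + target: strict_omega_category Y +
  bridge_morphism X R Y "diagonal_bridge Y" F
  for X :: "('u, 'm) omega_magma_scheme" and R :: "'u relation_family"
    and Y :: "('u, 'n) omega_magma_scheme" and F :: "nat \<Rightarrow> 'u \<Rightarrow> 'u" +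
  assumes bridge_collapse: "(a, b, c) \<in> R i \<Longrightarrow> F i a = F i b \<and> F (Suc i) c = Unit Y i (F i a)"
    and bridge_exists: "\<lbrakk>parallel X i a b; F i a = F i b\<rbrakk> \<Longrightarrow> \<exists>c. (a, b, c) \<in> R i"


section \<open>Weak omega categories and weak 2-categories\<close>

record 'u weak_omega_category =
  mag1 :: "'u omega_magma"
  mag2 :: "'u omega_magma"
  lam :: "nat \<Rightarrow> 'u \<Rightarrow> 'u"
  rho :: "nat \<Rightarrow> 'u \<Rightarrow> 'u"
  bridge :: "'u relation_family"
  cat3 :: "'u omega_magma"
  kap :: "nat \<Rightarrow> 'u \<Rightarrow> 'u"

locale weak_omega_category =
  M1: omega_magma "mag1 X" + M2: omega_magma "mag2 X" +
  lambda: omega_magma_morphism "mag2 X" "mag1 X" "lam X" +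
  rho: omega_graph_morphism "mag1 X" "mag2 X" "rho X" +
  kappa: categorical_Penon_morphism "mag2 X" "bridge X" "cat3 X" "kap X"
  for X :: "'u weak_omega_category" +
  assumes lam_rho: "mor_comp (mag1 X) (lam X) (rho X) = mor_id (mag1 X)"

definition small_weak_omega_category :: "'u weak_omega_category \<Rightarrow> bool" where
  "small_weak_omega_category X \<longleftrightarrow>
    (\<forall>i. small (cells (mag1 X) i) \<and> small (cells (mag2 X) i) \<and> small (cells (cat3 X) i))"

record 'u omega_functor =
  fun1 :: "nat \<Rightarrow> 'u \<Rightarrow> 'u"
  fun2 :: "nat \<Rightarrow> 'u \<Rightarrow> 'u"
  fun3 :: "nat \<Rightarrow> 'u \<Rightarrow> 'u"

locale omega_functor =
  F1: omega_magma_morphism "mag1 X" "mag1 Y" "fun1 F" +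
  F2: bridge_morphism "mag2 X" "bridge X" "mag2 Y" "bridge Y" "fun2 F" +
  F3: omega_magma_morphism "cat3 X" "cat3 Y" "fun3 F"
  for X Y :: "'u weak_omega_category" and F :: "'u omega_functor" +
  assumes fun_lam: "mor_comp (mag2 X) (fun1 F) (lam X) = mor_comp (mag2 X) (lam Y) (fun2 F)"
    and fun_kap: "mor_comp (mag2 X) (fun3 F) (kap X) = mor_comp (mag2 X) (kap Y) (fun2 F)"
    and fun_rho: "mor_comp (mag1 X) (fun2 F) (rho X) = mor_comp (mag1 X) (rho Y) (fun1 F)"

definition Weak_Omega_Cat :: "('u weak_omega_category, 'u omega_functor) category" where
  "Weak_Omega_Cat =
    \<lparr>Ob = {X. weak_omega_category X \<and> small_weak_omega_category X},
     Hom = (\<lambda>X Y. {F. omega_functor X Y F}),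
     Idn = (\<lambda>X. \<lparr>fun1 = mor_id (mag1 X), fun2 = mor_id (mag2 X), fun3 = mor_id (cat3 X)\<rparr>),
     Cmp = (\<lambda>X Y Z G F.
       \<lparr>fun1 = mor_comp (mag1 X) (fun1 G) (fun1 F),
        fun2 = mor_comp (mag2 X) (fun2 G) (fun2 F),
        fun3 = mor_comp (cat3 X) (fun3 G) (fun3 F)\<rparr>)\<rparr>"

definition Weak_2_Cat :: "('u weak_omega_category, 'u omega_functor) category" where
  "Weak_2_Cat = full_subcategory Weak_Omega_Cat (\<lambda>X. skeletal 2 (mag1 X))"


section \<open>Bicategories and strong homomorphisms\<close>

text \<open>
  Composition is written in diagrammatic order, as for omega magmas: for \<open>f : a \<rightarrow> b\<close> and
  \<open>g : b \<rightarrow> c\<close> the composite is \<open>hcomp1 B f g : a \<rightarrow> c\<close>. The hom-category \<open>B(a, b)\<close> consists of the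
  1-cells from \<open>a\<close> to \<open>b\<close> and the 2-cells between them under \<open>vcomp\<close>, and the functor
  \<open>B(a, b) \<times> B(b, c) \<rightarrow> B(a, c)\<close> is given by \<open>hcomp1\<close> and \<open>hcomp2\<close>. The structure 2-cells are
  \<open>alpha B f g h : (f g) h \<Rightarrow> f (g h)\<close>, \<open>lunit B f : 1 f \<Rightarrow> f\<close> and \<open>runit B f : f 1 \<Rightarrow> f\<close>.
\<close>

record 'u bicategory =
  cells0 :: "'u set"
  cells1 :: "'u set"
  cells2 :: "'u set"
  dom1 :: "'u \<Rightarrow> 'u"
  cod1 :: "'u \<Rightarrow> 'u"
  dom2 :: "'u \<Rightarrow> 'u"
  cod2 :: "'u \<Rightarrow> 'u"
  id1 :: "'u \<Rightarrow> 'u"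
  id2 :: "'u \<Rightarrow> 'u"
  vcomp :: "'u \<Rightarrow> 'u \<Rightarrow> 'u"
  hcomp1 :: "'u \<Rightarrow> 'u \<Rightarrow> 'u"
  hcomp2 :: "'u \<Rightarrow> 'u \<Rightarrow> 'u"
  alpha :: "'u \<Rightarrow> 'u \<Rightarrow> 'u \<Rightarrow> 'u"
  lunit :: "'u \<Rightarrow> 'u"
  runit :: "'u \<Rightarrow> 'u"

definition hcomposable1 :: "'u bicategory \<Rightarrow> 'u \<Rightarrow> 'u \<Rightarrow> bool" where
  "hcomposable1 B f g \<longleftrightarrow> f \<in> cells1 B \<and> g \<in> cells1 B \<and> cod1 B f = dom1 B g"

definition vcomposable :: "'u bicategory \<Rightarrow> 'u \<Rightarrow> 'u \<Rightarrow> bool" where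
  "vcomposable B x y \<longleftrightarrow> x \<in> cells2 B \<and> y \<in> cells2 B \<and> cod2 B x = dom2 B y"

definition hcomposable2 :: "'u bicategory \<Rightarrow> 'u \<Rightarrow> 'u \<Rightarrow> bool" where
  "hcomposable2 B x y \<longleftrightarrow>
    x \<in> cells2 B \<and> y \<in> cells2 B \<and> cod1 B (dom2 B x) = dom1 B (dom2 B y)"

definition two_cell :: "'u bicategory \<Rightarrow> 'u \<Rightarrow> 'u \<Rightarrow> 'u \<Rightarrow> bool" where
  "two_cell B x f g \<longleftrightarrow> x \<in> cells2 B \<and> dom2 B x = f \<and> cod2 B x = g"

definition invertible2 :: "'u bicategory \<Rightarrow> 'u \<Rightarrow> bool" where
  "invertible2 B x \<longleftrightarrow> (\<exists>y. two_cell B y (cod2 B x) (dom2 B x) \<and>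
    vcomp B x y = id2 B (dom2 B x) \<and> vcomp B y x = id2 B (cod2 B x))"

locale bicategory =
  fixes B :: "'u bicategory"
  assumes dom1_in: "dom1 B \<in> cells1 B \<rightarrow>\<^sub>E cells0 B"
    and cod1_in: "cod1 B \<in> cells1 B \<rightarrow>\<^sub>E cells0 B"
    and dom2_in: "dom2 B \<in> cells2 B \<rightarrow>\<^sub>E cells1 B"
    and cod2_in: "cod2 B \<in> cells2 B \<rightarrow>\<^sub>E cells1 B"
    and dom1_dom2: "x \<in> cells2 B \<Longrightarrow> dom1 B (dom2 B x) = dom1 B (cod2 B x)"
    and cod1_dom2: "x \<in> cells2 B \<Longrightarrow> cod1 B (dom2 B x) = cod1 B (cod2 B x)"
    \<comment> \<open>hom-categories\<close>
    and id2_in: "id2 B \<in> cells1 B \<rightarrow>\<^sub>E cells2 B"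
    and id2_cell: "f \<in> cells1 B \<Longrightarrow> two_cell B (id2 B f) f f"
    and vcomp_cell: "vcomposable B x y \<Longrightarrow> two_cell B (vcomp B x y) (dom2 B x) (cod2 B y)"
    and vcomp_undefined: "\<not> vcomposable B x y \<Longrightarrow> vcomp B x y = undefined"
    and vcomp_assoc: "\<lbrakk>vcomposable B x y; vcomposable B y z\<rbrakk>
      \<Longrightarrow> vcomp B (vcomp B x y) z = vcomp B x (vcomp B y z)"
    and vcomp_id_left: "x \<in> cells2 B \<Longrightarrow> vcomp B (id2 B (dom2 B x)) x = x"
    and vcomp_id_right: "x \<in> cells2 B \<Longrightarrow> vcomp B x (id2 B (cod2 B x)) = x"
    \<comment> \<open>identity 1-cells and composition functors\<close>
    and id1_in: "id1 B \<in> cells0 B \<rightarrow>\<^sub>E cells1 B"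
    and dom1_id1: "a \<in> cells0 B \<Longrightarrow> dom1 B (id1 B a) = a"
    and cod1_id1: "a \<in> cells0 B \<Longrightarrow> cod1 B (id1 B a) = a"
    and hcomp1_in: "hcomposable1 B f g \<Longrightarrow> hcomp1 B f g \<in> cells1 B"
    and hcomp1_undefined: "\<not> hcomposable1 B f g \<Longrightarrow> hcomp1 B f g = undefined"
    and dom1_hcomp1: "hcomposable1 B f g \<Longrightarrow> dom1 B (hcomp1 B f g) = dom1 B f"
    and cod1_hcomp1: "hcomposable1 B f g \<Longrightarrow> cod1 B (hcomp1 B f g) = cod1 B g"
    and hcomp2_cell: "hcomposable2 B x y \<Longrightarrow>
      two_cell B (hcomp2 B x y) (hcomp1 B (dom2 B x) (dom2 B y)) (hcomp1 B (cod2 B x) (cod2 B y))"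
    and hcomp2_undefined: "\<not> hcomposable2 B x y \<Longrightarrow> hcomp2 B x y = undefined"
    and hcomp2_id2: "hcomposable1 B f g \<Longrightarrow> hcomp2 B (id2 B f) (id2 B g) = id2 B (hcomp1 B f g)"
    and hcomp2_vcomp: "\<lbrakk>vcomposable B x x'; vcomposable B y y'; hcomposable2 B x y\<rbrakk>
      \<Longrightarrow> hcomp2 B (vcomp B x x') (vcomp B y y') = vcomp B (hcomp2 B x y) (hcomp2 B x' y')"
    \<comment> \<open>associativity isomorphisms\<close>
    and alpha_cell: "\<lbrakk>hcomposable1 B f g; hcomposable1 B g h\<rbrakk>
      \<Longrightarrow> two_cell B (alpha B f g h) (hcomp1 B (hcomp1 B f g) h) (hcomp1 B f (hcomp1 B g h))"
    and alpha_undefined: "\<not> (hcomposable1 B f g \<and> hcomposable1 B g h)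
      \<Longrightarrow> alpha B f g h = undefined"
    and alpha_invertible: "\<lbrakk>hcomposable1 B f g; hcomposable1 B g h\<rbrakk>
      \<Longrightarrow> invertible2 B (alpha B f g h)"
    and alpha_natural: "\<lbrakk>hcomposable2 B x y; hcomposable2 B y z\<rbrakk>
      \<Longrightarrow> vcomp B (hcomp2 B (hcomp2 B x y) z) (alpha B (cod2 B x) (cod2 B y) (cod2 B z)) =
          vcomp B (alpha B (dom2 B x) (dom2 B y) (dom2 B z)) (hcomp2 B x (hcomp2 B y z))"
    \<comment> \<open>unit isomorphisms\<close>
    and lunit_in: "lunit B \<in> cells1 B \<rightarrow>\<^sub>E cells2 B"
    and lunit_cell: "f \<in> cells1 B \<Longrightarrow> two_cell B (lunit B f) (hcomp1 B (id1 B (dom1 B f)) f) f"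
    and lunit_invertible: "f \<in> cells1 B \<Longrightarrow> invertible2 B (lunit B f)"
    and lunit_natural: "x \<in> cells2 B \<Longrightarrow>
      vcomp B (hcomp2 B (id2 B (id1 B (dom1 B (dom2 B x)))) x) (lunit B (cod2 B x)) =
      vcomp B (lunit B (dom2 B x)) x"
    and runit_in: "runit B \<in> cells1 B \<rightarrow>\<^sub>E cells2 B"
    and runit_cell: "f \<in> cells1 B \<Longrightarrow> two_cell B (runit B f) (hcomp1 B f (id1 B (cod1 B f))) f"
    and runit_invertible: "f \<in> cells1 B \<Longrightarrow> invertible2 B (runit B f)"
    and runit_natural: "x \<in> cells2 B \<Longrightarrow>
      vcomp B (hcomp2 B x (id2 B (id1 B (cod1 B (dom2 B x))))) (runit B (cod2 B x)) =
      vcomp B (runit B (dom2 B x)) x"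
    \<comment> \<open>coherence\<close>
    and pentagon: "\<lbrakk>hcomposable1 B f g; hcomposable1 B g h; hcomposable1 B h k\<rbrakk>
      \<Longrightarrow> vcomp B (alpha B (hcomp1 B f g) h k) (alpha B f g (hcomp1 B h k)) =
          vcomp B (hcomp2 B (alpha B f g h) (id2 B k))
            (vcomp B (alpha B f (hcomp1 B g h) k) (hcomp2 B (id2 B f) (alpha B g h k)))"
    and triangle: "hcomposable1 B f g
      \<Longrightarrow> vcomp B (alpha B f (id1 B (cod1 B f)) g) (hcomp2 B (id2 B f) (lunit B g)) =
          hcomp2 B (runit B f) (id2 B g)"

definition small_bicategory :: "'u bicategory \<Rightarrow> bool" where
  "small_bicategory B \<longleftrightarrow> small (cells0 B) \<and> small (cells1 B) \<and> small (cells2 B)"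

record 'u bicat_hom =
  map0 :: "'u \<Rightarrow> 'u"
  map1 :: "'u \<Rightarrow> 'u"
  map2 :: "'u \<Rightarrow> 'u"

locale strong_homomorphism =
  fixes B B' :: "'u bicategory" and F :: "'u bicat_hom"
  assumes map0_in: "map0 F \<in> cells0 B \<rightarrow>\<^sub>E cells0 B'"
    and map1_in: "map1 F \<in> cells1 B \<rightarrow>\<^sub>E cells1 B'"
    and map2_in: "map2 F \<in> cells2 B \<rightarrow>\<^sub>E cells2 B'"
    and map_dom1: "f \<in> cells1 B \<Longrightarrow> map0 F (dom1 B f) = dom1 B' (map1 F f)"
    and map_cod1: "f \<in> cells1 B \<Longrightarrow> map0 F (cod1 B f) = cod1 B' (map1 F f)"
    and map_dom2: "x \<in> cells2 B \<Longrightarrow> map1 F (dom2 B x) = dom2 B' (map2 F x)"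
    and map_cod2: "x \<in> cells2 B \<Longrightarrow> map1 F (cod2 B x) = cod2 B' (map2 F x)"
    and map_id1: "a \<in> cells0 B \<Longrightarrow> map1 F (id1 B a) = id1 B' (map0 F a)"
    and map_id2: "f \<in> cells1 B \<Longrightarrow> map2 F (id2 B f) = id2 B' (map1 F f)"
    and map_vcomp: "vcomposable B x y
      \<Longrightarrow> map2 F (vcomp B x y) = vcomp B' (map2 F x) (map2 F y)"
    and map_hcomp1: "hcomposable1 B f g
      \<Longrightarrow> map1 F (hcomp1 B f g) = hcomp1 B' (map1 F f) (map1 F g)"
    and map_hcomp2: "hcomposable2 B x y
      \<Longrightarrow> map2 F (hcomp2 B x y) = hcomp2 B' (map2 F x) (map2 F y)"
    and map_alpha: "\<lbrakk>hcomposable1 B f g; hcomposable1 B g h\<rbrakk>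
      \<Longrightarrow> map2 F (alpha B f g h) = alpha B' (map1 F f) (map1 F g) (map1 F h)"
    and map_lunit: "f \<in> cells1 B \<Longrightarrow> map2 F (lunit B f) = lunit B' (map1 F f)"
    and map_runit: "f \<in> cells1 B \<Longrightarrow> map2 F (runit B f) = runit B' (map1 F f)"

definition Bicat :: "('u bicategory, 'u bicat_hom) category" where
  "Bicat =
    \<lparr>Ob = {B. bicategory B \<and> small_bicategory B},
     Hom = (\<lambda>B B'. {F. strong_homomorphism B B' F}),
     Idn = (\<lambda>B. \<lparr>map0 = (\<lambda>a\<in>cells0 B. a), map1 = (\<lambda>f\<in>cells1 B. f), map2 = (\<lambda>x\<in>cells2 B. x)\<rparr>),
     Cmp = (\<lambda>B B' B'' G F.
       \<lparr>map0 = compose (cells0 B) (map0 G) (map0 F),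
        map1 = compose (cells1 B) (map1 G) (map1 F),
        map2 = compose (cells2 B) (map2 G) (map2 F)\<rparr>)\<rparr>"

end

theory Submission imports Defs begin

text \<open>
  From a weak 2-category one reads off cells, composites and units of \<open>mag1\<close>; the associator of
  \<open>f, g, h\<close> is the image under \<open>lam\<close> of the bridge from \<open>(\<rho>f \<rho>g) \<rho>h\<close> to \<open>\<rho>f (\<rho>g \<rho>h)\<close>. Since
  \<open>\<rho>\<close> need not preserve composition, nothing relates the associators of \<open>fg, h, k\<close> to the bridge out
  of \<open>((\<rho>f \<rho>g) \<rho>h) \<rho>k\<close>, and the pentagon may fail. All missing axioms are equations between
  2-cells, so they are forced by identifying parallel 2-cells that no structure preserving map
  into a bicategory separates; this quotient is functorial and does not change a bicategory.

  Conversely, for a bicategory \<open>B\<close> take as 1-cells of \<open>mag2\<close> the trees of composable 1-cells of \<open>B\<close>,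
  as 2-cells the 2-cells of \<open>B\<close> between the values of two trees, and let \<open>cat3\<close> be the part of this
  spanned by the trees in normal form (right bracketed, without identities). Coherence gives a
  canonical isomorphism \<open>nf_cell\<close> from a tree to its normal form, and conjugation by it is \<open>kap\<close>. A
  bridge between two trees is the canonical isomorphism between them; between \<open>(fg)h\<close> and \<open>f(gh)\<close> it
  is the associator, so that \<open>B\<close> is recovered on the nose.
\<close>

section \<open>Calculations in a bicategory\<close>

text \<open>Two parallel composites of structure cells must be shown equal before a bridge relation
  on trees can exist, since a bridge is determined by its ends. The proof of this coherence theorem
  lets trees act on trees from the left: a 2-cell between two trees counts as canonical if it is
  compatible with the actions of both on every third tree. This property passes to composites,
  inverses and whiskerings and holds for the structure cells. Tested on an identity it already
  determines the 2-cell. In the other direction, identifying 2-cells forces equations but does not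
  by itself supply inverses. Invertibility of the structure cells is therefore proved before the
  quotient, from bridges in both directions and from the fact that 3-cells of \<open>mag1\<close>
  are identities. The congruence is not generated from the missing axioms but is the common kernel
  of all homomorphisms into bicategories; an axiom holds in the quotient because it holds in every
  target. Trees over a finite set already form a countably infinite set. Such sets have to be small,
  which is what an uncountable universe guarantees.\<close>

locale pre_bicategory =
  fixes B :: "'u bicategory"
  assumes dom1_in: "dom1 B \<in> cells1 B \<rightarrow>\<^sub>E cells0 B"
    and cod1_in: "cod1 B \<in> cells1 B \<rightarrow>\<^sub>E cells0 B"
    and dom2_in: "dom2 B \<in> cells2 B \<rightarrow>\<^sub>E cells1 B"
    and cod2_in: "cod2 B \<in> cells2 B \<rightarrow>\<^sub>E cells1 B"
    and dom1_dom2: "x \<in> cells2 B \<Longrightarrow> dom1 B (dom2 B x) = dom1 B (cod2 B x)"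
    and cod1_dom2: "x \<in> cells2 B \<Longrightarrow> cod1 B (dom2 B x) = cod1 B (cod2 B x)"
    and id2_cell: "f \<in> cells1 B \<Longrightarrow> two_cell B (id2 B f) f f"
    and vcomp_cell: "vcomposable B x y \<Longrightarrow> two_cell B (vcomp B x y) (dom2 B x) (cod2 B y)"
    and id1_in: "id1 B \<in> cells0 B \<rightarrow>\<^sub>E cells1 B"
    and dom1_id1: "a \<in> cells0 B \<Longrightarrow> dom1 B (id1 B a) = a"
    and cod1_id1: "a \<in> cells0 B \<Longrightarrow> cod1 B (id1 B a) = a"
    and hcomp1_in: "hcomposable1 B f g \<Longrightarrow> hcomp1 B f g \<in> cells1 B"
    and hcomp1_undefined: "\<not> hcomposable1 B f g \<Longrightarrow> hcomp1 B f g = undefined"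
    and dom1_hcomp1: "hcomposable1 B f g \<Longrightarrow> dom1 B (hcomp1 B f g) = dom1 B f"
    and cod1_hcomp1: "hcomposable1 B f g \<Longrightarrow> cod1 B (hcomp1 B f g) = cod1 B g"
    and hcomp2_cell: "hcomposable2 B x y \<Longrightarrow>
      two_cell B (hcomp2 B x y) (hcomp1 B (dom2 B x) (dom2 B y)) (hcomp1 B (cod2 B x) (cod2 B y))"
    and alpha_cell: "\<lbrakk>hcomposable1 B f g; hcomposable1 B g h\<rbrakk>
      \<Longrightarrow> two_cell B (alpha B f g h) (hcomp1 B (hcomp1 B f g) h) (hcomp1 B f (hcomp1 B g h))"
    and alpha_invertible: "\<lbrakk>hcomposable1 B f g; hcomposable1 B g h\<rbrakk>
      \<Longrightarrow> invertible2 B (alpha B f g h)"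
    and lunit_cell: "f \<in> cells1 B \<Longrightarrow> two_cell B (lunit B f) (hcomp1 B (id1 B (dom1 B f)) f) f"
    and lunit_invertible: "f \<in> cells1 B \<Longrightarrow> invertible2 B (lunit B f)"
    and runit_cell: "f \<in> cells1 B \<Longrightarrow> two_cell B (runit B f) (hcomp1 B f (id1 B (cod1 B f))) f"
    and runit_invertible: "f \<in> cells1 B \<Longrightarrow> invertible2 B (runit B f)"
begin

abbreviation C0 where "C0 \<equiv> cells0 B"
abbreviation C1 where "C1 \<equiv> cells1 B"
abbreviation C2 where "C2 \<equiv> cells2 B"
abbreviation s1 where "s1 \<equiv> dom1 B"
abbreviation t1 where "t1 \<equiv> cod1 B"
abbreviation s2 where "s2 \<equiv> dom2 B"
abbreviation t2 where "t2 \<equiv> cod2 B"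
abbreviation I1 where "I1 \<equiv> id1 B"
abbreviation I2 where "I2 \<equiv> id2 B"
abbreviation V (infixr \<open>\<cdot>\<close> 60) where "x \<cdot> y \<equiv> vcomp B x y"
abbreviation H1 (infixr \<open>\<odot>\<close> 70) where "f \<odot> g \<equiv> hcomp1 B f g"
abbreviation H2 (infixr \<open>\<star>\<close> 70) where "x \<star> y \<equiv> hcomp2 B x y"

lemma typing0 [simp]:
  "f \<in> C1 \<Longrightarrow> s1 f \<in> C0" "f \<in> C1 \<Longrightarrow> t1 f \<in> C0"
  "x \<in> C2 \<Longrightarrow> s2 x \<in> C1" "x \<in> C2 \<Longrightarrow> t2 x \<in> C1"
  "x \<in> C2 \<Longrightarrow> s1 (t2 x) = s1 (s2 x)" "x \<in> C2 \<Longrightarrow> t1 (t2 x) = t1 (s2 x)"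
  using dom1_in cod1_in dom2_in cod2_in dom1_dom2 cod1_dom2 by (auto simp: PiE_iff)

lemma typing1 [simp]:
  "a \<in> C0 \<Longrightarrow> I1 a \<in> C1" "a \<in> C0 \<Longrightarrow> s1 (I1 a) = a" "a \<in> C0 \<Longrightarrow> t1 (I1 a) = a"
  "\<lbrakk>f \<in> C1; g \<in> C1; t1 f = s1 g\<rbrakk> \<Longrightarrow> f \<odot> g \<in> C1"
  "\<lbrakk>f \<in> C1; g \<in> C1; t1 f = s1 g\<rbrakk> \<Longrightarrow> s1 (f \<odot> g) = s1 f"
  "\<lbrakk>f \<in> C1; g \<in> C1; t1 f = s1 g\<rbrakk> \<Longrightarrow> t1 (f \<odot> g) = t1 g"
  using id1_in dom1_id1 cod1_id1 hcomp1_in dom1_hcomp1 cod1_hcomp1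
  by (auto simp: hcomposable1_def)

lemma typing2 [simp]:
  "f \<in> C1 \<Longrightarrow> I2 f \<in> C2" "f \<in> C1 \<Longrightarrow> s2 (I2 f) = f" "f \<in> C1 \<Longrightarrow> t2 (I2 f) = f"
  "\<lbrakk>x \<in> C2; y \<in> C2; t2 x = s2 y\<rbrakk> \<Longrightarrow> x \<cdot> y \<in> C2"
  "\<lbrakk>x \<in> C2; y \<in> C2; t2 x = s2 y\<rbrakk> \<Longrightarrow> s2 (x \<cdot> y) = s2 x"
  "\<lbrakk>x \<in> C2; y \<in> C2; t2 x = s2 y\<rbrakk> \<Longrightarrow> t2 (x \<cdot> y) = t2 y"
  "\<lbrakk>x \<in> C2; y \<in> C2; t1 (s2 x) = s1 (s2 y)\<rbrakk> \<Longrightarrow> x \<star> y \<in> C2"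
  "\<lbrakk>x \<in> C2; y \<in> C2; t1 (s2 x) = s1 (s2 y)\<rbrakk> \<Longrightarrow> s2 (x \<star> y) = s2 x \<odot> s2 y"
  "\<lbrakk>x \<in> C2; y \<in> C2; t1 (s2 x) = s1 (s2 y)\<rbrakk> \<Longrightarrow> t2 (x \<star> y) = t2 x \<odot> t2 y"
  using id2_cell vcomp_cell hcomp2_cell
  by (auto simp: two_cell_def hcomposable2_def vcomposable_def)

lemma typing3 [simp]:
  "\<lbrakk>f \<in> C1; g \<in> C1; h \<in> C1; t1 f = s1 g; t1 g = s1 h\<rbrakk> \<Longrightarrow> alpha B f g h \<in> C2"
  "\<lbrakk>f \<in> C1; g \<in> C1; h \<in> C1; t1 f = s1 g; t1 g = s1 h\<rbrakk> \<Longrightarrow> s2 (alpha B f g h) = (f \<odot> g) \<odot> h"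
  "\<lbrakk>f \<in> C1; g \<in> C1; h \<in> C1; t1 f = s1 g; t1 g = s1 h\<rbrakk> \<Longrightarrow> t2 (alpha B f g h) = f \<odot> g \<odot> h"
  "f \<in> C1 \<Longrightarrow> lunit B f \<in> C2" "f \<in> C1 \<Longrightarrow> s2 (lunit B f) = I1 (s1 f) \<odot> f" "f \<in> C1 \<Longrightarrow> t2 (lunit B f) = f"
  "f \<in> C1 \<Longrightarrow> runit B f \<in> C2" "f \<in> C1 \<Longrightarrow> s2 (runit B f) = f \<odot> I1 (t1 f)" "f \<in> C1 \<Longrightarrow> t2 (runit B f) = f"
  using alpha_cell lunit_cell runit_cell by (auto simp: two_cell_def hcomposable1_def)

text \<open>As rewrite rules these compute boundaries of images inside \<open>B\<close> and push the
  maps into the operations, so that side conditions about \<open>B'\<close> become side conditions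
  about \<open>B\<close>. Nothing is assumed of \<open>B'\<close>, hence they also serve for maps
  between pre-bicategories.\<close>

lemma hom_simps:
  assumes "strong_homomorphism B B' F"
  shows "a \<in> C0 \<Longrightarrow> map0 F a \<in> cells0 B'" "f \<in> C1 \<Longrightarrow> map1 F f \<in> cells1 B'" "x \<in> C2 \<Longrightarrow> map2 F x \<in> cells2 B'"
    "f \<in> C1 \<Longrightarrow> dom1 B' (map1 F f) = map0 F (s1 f)" "f \<in> C1 \<Longrightarrow> cod1 B' (map1 F f) = map0 F (t1 f)"
    "x \<in> C2 \<Longrightarrow> dom2 B' (map2 F x) = map1 F (s2 x)" "x \<in> C2 \<Longrightarrow> cod2 B' (map2 F x) = map1 F (t2 x)"
    "a \<in> C0 \<Longrightarrow> map1 F (I1 a) = id1 B' (map0 F a)" "f \<in> C1 \<Longrightarrow> map2 F (I2 f) = id2 B' (map1 F f)"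
    "\<lbrakk>x \<in> C2; y \<in> C2; t2 x = s2 y\<rbrakk> \<Longrightarrow> map2 F (x \<cdot> y) = vcomp B' (map2 F x) (map2 F y)"
    "\<lbrakk>f \<in> C1; g \<in> C1; t1 f = s1 g\<rbrakk> \<Longrightarrow> map1 F (f \<odot> g) = hcomp1 B' (map1 F f) (map1 F g)"
    "\<lbrakk>x \<in> C2; y \<in> C2; t1 (s2 x) = s1 (s2 y)\<rbrakk> \<Longrightarrow> map2 F (x \<star> y) = hcomp2 B' (map2 F x) (map2 F y)"
    "\<lbrakk>f \<in> C1; g \<in> C1; h \<in> C1; t1 f = s1 g; t1 g = s1 h\<rbrakk>
      \<Longrightarrow> map2 F (alpha B f g h) = alpha B' (map1 F f) (map1 F g) (map1 F h)"
    "f \<in> C1 \<Longrightarrow> map2 F (lunit B f) = lunit B' (map1 F f)"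
    "f \<in> C1 \<Longrightarrow> map2 F (runit B f) = runit B' (map1 F f)"
proof -
  interpret strong_homomorphism B B' F by fact
  show "a \<in> C0 \<Longrightarrow> map0 F a \<in> cells0 B'" "f \<in> C1 \<Longrightarrow> map1 F f \<in> cells1 B'" "x \<in> C2 \<Longrightarrow> map2 F x \<in> cells2 B'"
    using map0_in map1_in map2_in by auto
qed (simp_all add: assms[THEN strong_homomorphism.map_dom1] assms[THEN strong_homomorphism.map_cod1]
  assms[THEN strong_homomorphism.map_dom2] assms[THEN strong_homomorphism.map_cod2]
  assms[THEN strong_homomorphism.map_id1] assms[THEN strong_homomorphism.map_id2]
  assms[THEN strong_homomorphism.map_vcomp] assms[THEN strong_homomorphism.map_hcomp1]
  assms[THEN strong_homomorphism.map_hcomp2] assms[THEN strong_homomorphism.map_alpha]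
  assms[THEN strong_homomorphism.map_lunit] assms[THEN strong_homomorphism.map_runit]
  vcomposable_def hcomposable1_def hcomposable2_def)

end

text \<open>\<open>pre_bicategory\<close> keeps typing, boundaries and the invertibility of the
  structure cells and leaves out the laws between 2-cells. Extensionality is dropped for
  \<open>id2\<close>, \<open>vcomp\<close>, \<open>hcomp2\<close> and the structure cells, which
  \<open>reflect\<close> redefines anyway.\<close>

sublocale bicategory \<subseteq> pre_bicategory
  using bicategory_axioms by (simp add: bicategory_def pre_bicategory_def)

definition inv2 :: "'u bicategory \<Rightarrow> 'u \<Rightarrow> 'u" where
  "inv2 B x = (SOME y. two_cell B y (cod2 B x) (dom2 B x) \<and>
    vcomp B x y = id2 B (dom2 B x) \<and> vcomp B y x = id2 B (cod2 B x))"

context bicategory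
begin

lemma v_assoc [simp]:
  "\<lbrakk>x \<in> C2; y \<in> C2; z \<in> C2; t2 x = s2 y; t2 y = s2 z\<rbrakk> \<Longrightarrow> (x \<cdot> y) \<cdot> z = x \<cdot> y \<cdot> z"
  by (simp add: vcomp_assoc vcomposable_def)

lemma v_id [simp]:
  "\<lbrakk>x \<in> C2; s2 x = f\<rbrakk> \<Longrightarrow> I2 f \<cdot> x = x" "\<lbrakk>x \<in> C2; t2 x = f\<rbrakk> \<Longrightarrow> x \<cdot> I2 f = x"
  using vcomp_id_left vcomp_id_right by auto

lemma h_id [simp]: "\<lbrakk>f \<in> C1; g \<in> C1; t1 f = s1 g\<rbrakk> \<Longrightarrow> I2 f \<star> I2 g = I2 (f \<odot> g)"
  by (simp add: hcomp2_id2 hcomposable1_def)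

lemma interchange:
  "\<lbrakk>x \<in> C2; y \<in> C2; x' \<in> C2; y' \<in> C2; t2 x = s2 x'; t2 y = s2 y'; t1 (s2 x) = s1 (s2 y)\<rbrakk>
    \<Longrightarrow> (x \<cdot> x') \<star> (y \<cdot> y') = (x \<star> y) \<cdot> (x' \<star> y')"
  by (simp add: hcomp2_vcomp hcomposable2_def vcomposable_def)

lemma whisker_left:
  "\<lbrakk>f \<in> C1; y \<in> C2; y' \<in> C2; t2 y = s2 y'; t1 f = s1 (s2 y)\<rbrakk>
    \<Longrightarrow> I2 f \<star> (y \<cdot> y') = (I2 f \<star> y) \<cdot> (I2 f \<star> y')"
  using interchange[of "I2 f" y "I2 f" y'] by simp

lemma whisker_right:
  "\<lbrakk>f \<in> C1; y \<in> C2; y' \<in> C2; t2 y = s2 y'; t1 (s2 y) = s1 f\<rbrakk>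
    \<Longrightarrow> (y \<cdot> y') \<star> I2 f = (y \<star> I2 f) \<cdot> (y' \<star> I2 f)"
  using interchange[of y "I2 f" y' "I2 f"] by simp

lemma inv2_props:
  assumes "invertible2 B x" "x \<in> C2"
  shows "inv2 B x \<in> C2" "s2 (inv2 B x) = t2 x" "t2 (inv2 B x) = s2 x"
    "x \<cdot> inv2 B x = I2 (s2 x)" "inv2 B x \<cdot> x = I2 (t2 x)"
  using someI_ex[OF assms(1)[unfolded invertible2_def]]
  unfolding inv2_def two_cell_def by blast+

lemma invertible2I:
  "\<lbrakk>y \<in> C2; s2 y = t2 x; t2 y = s2 x; x \<cdot> y = I2 (s2 x); y \<cdot> x = I2 (t2 x)\<rbrakk> \<Longrightarrow> invertible2 B x"
  unfolding invertible2_def two_cell_def by blast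

lemma invertible2_inv2: "\<lbrakk>invertible2 B x; x \<in> C2\<rbrakk> \<Longrightarrow> invertible2 B (inv2 B x)"
  by (rule invertible2I[where y = x]) (auto simp: inv2_props)

lemma invertible2_id: "f \<in> C1 \<Longrightarrow> invertible2 B (I2 f)"
  by (rule invertible2I[where y = "I2 f"]) auto

lemma cancel_left:
  assumes "x \<cdot> y = x \<cdot> z" "invertible2 B x" "x \<in> C2" "y \<in> C2" "z \<in> C2" "t2 x = s2 y" "t2 x = s2 z"
  shows "y = z"
proof -
  note i = inv2_props[OF assms(2,3)]
  have "y = (inv2 B x \<cdot> x) \<cdot> y" using i assms(4,6) by simp
  also have "\<dots> = inv2 B x \<cdot> (x \<cdot> y)" using i(1-3) assms(3-) by (simp del: i(5))
  also have "\<dots> = inv2 B x \<cdot> (x \<cdot> z)" using assms(1) by simp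
  also have "\<dots> = (inv2 B x \<cdot> x) \<cdot> z" using i(1-3) assms(3-) by simp
  also have "\<dots> = z" using i assms(5,7) by simp
  finally show ?thesis .
qed

lemma cancel_right:
  assumes "y \<cdot> x = z \<cdot> x" "invertible2 B x" "x \<in> C2" "y \<in> C2" "z \<in> C2" "t2 y = s2 x" "t2 z = s2 x"
  shows "y = z"
proof -
  note i = inv2_props[OF assms(2,3)]
  have "y = y \<cdot> (x \<cdot> inv2 B x)" using i assms(4,6) by simp
  also have "\<dots> = (y \<cdot> x) \<cdot> inv2 B x" using i(1-3) assms(3-) by simp
  also have "\<dots> = (z \<cdot> x) \<cdot> inv2 B x" using assms(1) by simp
  also have "\<dots> = z \<cdot> (x \<cdot> inv2 B x)" using i(1-3) assms(3-) by simp
  also have "\<dots> = z" using i assms(5,7) by simp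
  finally show ?thesis .
qed

lemma invertible2_vcomp:
  assumes "invertible2 B x" "invertible2 B y" "x \<in> C2" "y \<in> C2" "t2 x = s2 y"
  shows "invertible2 B (x \<cdot> y)"
proof -
  note i = inv2_props[OF assms(1,3)] inv2_props[OF assms(2,4)]
  have "(x \<cdot> y) \<cdot> inv2 B y \<cdot> inv2 B x = x \<cdot> (y \<cdot> inv2 B y) \<cdot> inv2 B x"
    using assms(3-) i(1-3,6-8) by simp
  moreover have "(inv2 B y \<cdot> inv2 B x) \<cdot> x \<cdot> y = inv2 B y \<cdot> (inv2 B x \<cdot> x) \<cdot> y"
    using assms i(1-3,6-8) by simp
  ultimately show ?thesis
    using assms i by (intro invertible2I[where y = "inv2 B y \<cdot> inv2 B x"]) auto
qed

lemma invertible2_hcomp: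
  assumes "invertible2 B x" "invertible2 B y" "x \<in> C2" "y \<in> C2" "t1 (s2 x) = s1 (s2 y)"
  shows "invertible2 B (x \<star> y)"
proof -
  note i = inv2_props[OF assms(1,3)] inv2_props[OF assms(2,4)]
  show ?thesis
    using assms i
    by (intro invertible2I[where y = "inv2 B x \<star> inv2 B y"]) (auto simp: interchange[symmetric])
qed

lemma invertible2_alpha: "\<lbrakk>f \<in> C1; g \<in> C1; h \<in> C1; t1 f = s1 g; t1 g = s1 h\<rbrakk> \<Longrightarrow> invertible2 B (alpha B f g h)"
  by (simp add: alpha_invertible hcomposable1_def)

lemma alpha_nat:
  "\<lbrakk>x \<in> C2; y \<in> C2; z \<in> C2; t1 (s2 x) = s1 (s2 y); t1 (s2 y) = s1 (s2 z)\<rbrakk>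
    \<Longrightarrow> ((x \<star> y) \<star> z) \<cdot> alpha B (t2 x) (t2 y) (t2 z) = alpha B (s2 x) (s2 y) (s2 z) \<cdot> (x \<star> y \<star> z)"
  by (simp add: alpha_natural hcomposable2_def)

lemma pentagon':
  "\<lbrakk>f \<in> C1; g \<in> C1; h \<in> C1; k \<in> C1; t1 f = s1 g; t1 g = s1 h; t1 h = s1 k\<rbrakk>
    \<Longrightarrow> alpha B (f \<odot> g) h k \<cdot> alpha B f g (h \<odot> k) =
      (alpha B f g h \<star> I2 k) \<cdot> alpha B f (g \<odot> h) k \<cdot> (I2 f \<star> alpha B g h k)"
  by (simp add: pentagon hcomposable1_def)

lemma triangle':
  "\<lbrakk>f \<in> C1; g \<in> C1; t1 f = s1 g\<rbrakk>
    \<Longrightarrow> alpha B f (I1 (t1 f)) g \<cdot> (I2 f \<star> lunit B g) = runit B f \<star> I2 g"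
  using triangle[of f g] by (simp add: hcomposable1_def)

text \<open>Whiskering with an identity 1-cell is faithful: naturality of \<open>lunit\<close> turns
  the hypothesis into an equation of composites starting with \<open>lunit B (s2 x)\<close>, which
  cancels.\<close>

lemma whisker_unit_cancel:
  assumes "I2 (I1 a) \<star> x = I2 (I1 a) \<star> y" "x \<in> C2" "y \<in> C2" "s2 x = s2 y" "t2 x = t2 y" "s1 (s2 x) = a"
  shows "x = y"
proof -
  have "lunit B (s2 x) \<cdot> x = lunit B (s2 x) \<cdot> y"
    using lunit_natural[of x] lunit_natural[of y] assms by simp
  then show ?thesis
    by (rule cancel_left) (use assms lunit_invertible in auto)
qed

text \<open>Kelly's derivation of the left unit coherence from the pentagon and the triangle.\<close>

lemma lunit_hcomp:
  assumes [simp]: "f \<in> C1" "g \<in> C1" "t1 f = s1 g"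
  shows "alpha B (I1 (s1 f)) f g \<cdot> lunit B (f \<odot> g) = lunit B f \<star> I2 g"
proof -
  define u where "u = I1 (s1 f)"
  have u [simp]: "u \<in> C1" "s1 u = s1 f" "t1 u = s1 f" "I1 (s1 f) = u" by (auto simp: u_def)
  \<comment> \<open>The claim is reached after whiskering with \<open>u\<close> and precomposing
    with the invertible cells \<open>?p\<close> and \<open>?q\<close>. With these in front, the
    pentagon at \<open>u, u, f, g\<close> applies, the triangle brings in \<open>runit B u\<close>,
    and the triangle used backwards at \<open>u, f\<close> trades it for
    \<open>lunit B f\<close>.\<close>
  let ?p = "alpha B u u f \<star> I2 g" and ?q = "alpha B u (u \<odot> f) g"
  have "?p \<cdot> ?q \<cdot> (I2 u \<star> alpha B u f g) \<cdot> (I2 u \<star> lunit B (f \<odot> g))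
      = (?p \<cdot> ?q \<cdot> (I2 u \<star> alpha B u f g)) \<cdot> (I2 u \<star> lunit B (f \<odot> g))" by simp
  also have "\<dots> = (alpha B (u \<odot> u) f g \<cdot> alpha B u u (f \<odot> g)) \<cdot> (I2 u \<star> lunit B (f \<odot> g))"
    by (simp add: pentagon' del: v_assoc)
  also have "\<dots> = alpha B (u \<odot> u) f g \<cdot> (runit B u \<star> I2 (f \<odot> g))"
    using triangle'[of u "f \<odot> g"] by simp
  also have "\<dots> = ((runit B u \<star> I2 f) \<star> I2 g) \<cdot> alpha B u f g"
    using alpha_nat[of "runit B u" "I2 f" "I2 g"] by simp
  also have "\<dots> = ((alpha B u u f \<cdot> (I2 u \<star> lunit B f)) \<star> I2 g) \<cdot> alpha B u f g"
    using triangle'[of u f] by simp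
  also have "\<dots> = ?p \<cdot> ((I2 u \<star> lunit B f) \<star> I2 g) \<cdot> alpha B u f g"
    by (simp add: whisker_right)
  also have "\<dots> = ?p \<cdot> ?q \<cdot> (I2 u \<star> lunit B f \<star> I2 g)"
    using alpha_nat[of "I2 u" "lunit B f" "I2 g"] by simp
  finally have "?q \<cdot> (I2 u \<star> alpha B u f g) \<cdot> (I2 u \<star> lunit B (f \<odot> g)) = ?q \<cdot> (I2 u \<star> lunit B f \<star> I2 g)"
    by (rule cancel_left) (auto intro!: invertible2_hcomp invertible2_alpha invertible2_id)
  then have "(I2 u \<star> alpha B u f g) \<cdot> (I2 u \<star> lunit B (f \<odot> g)) = I2 u \<star> lunit B f \<star> I2 g"
    by (rule cancel_left) (auto intro!: invertible2_alpha)
  then have "I2 (I1 (s1 f)) \<star> (alpha B u f g \<cdot> lunit B (f \<odot> g)) = I2 (I1 (s1 f)) \<star> lunit B f \<star> I2 g"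
    by (simp add: whisker_left)
  then have "alpha B u f g \<cdot> lunit B (f \<odot> g) = lunit B f \<star> I2 g"
    by (rule whisker_unit_cancel) auto
  then show ?thesis by simp
qed

end

section \<open>Coherence\<close>

datatype (leaves: 'a) tree = Leaf 'a | Node "'a tree" "'a tree"

primrec ev :: "'u bicategory \<Rightarrow> 'u tree \<Rightarrow> 'u" where
  "ev B (Leaf f) = f"
| "ev B (Node s t) = hcomp1 B (ev B s) (ev B t)"

primrec tsrc :: "'u bicategory \<Rightarrow> 'u tree \<Rightarrow> 'u" where
  "tsrc B (Leaf f) = dom1 B f"
| "tsrc B (Node s t) = tsrc B s"

primrec ttgt :: "'u bicategory \<Rightarrow> 'u tree \<Rightarrow> 'u" where
  "ttgt B (Leaf f) = cod1 B f"
| "ttgt B (Node s t) = ttgt B t"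

primrec wf_tree :: "'u bicategory \<Rightarrow> 'u tree \<Rightarrow> bool" where
  "wf_tree B (Leaf f) \<longleftrightarrow> f \<in> cells1 B"
| "wf_tree B (Node s t) \<longleftrightarrow> wf_tree B s \<and> wf_tree B t \<and> ttgt B s = tsrc B t"

text \<open>\<open>act\<close> prefixes the non-identity leaves of its first argument one by one to the second, and
  \<open>act_cell\<close> is the canonical isomorphism from the composite of the two values. Identities have to
  disappear because \<open>kap\<close> preserves units.\<close>

primrec act :: "'u bicategory \<Rightarrow> 'u tree \<Rightarrow> 'u tree \<Rightarrow> 'u tree" where
  "act B (Leaf f) n = (if f = id1 B (dom1 B f) then n else Node (Leaf f) n)"
| "act B (Node s t) n = act B s (act B t n)"

primrec act_cell :: "'u bicategory \<Rightarrow> 'u tree \<Rightarrow> 'u tree \<Rightarrow> 'u" where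
  "act_cell B (Leaf f) n = (if f = id1 B (dom1 B f) then lunit B (ev B n) else id2 B (hcomp1 B f (ev B n)))"
| "act_cell B (Node s t) n = vcomp B (alpha B (ev B s) (ev B t) (ev B n))
    (vcomp B (hcomp2 B (id2 B (ev B s)) (act_cell B t n)) (act_cell B s (act B t n)))"

definition unit_tree :: "'u bicategory \<Rightarrow> 'u tree \<Rightarrow> 'u tree" where
  "unit_tree B t = Leaf (id1 B (ttgt B t))"

text \<open>The identity leaf seeds the recursion and stays behind as the last leaf of every normal
  form. Trees have no empty case, so this leaf also stands for the empty composite.\<close>

definition nf :: "'u bicategory \<Rightarrow> 'u tree \<Rightarrow> 'u tree" where
  "nf B t = act B t (unit_tree B t)"

text \<open>As the normal form ends in an identity leaf, the value \<open>f\<close> of the tree must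
  first be replaced by \<open>f 1\<close>; this is the role of the inverse of
  \<open>runit\<close>.\<close>

definition nf_cell :: "'u bicategory \<Rightarrow> 'u tree \<Rightarrow> 'u" where
  "nf_cell B t = vcomp B (inv2 B (runit B (ev B t))) (act_cell B t (unit_tree B t))"

text \<open>The property of being canonical, without an inductive definition: \<open>x\<close>
  carries the action of \<open>t\<close> to that of \<open>s\<close>. The test tree \<open>m\<close>
  is arbitrary because in \<open>Node s t\<close> the tree \<open>s\<close> acts not on
  \<open>m\<close> but on \<open>act B t m\<close>.\<close>

definition coherent :: "'u bicategory \<Rightarrow> 'u tree \<Rightarrow> 'u tree \<Rightarrow> 'u \<Rightarrow> bool" where
  "coherent B s t x \<longleftrightarrow> wf_tree B s \<and> wf_tree B t \<and> tsrc B s = tsrc B t \<and> ttgt B s = ttgt B t \<and>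
    x \<in> cells2 B \<and> dom2 B x = ev B s \<and> cod2 B x = ev B t \<and> invertible2 B x \<and>
    (\<forall>m. wf_tree B m \<and> tsrc B m = ttgt B s \<longrightarrow> act B s m = act B t m \<and>
      act_cell B s m = vcomp B (hcomp2 B x (id2 B (ev B m))) (act_cell B t m))"

context bicategory
begin

lemma ev_in [simp]:
  assumes "wf_tree B t"
  shows "ev B t \<in> C1" "s1 (ev B t) = tsrc B t" "t1 (ev B t) = ttgt B t" "tsrc B t \<in> C0" "ttgt B t \<in> C0"
proof -
  have "ev B t \<in> C1 \<and> s1 (ev B t) = tsrc B t \<and> t1 (ev B t) = ttgt B t \<and> tsrc B t \<in> C0 \<and> ttgt B t \<in> C0"
    using assms by (induction t) auto
  then show "ev B t \<in> C1" "s1 (ev B t) = tsrc B t" "t1 (ev B t) = ttgt B t" "tsrc B t \<in> C0" "ttgt B t \<in> C0"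
    by auto
qed

text \<open>When \<open>act\<close> drops a leaf recognized by its domain, the trees on both sides
  of it must still be composable.\<close>

lemma cod_of_unit: "\<lbrakk>f \<in> C1; f = I1 (s1 f)\<rbrakk> \<Longrightarrow> t1 f = s1 f"
  by (metis typing0(1) typing1(3))

lemma act_wf:
  "\<lbrakk>wf_tree B t; wf_tree B n; ttgt B t = tsrc B n\<rbrakk>
    \<Longrightarrow> wf_tree B (act B t n) \<and> tsrc B (act B t n) = tsrc B t \<and> ttgt B (act B t n) = ttgt B n"
  by (induction t arbitrary: n) (auto dest: cod_of_unit)

lemma act_wf' [simp]:
  assumes "wf_tree B t" "wf_tree B n" "ttgt B t = tsrc B n"
  shows "wf_tree B (act B t n)" "tsrc B (act B t n) = tsrc B t" "ttgt B (act B t n) = ttgt B n"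
  using act_wf[OF assms] by auto

lemma act_cell_in:
  "\<lbrakk>wf_tree B t; wf_tree B n; ttgt B t = tsrc B n\<rbrakk>
    \<Longrightarrow> act_cell B t n \<in> C2 \<and> s2 (act_cell B t n) = ev B t \<odot> ev B n \<and> t2 (act_cell B t n) = ev B (act B t n)"
proof (induction t arbitrary: n)
  case (Leaf f)
  then show ?case by (cases "f = I1 (s1 f)") (auto dest: cod_of_unit)
qed auto

lemma act_cell_in' [simp]:
  assumes "wf_tree B t" "wf_tree B n" "ttgt B t = tsrc B n"
  shows "act_cell B t n \<in> C2" "s2 (act_cell B t n) = ev B t \<odot> ev B n" "t2 (act_cell B t n) = ev B (act B t n)"
  using act_cell_in[OF assms] by auto

lemma act_cell_invertible:
  "\<lbrakk>wf_tree B t; wf_tree B n; ttgt B t = tsrc B n\<rbrakk> \<Longrightarrow> invertible2 B (act_cell B t n)"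
proof (induction t arbitrary: n)
  case (Leaf f)
  then show ?case by (auto intro: lunit_invertible invertible2_id)
next
  case (Node s t)
  then show ?case
    by (auto intro!: invertible2_vcomp invertible2_hcomp invertible2_alpha invertible2_id)
qed

lemma unit_tree [simp]:
  assumes "wf_tree B t"
  shows "wf_tree B (unit_tree B t)" "tsrc B (unit_tree B t) = ttgt B t" "ttgt B (unit_tree B t) = ttgt B t"
    "ev B (unit_tree B t) = I1 (ttgt B t)"
  using assms by (auto simp: unit_tree_def)

lemma nf_wf [simp]:
  assumes "wf_tree B t"
  shows "wf_tree B (nf B t)" "tsrc B (nf B t) = tsrc B t" "ttgt B (nf B t) = ttgt B t"
  using assms by (auto simp: nf_def)

text \<open>\<open>runit_nf_cell\<close> is the defining equation cleared of the inverse. Facts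
  about \<open>nf_cell\<close> are obtained by precomposing with \<open>runit\<close>, calculating,
  and cancelling it.\<close>

lemma nf_cell_in [simp]:
  assumes "wf_tree B t"
  shows "nf_cell B t \<in> C2" "s2 (nf_cell B t) = ev B t" "t2 (nf_cell B t) = ev B (nf B t)"
    and runit_nf_cell: "runit B (ev B t) \<cdot> nf_cell B t = act_cell B t (unit_tree B t)"
    and nf_cell_invertible: "invertible2 B (nf_cell B t)"
proof -
  let ?r = "runit B (ev B t)"
  have r: "invertible2 B ?r" "?r \<in> C2" using assms runit_invertible by auto
  note i = inv2_props[OF r]
  show "nf_cell B t \<in> C2" "s2 (nf_cell B t) = ev B t" "t2 (nf_cell B t) = ev B (nf B t)"
    using assms i by (auto simp: nf_cell_def nf_def)
  have "?r \<cdot> nf_cell B t = (?r \<cdot> inv2 B ?r) \<cdot> act_cell B t (unit_tree B t)"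
    using assms i(1-3) unfolding nf_cell_def by simp
  then show "?r \<cdot> nf_cell B t = act_cell B t (unit_tree B t)"
    using assms i by simp
  show "invertible2 B (nf_cell B t)"
    unfolding nf_cell_def using assms r i
    by (auto intro!: invertible2_vcomp invertible2_inv2 act_cell_invertible)
qed

section \<open>Closure properties of coherent 2-cells\<close>

lemma coherentD:
  assumes "coherent B s t x"
  shows "wf_tree B s" "wf_tree B t" "tsrc B s = tsrc B t" "ttgt B s = ttgt B t"
    "x \<in> C2" "s2 x = ev B s" "t2 x = ev B t" "invertible2 B x"
  using assms by (auto simp: coherent_def)

lemma coherent_act:
  assumes "coherent B s t x" "wf_tree B m" "tsrc B m = ttgt B t"
  shows "act B s m = act B t m" "act_cell B s m = (x \<star> I2 (ev B m)) \<cdot> act_cell B t m"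
  using assms by (auto simp: coherent_def)

lemma coherentI:
  assumes "wf_tree B s" "wf_tree B t" "tsrc B s = tsrc B t" "ttgt B s = ttgt B t"
    "x \<in> C2" "s2 x = ev B s" "t2 x = ev B t" "invertible2 B x"
    "\<And>m. \<lbrakk>wf_tree B m; tsrc B m = ttgt B t\<rbrakk> \<Longrightarrow> act B s m = act B t m"
    "\<And>m. \<lbrakk>wf_tree B m; tsrc B m = ttgt B t\<rbrakk> \<Longrightarrow> act_cell B s m = (x \<star> I2 (ev B m)) \<cdot> act_cell B t m"
  shows "coherent B s t x"
  using assms by (auto simp: coherent_def)

lemma coherent_id: "wf_tree B s \<Longrightarrow> coherent B s s (I2 (ev B s))"
  by (rule coherentI) (auto intro: invertible2_id)

lemma coherent_comp:
  assumes "coherent B s t x" "coherent B t u y"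
  shows "coherent B s u (x \<cdot> y)"
proof (rule coherentI)
  show "invertible2 B (x \<cdot> y)"
    using coherentD[OF assms(1)] coherentD[OF assms(2)] by (simp add: invertible2_vcomp)
next
  fix m assume m: "wf_tree B m" "tsrc B m = ttgt B u"
  then show "act B s m = act B u m"
    using coherentD[OF assms(1)] coherentD[OF assms(2)]
    by (simp add: coherent_act[OF assms(1)] coherent_act[OF assms(2)])
  show "act_cell B s m = ((x \<cdot> y) \<star> I2 (ev B m)) \<cdot> act_cell B u m"
    using m assms coherentD[OF assms(1)] coherentD[OF assms(2)]
    by (simp add: coherent_act[OF assms(1)] coherent_act[OF assms(2)] whisker_right)
qed (use coherentD[OF assms(1)] coherentD[OF assms(2)] in auto)

lemma coherent_inv:
  assumes "coherent B s t x"
  shows "coherent B t s (inv2 B x)"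
proof -
  note c = coherentD[OF assms]
  note i = inv2_props[OF c(8,5)]
  show ?thesis
  proof (rule coherentI)
    show "invertible2 B (inv2 B x)" using c by (simp add: invertible2_inv2)
  next
    fix m assume m: "wf_tree B m" "tsrc B m = ttgt B s"
    then show "act B t m = act B s m" using coherent_act[OF assms] c by simp
    have "(inv2 B x \<star> I2 (ev B m)) \<cdot> act_cell B s m
        = ((inv2 B x \<star> I2 (ev B m)) \<cdot> (x \<star> I2 (ev B m))) \<cdot> act_cell B t m"
      using m c i(1-3) coherent_act[OF assms] by simp
    also have "\<dots> = act_cell B t m"
      using m c i by (simp add: interchange[symmetric])
    finally show "act_cell B t m = (inv2 B x \<star> I2 (ev B m)) \<cdot> act_cell B s m" ..
  qed (use c i in auto)
qed

text \<open>The hypothesis on \<open>x\<close> is used at the tree \<open>act B t m\<close>.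
  Interchange then moves \<open>x\<close> in front of the cell of \<open>t\<close>, and naturality
  of \<open>alpha\<close> moves it in front of the associator.\<close>

lemma coherent_Node_left:
  assumes "coherent B s s' x" "wf_tree B t" "ttgt B s = tsrc B t"
  shows "coherent B (Node s t) (Node s' t) (x \<star> I2 (ev B t))"
proof -
  let ?S = "ev B s" and ?T = "ev B t"
  note c = coherentD[OF assms(1)]
  show ?thesis
  proof (rule coherentI)
    show "invertible2 B (x \<star> I2 ?T)"
      using assms c by (intro invertible2_hcomp invertible2_id) auto
  next
    fix m let ?M = "ev B m"
    assume m: "wf_tree B m" "tsrc B m = ttgt B (Node s' t)"
    show "act B (Node s t) m = act B (Node s' t) m"
      using m assms c by (simp add: coherent_act[OF assms(1)])
    have "act_cell B (Node s t) m = alpha B ?S ?T ?M \<cdot>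
        (I2 ?S \<star> act_cell B t m) \<cdot> (x \<star> I2 (ev B (act B t m))) \<cdot> act_cell B s' (act B t m)"
      using m assms c by (simp add: coherent_act[OF assms(1)])
    also have "\<dots> = alpha B ?S ?T ?M \<cdot>
        ((I2 ?S \<star> act_cell B t m) \<cdot> (x \<star> I2 (ev B (act B t m)))) \<cdot> act_cell B s' (act B t m)"
      using m assms c by simp
    also have "(I2 ?S \<star> act_cell B t m) \<cdot> (x \<star> I2 (ev B (act B t m)))
        = (x \<star> I2 ?T \<star> I2 ?M) \<cdot> (I2 (ev B s') \<star> act_cell B t m)"
      using m assms c by (simp add: interchange[symmetric])
    also have "alpha B ?S ?T ?M \<cdot>
        ((x \<star> I2 ?T \<star> I2 ?M) \<cdot> (I2 (ev B s') \<star> act_cell B t m)) \<cdot> act_cell B s' (act B t m)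
       = (alpha B ?S ?T ?M \<cdot> (x \<star> I2 ?T \<star> I2 ?M)) \<cdot>
         (I2 (ev B s') \<star> act_cell B t m) \<cdot> act_cell B s' (act B t m)"
      using m assms c by simp
    also have "alpha B ?S ?T ?M \<cdot> (x \<star> I2 ?T \<star> I2 ?M)
       = ((x \<star> I2 ?T) \<star> I2 ?M) \<cdot> alpha B (ev B s') ?T ?M"
      using alpha_nat[of x "I2 ?T" "I2 ?M"] m assms c by simp
    also have "(((x \<star> I2 ?T) \<star> I2 ?M) \<cdot> alpha B (ev B s') ?T ?M) \<cdot>
         (I2 (ev B s') \<star> act_cell B t m) \<cdot> act_cell B s' (act B t m)
       = ((x \<star> I2 ?T) \<star> I2 ?M) \<cdot> act_cell B (Node s' t) m"
      using m assms c by simp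
    finally show "act_cell B (Node s t) m = ((x \<star> I2 ?T) \<star> I2 ?M) \<cdot> act_cell B (Node s' t) m" .
  qed (use assms c in auto)
qed

text \<open>Here the hypothesis applies at \<open>m\<close> itself; afterwards \<open>s\<close> acts
  on the same tree on both sides, and only naturality of \<open>alpha\<close> is left.\<close>

lemma coherent_Node_right:
  assumes "coherent B t t' y" "wf_tree B s" "ttgt B s = tsrc B t"
  shows "coherent B (Node s t) (Node s t') (I2 (ev B s) \<star> y)"
proof -
  let ?S = "ev B s" and ?T = "ev B t"
  note c = coherentD[OF assms(1)]
  show ?thesis
  proof (rule coherentI)
    show "invertible2 B (I2 ?S \<star> y)"
      using assms c by (intro invertible2_hcomp invertible2_id) auto
  next
    fix m let ?M = "ev B m"
    assume m: "wf_tree B m" "tsrc B m = ttgt B (Node s t')"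
    show "act B (Node s t) m = act B (Node s t') m"
      using m assms c by (simp add: coherent_act[OF assms(1)])
    have "act_cell B (Node s t) m = (alpha B ?S ?T ?M \<cdot>
        (I2 ?S \<star> y \<star> I2 ?M)) \<cdot> (I2 ?S \<star> act_cell B t' m) \<cdot> act_cell B s (act B t' m)"
      using m assms c by (simp add: coherent_act[OF assms(1)] whisker_left)
    also have "alpha B ?S ?T ?M \<cdot> (I2 ?S \<star> y \<star> I2 ?M)
       = ((I2 ?S \<star> y) \<star> I2 ?M) \<cdot> alpha B ?S (ev B t') ?M"
      using alpha_nat[of "I2 ?S" y "I2 ?M"] m assms c by simp
    also have "(((I2 ?S \<star> y) \<star> I2 ?M) \<cdot> alpha B ?S (ev B t') ?M) \<cdot>
        (I2 ?S \<star> act_cell B t' m) \<cdot> act_cell B s (act B t' m)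
       = ((I2 ?S \<star> y) \<star> I2 ?M) \<cdot> act_cell B (Node s t') m"
      using m assms c by simp
    finally show "act_cell B (Node s t) m = ((I2 ?S \<star> y) \<star> I2 ?M) \<cdot> act_cell B (Node s t') m" .
  qed (use assms c in auto)
qed

lemma coherent_Node:
  assumes "coherent B s s' x" "coherent B t t' y" "ttgt B s = tsrc B t"
  shows "coherent B (Node s t) (Node s' t') (x \<star> y)"
proof -
  note c = coherentD[OF assms(1)] coherentD[OF assms(2)]
  have "coherent B (Node s t) (Node s' t') ((x \<star> I2 (ev B t)) \<cdot> (I2 (ev B s') \<star> y))"
    using assms c
    by (intro coherent_comp[OF coherent_Node_left[OF assms(1)] coherent_Node_right[OF assms(2)]]) auto
  moreover have "(x \<star> I2 (ev B t)) \<cdot> (I2 (ev B s') \<star> y) = x \<star> y"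
    using assms c by (simp add: interchange[symmetric])
  ultimately show ?thesis by simp
qed

text \<open>Both trees act by \<open>u\<close>, then \<open>t\<close>, then \<open>s\<close>. Once
  naturality has brought the associators together, their cells differ exactly by the
  pentagon.\<close>

lemma coherent_alpha:
  assumes [simp]: "wf_tree B s" "wf_tree B t" "wf_tree B u" "ttgt B s = tsrc B t" "ttgt B t = tsrc B u"
  shows "coherent B (Node (Node s t) u) (Node s (Node t u)) (alpha B (ev B s) (ev B t) (ev B u))"
proof (rule coherentI)
  fix m assume [simp]: "wf_tree B m" and "tsrc B m = ttgt B (Node s (Node t u))"
  then have [simp]: "ttgt B u = tsrc B m" by simp
  show "act B (Node (Node s t) u) m = act B (Node s (Node t u)) m" by simp
  let ?S = "ev B s" and ?T = "ev B t" and ?U = "ev B u" and ?M = "ev B m"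
  let ?A = "act_cell B u m" and ?n = "act B u m"
  have "act_cell B (Node (Node s t) u) m = alpha B (?S \<odot> ?T) ?U ?M \<cdot>
      ((I2 ?S \<star> I2 ?T) \<star> ?A) \<cdot> alpha B ?S ?T (ev B ?n) \<cdot>
      (I2 ?S \<star> act_cell B t ?n) \<cdot> act_cell B s (act B t ?n)"
    by simp
  also have "\<dots> = alpha B (?S \<odot> ?T) ?U ?M \<cdot>
      (((I2 ?S \<star> I2 ?T) \<star> ?A) \<cdot> alpha B ?S ?T (ev B ?n)) \<cdot>
      (I2 ?S \<star> act_cell B t ?n) \<cdot> act_cell B s (act B t ?n)"
    by simp
  also have "((I2 ?S \<star> I2 ?T) \<star> ?A) \<cdot> alpha B ?S ?T (ev B ?n)
      = alpha B ?S ?T (?U \<odot> ?M) \<cdot> (I2 ?S \<star> I2 ?T \<star> ?A)"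
    using alpha_nat[of "I2 ?S" "I2 ?T" ?A] by simp
  also have "alpha B (?S \<odot> ?T) ?U ?M \<cdot> (alpha B ?S ?T (?U \<odot> ?M) \<cdot> (I2 ?S \<star> I2 ?T \<star> ?A)) \<cdot>
      (I2 ?S \<star> act_cell B t ?n) \<cdot> act_cell B s (act B t ?n)
    = (alpha B (?S \<odot> ?T) ?U ?M \<cdot> alpha B ?S ?T (?U \<odot> ?M)) \<cdot> (I2 ?S \<star> I2 ?T \<star> ?A) \<cdot>
      (I2 ?S \<star> act_cell B t ?n) \<cdot> act_cell B s (act B t ?n)"
    by simp
  also have "alpha B (?S \<odot> ?T) ?U ?M \<cdot> alpha B ?S ?T (?U \<odot> ?M)
    = (alpha B ?S ?T ?U \<star> I2 ?M) \<cdot> alpha B ?S (?T \<odot> ?U) ?M \<cdot> (I2 ?S \<star> alpha B ?T ?U ?M)"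
    by (simp add: pentagon')
  finally show "act_cell B (Node (Node s t) u) m =
      (alpha B ?S ?T ?U \<star> I2 ?M) \<cdot> act_cell B (Node s (Node t u)) m"
    by (simp add: whisker_left)
qed (auto intro: invertible2_alpha)

text \<open>This needs the unit law \<open>lunit_hcomp\<close>, which is derived and not an axiom;
  naturality of \<open>lunit\<close> does the rest.\<close>

lemma coherent_lunit:
  assumes [simp]: "wf_tree B t"
  shows "coherent B (Node (Leaf (I1 (tsrc B t))) t) t (lunit B (ev B t))"
proof (rule coherentI)
  fix m assume [simp]: "wf_tree B m" "tsrc B m = ttgt B t"
  show "act B (Node (Leaf (I1 (tsrc B t))) t) m = act B t m" by simp
  let ?u = "I1 (tsrc B t)" and ?T = "ev B t" and ?M = "ev B m"
  have "act_cell B (Node (Leaf ?u) t) m =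
      alpha B ?u ?T ?M \<cdot> (I2 ?u \<star> act_cell B t m) \<cdot> lunit B (ev B (act B t m))"
    by simp
  also have "(I2 ?u \<star> act_cell B t m) \<cdot> lunit B (ev B (act B t m)) = lunit B (?T \<odot> ?M) \<cdot> act_cell B t m"
    using lunit_natural[of "act_cell B t m"] by simp
  also have "alpha B ?u ?T ?M \<cdot> lunit B (?T \<odot> ?M) \<cdot> act_cell B t m
      = (alpha B ?u ?T ?M \<cdot> lunit B (?T \<odot> ?M)) \<cdot> act_cell B t m" by simp
  also have "alpha B ?u ?T ?M \<cdot> lunit B (?T \<odot> ?M) = lunit B ?T \<star> I2 ?M"
    using lunit_hcomp[of ?T ?M] by simp
  finally show "act_cell B (Node (Leaf ?u) t) m = (lunit B ?T \<star> I2 ?M) \<cdot> act_cell B t m" .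
qed (auto intro: lunit_invertible)

text \<open>The action of the identity leaf contributes \<open>lunit\<close>, and the triangle turns
  it into the whiskered \<open>runit\<close>.\<close>

lemma coherent_runit:
  assumes [simp]: "wf_tree B t"
  shows "coherent B (Node t (Leaf (I1 (ttgt B t)))) t (runit B (ev B t))"
proof (rule coherentI)
  fix m assume [simp]: "wf_tree B m" "tsrc B m = ttgt B t"
  let ?u = "I1 (ttgt B t)" and ?T = "ev B t" and ?M = "ev B m"
  show "act B (Node t (Leaf ?u)) m = act B t m" by simp
  have "act_cell B (Node t (Leaf ?u)) m = (alpha B ?T ?u ?M \<cdot> (I2 ?T \<star> lunit B ?M)) \<cdot> act_cell B t m"
    by simp
  also have "alpha B ?T ?u ?M \<cdot> (I2 ?T \<star> lunit B ?M) = runit B ?T \<star> I2 ?M"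
    using triangle'[of ?T ?M] by simp
  finally show "act_cell B (Node t (Leaf ?u)) m = (runit B ?T \<star> I2 ?M) \<cdot> act_cell B t m" .
qed (auto intro: runit_invertible)

section \<open>Normal forms under strong homomorphisms\<close>

lemma map_tree_hom:
  assumes "bicategory A" "strong_homomorphism A B F" "wf_tree A t"
  shows "wf_tree B (map_tree (map1 F) t)" "tsrc B (map_tree (map1 F) t) = map0 F (tsrc A t)"
    "ttgt B (map_tree (map1 F) t) = map0 F (ttgt A t)" "ev B (map_tree (map1 F) t) = map1 F (ev A t)"
proof -
  interpret A: bicategory A by fact
  interpret F: strong_homomorphism A B F by fact
  have "wf_tree B (map_tree (map1 F) t) \<and> tsrc B (map_tree (map1 F) t) = map0 F (tsrc A t) \<and>
    ttgt B (map_tree (map1 F) t) = map0 F (ttgt A t) \<and> ev B (map_tree (map1 F) t) = map1 F (ev A t)"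
    using assms(3)
  proof (induction t)
    case (Leaf f)
    then show ?case using F.map1_in by (auto simp: F.map_dom1 F.map_cod1)
  next
    case (Node s t)
    then show ?case by (auto simp: F.map_hcomp1 hcomposable1_def)
  qed
  then show "wf_tree B (map_tree (map1 F) t)" "tsrc B (map_tree (map1 F) t) = map0 F (tsrc A t)"
    "ttgt B (map_tree (map1 F) t) = map0 F (ttgt A t)" "ev B (map_tree (map1 F) t) = map1 F (ev A t)"
    by auto
qed

text \<open>Normal forms are preserved only up to renormalization, as \<open>F\<close> may turn 1-cells into
  identities. With \<open>F\<close> the identity, the lemma relates a tree to its own normal form.\<close>

lemma act_cell_hom:
  assumes "bicategory A" "strong_homomorphism A B F"
    "wf_tree A s" "wf_tree A n" "ttgt A s = tsrc A n" "wf_tree B m" "tsrc B m = map0 F (ttgt A n)"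
  shows "act B (map_tree (map1 F) (act A s n)) m = act B (map_tree (map1 F) (Node s n)) m \<and>
    act_cell B (map_tree (map1 F) (Node s n)) m =
      (map2 F (act_cell A s n) \<star> I2 (ev B m)) \<cdot> act_cell B (map_tree (map1 F) (act A s n)) m"
proof -
  let ?f = "map_tree (map1 F)"
  interpret A: bicategory A by fact
  interpret F: strong_homomorphism A B F by fact
  note A.hom_simps[OF assms(2), simp] map_tree_hom[OF assms(1,2), simp]
  note [simp] = assms(6)
  show ?thesis
    using assms(3-5,7)
  proof (induction s arbitrary: n)
    case (Leaf f)
    show ?case
    proof (cases "f = id1 A (dom1 A f)")
      \<comment> \<open>The image of an identity leaf is an identity leaf and \<open>F\<close>
        preserves \<open>lunit\<close>, so the claim is coherence of \<open>lunit\<close> in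
        \<open>B\<close>.\<close>
      case True
      define a where "a = dom1 A f"
      have a: "f = id1 A a" "a \<in> cells0 A" "tsrc A n = a"
        using True Leaf A.cod_of_unit[of f] by (auto simp: a_def)
      show ?thesis
        using coherent_act[OF coherent_lunit, of "map_tree (map1 F) n" m] Leaf a by simp
    next
      \<comment> \<open>The leaf is kept and its cell is an identity. Whether \<open>F\<close> sends
        it to an identity 1-cell does not matter, as the same image leaf occurs on both
        sides.\<close>
      case False
      then have f: "act A (Leaf f) n = Node (Leaf f) n" "act_cell A (Leaf f) n = id2 A (ev A (Node (Leaf f) n))"
        by auto
      have wf: "wf_tree A (Node (Leaf f) n)" using Leaf by simp
      have "wf_tree B (map_tree (map1 F) (Node (Leaf f) n))"
        "ttgt B (map_tree (map1 F) (Node (Leaf f) n)) = map0 F (ttgt A n)"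
        using map_tree_hom[OF assms(1,2) wf] by auto
      then show ?thesis
        using Leaf coherent_act(2)[OF coherent_id, of "map_tree (map1 F) (Node (Leaf f) n)" m]
          map_tree_hom(4)[OF assms(1,2) wf] A.ev_in(1)[OF wf]
        unfolding f by (simp del: act_cell.simps ev.simps tree.map)
    qed
  next
    case (Node s t)
    then have [simp]: "wf_tree A s" "wf_tree A t" "wf_tree A n" "ttgt A s = tsrc A t" "ttgt A t = tsrc A n"
      "tsrc B m = map0 F (ttgt A n)" by auto
    let ?S = "ev B (?f s)" and ?T = "ev B (?f t)" and ?N = "ev B (?f n)" and ?M = "ev B m"
    let ?st = "map2 F (act_cell A s (act A t n))" and ?tn = "map2 F (act_cell A t n)"
    note IHt = Node.IH(2)[of n, simplified]
    note IHs = Node.IH(1)[of "act A t n", simplified]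
    have 1: "act B (?f (act A (Node s t) n)) m = act B (?f (Node (Node s t) n)) m"
      using IHt IHs by simp
    \<comment> \<open>After rebracketing the image of \<open>Node (Node s t) n\<close>, the
      hypothesis for \<open>t\<close> applies at \<open>n\<close>, and then the one for
      \<open>s\<close> at \<open>act A t n\<close>.\<close>
    have 2: "coherent B (Node (Node (?f s) (?f t)) (?f n)) (Node (?f s) (Node (?f t) (?f n)))
      (alpha B ?S ?T ?N)"
      by (intro coherent_alpha) auto
    have "act_cell B (?f (Node (Node s t) n)) m
        = (alpha B ?S ?T ?N \<star> I2 ?M) \<cdot> act_cell B (Node (?f s) (Node (?f t) (?f n))) m"
      using coherent_act(2)[OF 2] by simp
    also have "act_cell B (Node (?f s) (Node (?f t) (?f n))) m
        = ((I2 ?S \<star> ?tn) \<star> I2 ?M) \<cdot> act_cell B (Node (?f s) (?f (act A t n))) m"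
    proof -
      have "act_cell B (Node (?f s) (Node (?f t) (?f n))) m = alpha B ?S (?T \<odot> ?N) ?M \<cdot>
          (I2 ?S \<star> ((?tn \<star> I2 ?M) \<cdot> act_cell B (?f (act A t n)) m)) \<cdot>
          act_cell B (?f s) (act B (?f (act A t n)) m)"
        using IHt by simp
      also have "\<dots> = (alpha B ?S (?T \<odot> ?N) ?M \<cdot> (I2 ?S \<star> ?tn \<star> I2 ?M)) \<cdot>
          (I2 ?S \<star> act_cell B (?f (act A t n)) m) \<cdot> act_cell B (?f s) (act B (?f (act A t n)) m)"
        by (simp add: whisker_left)
      also have "alpha B ?S (?T \<odot> ?N) ?M \<cdot> (I2 ?S \<star> ?tn \<star> I2 ?M)
          = ((I2 ?S \<star> ?tn) \<star> I2 ?M) \<cdot> alpha B ?S (ev B (?f (act A t n))) ?M"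
        using alpha_nat[of "I2 ?S" ?tn "I2 ?M"] by simp
      finally show ?thesis by simp
    qed
    also have "act_cell B (Node (?f s) (?f (act A t n))) m
        = (?st \<star> I2 ?M) \<cdot> act_cell B (?f (act A s (act A t n))) m"
      using IHs by simp
    finally have "act_cell B (?f (Node (Node s t) n)) m =
        (map2 F (act_cell A (Node s t) n) \<star> I2 ?M) \<cdot> act_cell B (?f (act A (Node s t) n)) m"
      by (simp add: whisker_right)
    with 1 show ?case by blast
  qed
qed

end

text \<open>\<open>act_cell_hom\<close> at the identity tree gives the statement for
  \<open>act_cell\<close> in place of \<open>nf_cell\<close>. The two differ by
  \<open>runit\<close>, whose image is \<open>runit\<close> of the image tree and is coherent, so it
  cancels.\<close>

lemma coherent_map_nf:
  assumes A: "bicategory A" and B: "bicategory B" and F: "strong_homomorphism A B F" and t: "wf_tree A t"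
  shows "coherent B (map_tree (map1 F) t) (map_tree (map1 F) (nf A t)) (map2 F (nf_cell A t))"
proof -
  interpret A: bicategory A by fact
  interpret B: bicategory B by fact
  interpret F: strong_homomorphism A B F by fact
  note th = B.map_tree_hom[OF A F]
  let ?f = "map_tree (map1 F)" and ?u = "unit_tree A t"
  let ?r = "runit B (ev B (?f t))" and ?n = "map2 F (nf_cell A t)"
  have [simp]: "map0 F (ttgt A t) \<in> cells0 B" using F.map0_in t by auto
  have n: "?n \<in> cells2 B" "dom2 B ?n = ev B (?f t)" "cod2 B ?n = ev B (?f (nf A t))" "invertible2 B ?n"
  proof -
    have x: "nf_cell A t \<in> cells2 A" using t by simp
    show "?n \<in> cells2 B" "dom2 B ?n = ev B (?f t)" "cod2 B ?n = ev B (?f (nf A t))"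
      using F.map2_in t F.map_dom2[OF x] F.map_cod2[OF x] by (auto simp: th)
    note i = A.inv2_props[OF A.nf_cell_invertible[OF t] x]
    have "map2 F (vcomp A (nf_cell A t) (inv2 A (nf_cell A t))) = vcomp B ?n (map2 F (inv2 A (nf_cell A t)))"
      "map2 F (vcomp A (inv2 A (nf_cell A t)) (nf_cell A t)) = vcomp B (map2 F (inv2 A (nf_cell A t))) ?n"
      using i(1-3) x by (simp_all add: F.map_vcomp vcomposable_def)
    then show "invertible2 B ?n"
      using i x t F.map2_in F.map_dom2[OF x] F.map_cod2[OF x] F.map_dom2[OF i(1)] F.map_cod2[OF i(1)]
      by (intro B.invertible2I[where y = "map2 F (inv2 A (nf_cell A t))"])
        (auto simp: F.map_id2)
  qed
  \<comment> \<open>Cleared of the inverse, the equation is mapped by \<open>F\<close> directly; the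
    choice in \<open>inv2\<close> is not claimed to be preserved.\<close>
  have r: "map2 F (act_cell A t ?u) = vcomp B ?r ?n"
  proof -
    have "map2 F (vcomp A (runit A (ev A t)) (nf_cell A t)) = vcomp B (map2 F (runit A (ev A t))) ?n"
      using t by (intro F.map_vcomp) (auto simp: vcomposable_def)
    then show ?thesis using t by (simp add: A.runit_nf_cell F.map_runit th)
  qed
  show ?thesis
  proof (rule B.coherentI)
    fix m assume m: "wf_tree B m" "tsrc B m = ttgt B (?f (nf A t))"
    have m': "tsrc B m = map0 F (ttgt A t)" using m t by (simp add: th)
    have u: "?f ?u = Leaf (id1 B (ttgt B (?f t)))" using t by (simp add: unit_tree_def F.map_id1 th)
    have *: "act B (?f (nf A t)) m = act B (?f (Node t ?u)) m"
      "act_cell B (?f (Node t ?u)) m =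
        vcomp B (hcomp2 B (map2 F (act_cell A t ?u)) (id2 B (ev B m))) (act_cell B (?f (nf A t)) m)"
      using B.act_cell_hom[OF A F t, of ?u m] t m m' by (auto simp: nf_def)
    have ru: "coherent B (?f (Node t ?u)) (?f t) ?r"
      using B.coherent_runit[of "?f t"] t u by (simp add: th)
    have m2: "tsrc B m = ttgt B (?f t)" using m' t by (simp add: th)
    note ru2 = B.coherent_act[OF ru m(1) m2]
    show "act B (?f t) m = act B (?f (nf A t)) m" using * ru2 by simp
    let ?M = "id2 B (ev B m)"
    have "vcomp B (hcomp2 B ?r ?M) (act_cell B (?f t) m)
      = vcomp B (hcomp2 B (vcomp B ?r ?n) ?M) (act_cell B (?f (nf A t)) m)"
      using ru2 * r by simp
    also have "\<dots> = vcomp B (hcomp2 B ?r ?M) (vcomp B (hcomp2 B ?n ?M) (act_cell B (?f (nf A t)) m))"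
      using n m m' t by (simp add: B.whisker_right th(1-3))
    finally show "act_cell B (?f t) m = vcomp B (hcomp2 B ?n ?M) (act_cell B (?f (nf A t)) m)"
      by (rule B.cancel_left)
        (use n m m' t in \<open>auto intro!: B.invertible2_hcomp B.invertible2_id B.runit_invertible simp: th(1-3)\<close>)
  qed (use n t in \<open>auto simp: th\<close>)
qed

definition bicat_id :: "'u bicategory \<Rightarrow> 'u bicat_hom" where
  "bicat_id B = \<lparr>map0 = (\<lambda>a\<in>cells0 B. a), map1 = (\<lambda>f\<in>cells1 B. f), map2 = (\<lambda>x\<in>cells2 B. x)\<rparr>"

lemma bicat_id_at:
  "a \<in> cells0 B \<Longrightarrow> map0 (bicat_id B) a = a" "f \<in> cells1 B \<Longrightarrow> map1 (bicat_id B) f = f"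
  "x \<in> cells2 B \<Longrightarrow> map2 (bicat_id B) x = x"
  by (simp_all add: bicat_id_def)

lemma (in bicategory) hom_id: "strong_homomorphism B B (bicat_id B)"
  by unfold_locales
    (auto simp: bicat_id_def hcomposable1_def hcomposable2_def vcomposable_def)

lemma (in bicategory) leaves_in: "wf_tree B t \<Longrightarrow> leaves t \<subseteq> C1"
  by (induction t) auto

lemma (in bicategory) map_tree_id: "wf_tree B t \<Longrightarrow> map_tree (map1 (bicat_id B)) t = t"
  using leaves_in[of t] by (intro tree.map_ident_strong) (auto simp: bicat_id_def)

section \<open>Canonical isomorphisms: existence and uniqueness\<close>

context bicategory
begin

lemma coherent_nf: "wf_tree B t \<Longrightarrow> coherent B t (nf B t) (nf_cell B t)"
  using coherent_map_nf[OF bicategory_axioms bicategory_axioms hom_id, of t]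
  by (simp add: map_tree_id) (simp add: bicat_id_def)

text \<open>Taking the identity tree for \<open>m\<close> yields the equation with \<open>x\<close>
  whiskered by an identity; naturality of \<open>runit\<close> strips the whiskering.\<close>

lemma coherent_nf_cell:
  assumes "coherent B s t x"
  shows "nf B s = nf B t" "nf_cell B s = x \<cdot> nf_cell B t"
proof -
  note c = coherentD[OF assms]
  have u: "unit_tree B s = unit_tree B t" using c by (simp add: unit_tree_def)
  show "nf B s = nf B t" using coherent_act[OF assms] c u by (simp add: nf_def)
  have "runit B (ev B s) \<cdot> nf_cell B s = (x \<star> I2 (I1 (ttgt B t))) \<cdot> runit B (ev B t) \<cdot> nf_cell B t"
    using c u coherent_act[OF assms, of "unit_tree B t"] by (simp add: runit_nf_cell)
  also have "\<dots> = ((x \<star> I2 (I1 (ttgt B t))) \<cdot> runit B (ev B t)) \<cdot> nf_cell B t"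
    using c by simp
  also have "(x \<star> I2 (I1 (ttgt B t))) \<cdot> runit B (ev B t) = runit B (ev B s) \<cdot> x"
    using c runit_natural[of x] by simp
  also have "(runit B (ev B s) \<cdot> x) \<cdot> nf_cell B t = runit B (ev B s) \<cdot> x \<cdot> nf_cell B t"
    using c by simp
  finally show "nf_cell B s = x \<cdot> nf_cell B t"
    by (rule cancel_left) (use c \<open>nf B s = nf B t\<close> in \<open>auto intro: runit_invertible\<close>)
qed

text \<open>The coherence theorem. A coherent \<open>x\<close> satisfies
  \<open>x \<cdot> nf_cell B t = nf_cell B s\<close>, where the right side does not involve
  \<open>x\<close> and \<open>nf_cell B t\<close> is invertible.\<close>

lemma coherent_unique:
  assumes "coherent B s t x" "coherent B s t y"
  shows "x = y"
proof -
  note c = coherentD[OF assms(1)] coherentD[OF assms(2)]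
  have "x \<cdot> nf_cell B t = y \<cdot> nf_cell B t"
    using coherent_nf_cell(2)[OF assms(1)] coherent_nf_cell(2)[OF assms(2)] by simp
  then show ?thesis by (rule cancel_right) (use c nf_cell_invertible in auto)
qed

text \<open>The isomorphism passes through the common normal form.\<close>

lemma coherent_exists:
  assumes "wf_tree B s" "wf_tree B t" "nf B s = nf B t"
  shows "\<exists>x. coherent B s t x"
  using coherent_comp[OF coherent_nf[OF assms(1)]] coherent_inv[OF coherent_nf[OF assms(2)]] assms(3)
  by auto

lemma nf_nf [simp]: "wf_tree B t \<Longrightarrow> nf B (nf B t) = nf B t"
  using coherent_nf_cell(1)[OF coherent_nf] by simp

text \<open>On a normal tree, coherence of \<open>nf_cell\<close> with itself makes it idempotent,
  and an invertible idempotent is an identity.\<close>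

lemma nf_cell_nf:
  assumes "wf_tree B t" "nf B t = t"
  shows "nf_cell B t = I2 (ev B t)"
proof -
  have "nf_cell B t \<cdot> nf_cell B t = nf_cell B t \<cdot> I2 (ev B t)"
    using coherent_nf_cell(2)[OF coherent_nf[OF assms(1)]] assms by simp
  then show ?thesis
    by (rule cancel_left) (use assms nf_cell_invertible in auto)
qed

end

text \<open>By \<open>coherent_nf_cell\<close> the 2-cell \<open>x\<close> is \<open>nf_cell\<close>
  of \<open>s\<close> followed by the inverse of \<open>nf_cell\<close> of \<open>t\<close>. The
  images of both factors are coherent in \<open>B\<close>, so canonical isomorphisms go to canonical
  isomorphisms; this makes the tree map respect bridges.\<close>

lemma coherent_map:
  assumes A: "bicategory A" and B: "bicategory B" and F: "strong_homomorphism A B F" and c: "coherent A s t x"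
  shows "coherent B (map_tree (map1 F) s) (map_tree (map1 F) t) (map2 F x)"
proof -
  interpret A: bicategory A by fact
  interpret B: bicategory B by fact
  interpret F: strong_homomorphism A B F by fact
  note c' = A.coherentD[OF c]
  let ?f = "map_tree (map1 F)"
  have s: "coherent B (?f s) (?f (nf A t)) (map2 F (nf_cell A s))"
    using coherent_map_nf[OF A B F c'(1)] A.coherent_nf_cell[OF c] by simp
  have t: "coherent B (?f t) (?f (nf A t)) (map2 F (nf_cell A t))"
    using coherent_map_nf[OF A B F c'(2)] .
  have xin: "map2 F x \<in> cells2 B" using F.map2_in c' by auto
  have "map2 F (nf_cell A s) = vcomp B (map2 F x) (map2 F (nf_cell A t))"
    unfolding A.coherent_nf_cell(2)[OF c]
    using c' by (intro F.map_vcomp) (auto simp: vcomposable_def)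
  then have "vcomp B (map2 F (nf_cell A s)) (inv2 B (map2 F (nf_cell A t))) = map2 F x"
    using B.coherentD[OF t] B.inv2_props[OF B.coherentD(8)[OF t] B.coherentD(5)[OF t]] c' xin
      F.map_dom2[of x] F.map_cod2[of x]
    by (auto simp: B.map_tree_hom[OF A F])
  then show ?thesis
    using B.coherent_comp[OF s B.coherent_inv[OF t]] by simp
qed

section \<open>Omega magmas with trivial cells above dimension 2\<close>

text \<open>Cells up to dimension 2, each dimension with its own type and an injection of it into the
  universe. In \<open>omega D\<close> below the 2-cells are the cells of every dimension from 2 on.\<close>

record ('a, 'b, 'c, 'u) two_magma =
  objs :: "'a set"
  arrs :: "'b set"
  twos :: "'c set"
  src1 :: "'b \<Rightarrow> 'a"
  tgt1 :: "'b \<Rightarrow> 'a"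
  src2 :: "'c \<Rightarrow> 'b"
  tgt2 :: "'c \<Rightarrow> 'b"
  unit1 :: "'a \<Rightarrow> 'b"
  unit2 :: "'b \<Rightarrow> 'c"
  vert :: "'c \<Rightarrow> 'c \<Rightarrow> 'c"
  horiz1 :: "'b \<Rightarrow> 'b \<Rightarrow> 'b"
  horiz2 :: "'c \<Rightarrow> 'c \<Rightarrow> 'c"
  enc0 :: "'a \<Rightarrow> 'u"
  enc1 :: "'b \<Rightarrow> 'u"
  enc2 :: "'c \<Rightarrow> 'u"

locale two_magma =
  fixes D :: "('a, 'b, 'c, 'u) two_magma"
  assumes inj_enc [simp]: "inj (enc0 D)" "inj (enc1 D)" "inj (enc2 D)"
    and src1 [simp]: "f \<in> arrs D \<Longrightarrow> src1 D f \<in> objs D" and tgt1 [simp]: "f \<in> arrs D \<Longrightarrow> tgt1 D f \<in> objs D"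
    and src2 [simp]: "x \<in> twos D \<Longrightarrow> src2 D x \<in> arrs D" and tgt2 [simp]: "x \<in> twos D \<Longrightarrow> tgt2 D x \<in> arrs D"
    and globular [simp]: "x \<in> twos D \<Longrightarrow> src1 D (tgt2 D x) = src1 D (src2 D x)"
      "x \<in> twos D \<Longrightarrow> tgt1 D (tgt2 D x) = tgt1 D (src2 D x)"
    and unit1 [simp]: "a \<in> objs D \<Longrightarrow> unit1 D a \<in> arrs D"
      "a \<in> objs D \<Longrightarrow> src1 D (unit1 D a) = a" "a \<in> objs D \<Longrightarrow> tgt1 D (unit1 D a) = a"
    and unit2 [simp]: "f \<in> arrs D \<Longrightarrow> unit2 D f \<in> twos D"
      "f \<in> arrs D \<Longrightarrow> src2 D (unit2 D f) = f" "f \<in> arrs D \<Longrightarrow> tgt2 D (unit2 D f) = f"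
    and vert [simp]: "\<lbrakk>x \<in> twos D; y \<in> twos D; tgt2 D x = src2 D y\<rbrakk> \<Longrightarrow> vert D x y \<in> twos D"
      "\<lbrakk>x \<in> twos D; y \<in> twos D; tgt2 D x = src2 D y\<rbrakk> \<Longrightarrow> src2 D (vert D x y) = src2 D x"
      "\<lbrakk>x \<in> twos D; y \<in> twos D; tgt2 D x = src2 D y\<rbrakk> \<Longrightarrow> tgt2 D (vert D x y) = tgt2 D y"
    and horiz1 [simp]: "\<lbrakk>f \<in> arrs D; g \<in> arrs D; tgt1 D f = src1 D g\<rbrakk> \<Longrightarrow> horiz1 D f g \<in> arrs D"
      "\<lbrakk>f \<in> arrs D; g \<in> arrs D; tgt1 D f = src1 D g\<rbrakk> \<Longrightarrow> src1 D (horiz1 D f g) = src1 D f"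
      "\<lbrakk>f \<in> arrs D; g \<in> arrs D; tgt1 D f = src1 D g\<rbrakk> \<Longrightarrow> tgt1 D (horiz1 D f g) = tgt1 D g"
    and horiz2 [simp]: "\<lbrakk>x \<in> twos D; y \<in> twos D; tgt1 D (src2 D x) = src1 D (src2 D y)\<rbrakk> \<Longrightarrow> horiz2 D x y \<in> twos D"
      "\<lbrakk>x \<in> twos D; y \<in> twos D; tgt1 D (src2 D x) = src1 D (src2 D y)\<rbrakk>
        \<Longrightarrow> src2 D (horiz2 D x y) = horiz1 D (src2 D x) (src2 D y)"
      "\<lbrakk>x \<in> twos D; y \<in> twos D; tgt1 D (src2 D x) = src1 D (src2 D y)\<rbrakk>
        \<Longrightarrow> tgt2 D (horiz2 D x y) = horiz1 D (tgt2 D x) (tgt2 D y)"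

section \<open>The omega magma spanned by cells of dimension at most 2\<close>

fun omega_cells :: "('a, 'b, 'c, 'u) two_magma \<Rightarrow> nat \<Rightarrow> 'u set" where
  "omega_cells D 0 = enc0 D ` objs D"
| "omega_cells D (Suc 0) = enc1 D ` arrs D"
| "omega_cells D (Suc (Suc i)) = enc2 D ` twos D"

fun omega_dom :: "('a, 'b, 'c, 'u) two_magma \<Rightarrow> nat \<Rightarrow> 'u \<Rightarrow> 'u" where
  "omega_dom D 0 a = enc0 D (src1 D (inv (enc1 D) a))"
| "omega_dom D (Suc 0) a = enc1 D (src2 D (inv (enc2 D) a))"
| "omega_dom D (Suc (Suc i)) a = a"

fun omega_cod :: "('a, 'b, 'c, 'u) two_magma \<Rightarrow> nat \<Rightarrow> 'u \<Rightarrow> 'u" where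
  "omega_cod D 0 a = enc0 D (tgt1 D (inv (enc1 D) a))"
| "omega_cod D (Suc 0) a = enc1 D (tgt2 D (inv (enc2 D) a))"
| "omega_cod D (Suc (Suc i)) a = a"

fun omega_unit :: "('a, 'b, 'c, 'u) two_magma \<Rightarrow> nat \<Rightarrow> 'u \<Rightarrow> 'u" where
  "omega_unit D 0 a = enc1 D (unit1 D (inv (enc0 D) a))"
| "omega_unit D (Suc 0) a = enc2 D (unit2 D (inv (enc1 D) a))"
| "omega_unit D (Suc (Suc i)) a = a"

text \<open>The last equation is meant for composition along cells of dimension at least 2. There
  all boundary maps are identities, so cells are composable only if they are equal, and the
  composite is that cell.\<close>

fun omega_comp :: "('a, 'b, 'c, 'u) two_magma \<Rightarrow> nat \<Rightarrow> nat \<Rightarrow> 'u \<Rightarrow> 'u \<Rightarrow> 'u" where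
  "omega_comp D 0 (Suc 0) a b = enc1 D (horiz1 D (inv (enc1 D) a) (inv (enc1 D) b))"
| "omega_comp D 0 (Suc (Suc j)) a b = enc2 D (horiz2 D (inv (enc2 D) a) (inv (enc2 D) b))"
| "omega_comp D (Suc 0) (Suc (Suc j)) a b = enc2 D (vert D (inv (enc2 D) a) (inv (enc2 D) b))"
| "omega_comp D i j a b = a"

text \<open>Composition must be undefined exactly on pairs that are not \<open>composable\<close>, a
  notion that depends on the structure being built. Since it only looks at boundaries, it can be
  taken from this version with a placeholder for composition.\<close>

definition omega0 :: "('a, 'b, 'c, 'u) two_magma \<Rightarrow> 'u omega_magma" where
  "omega0 D = \<lparr>cells = omega_cells D, Dom = (\<lambda>i. restrict (omega_dom D i) (omega_cells D (Suc i))),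
     Cod = (\<lambda>i. restrict (omega_cod D i) (omega_cells D (Suc i))),
     Unit = (\<lambda>i. restrict (omega_unit D i) (omega_cells D i)), ocomp = (\<lambda>_ _ _ _. undefined)\<rparr>"

definition omega :: "('a, 'b, 'c, 'u) two_magma \<Rightarrow> 'u omega_magma" where
  "omega D = (omega0 D)\<lparr>ocomp := (\<lambda>i j a b.
     if composable (omega0 D) i j a b then omega_comp D i j a b else undefined)\<rparr>"

lemma dom_it_ocomp [simp]: "dom_it (X\<lparr>ocomp := c\<rparr>) i j a = dom_it X i j a"
  by (induction j arbitrary: a) auto

lemma cod_it_ocomp [simp]: "cod_it (X\<lparr>ocomp := c\<rparr>) i j a = cod_it X i j a"
  by (induction j arbitrary: a) auto

lemma composable_ocomp [simp]: "composable (X\<lparr>ocomp := c\<rparr>) = composable X"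
  by (auto simp: composable_def fun_eq_iff)

lemma omega_simps [simp]:
  "cells (omega D) = omega_cells D"
  "Dom (omega D) i = restrict (omega_dom D i) (omega_cells D (Suc i))"
  "Cod (omega D) i = restrict (omega_cod D i) (omega_cells D (Suc i))"
  "Unit (omega D) i = restrict (omega_unit D i) (omega_cells D i)"
  "ocomp (omega D) i j a b = (if composable (omega D) i j a b then omega_comp D i j a b else undefined)"
  by (simp_all add: omega_def) (simp_all add: omega0_def)

text \<open>From dimension 2 on the unit map is the identity on one fixed set of cells, so it is
  onto.\<close>

lemma skeletal_omega: "skeletal 2 (omega D)"
  unfolding skeletal_def
proof (intro allI impI ballI)
  fix i a assume "2 \<le> i" "a \<in> cells (omega D) (Suc i)"
  moreover then obtain k where "i = Suc (Suc k)" by (metis add_2_eq_Suc le_Suc_ex)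
  ultimately show "a \<in> Unit (omega D) i ` cells (omega D) i" by auto
qed

lemma dim_cases:
  obtains (0) "i = 0" | (1) "i = Suc 0" | (2) k where "i = Suc (Suc k)"
  by (metis not0_implies_Suc)

context two_magma
begin

lemma inv_enc [simp]: "inv (enc0 D) (enc0 D a) = a" "inv (enc1 D) (enc1 D f) = f" "inv (enc2 D) (enc2 D x) = x"
  by simp_all

lemma enc_eq [simp]: "enc0 D a = enc0 D a' \<longleftrightarrow> a = a'" "enc1 D f = enc1 D f' \<longleftrightarrow> f = f'"
  "enc2 D x = enc2 D x' \<longleftrightarrow> x = x'"
  by (metis inv_enc(1), metis inv_enc(2), metis inv_enc(3))

lemma enc_in [simp]: "enc0 D a \<in> enc0 D ` A \<longleftrightarrow> a \<in> A" "enc1 D f \<in> enc1 D ` A1 \<longleftrightarrow> f \<in> A1"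
  "enc2 D x \<in> enc2 D ` A2 \<longleftrightarrow> x \<in> A2"
  by auto

lemma it_high:
  assumes "a \<in> enc2 D ` twos D"
  shows "dom_it (omega D) (Suc (Suc i)) j a = a" "cod_it (omega D) (Suc (Suc i)) j a = a"
    "unit_it (omega D) (Suc (Suc i)) j a = a"
proof -
  show "dom_it (omega D) (Suc (Suc i)) j a = a" using assms
  proof (induction j)
    case (Suc j) then show ?case by (cases j rule: dim_cases) auto
  qed simp
  show "cod_it (omega D) (Suc (Suc i)) j a = a" using assms
  proof (induction j)
    case (Suc j) then show ?case by (cases j rule: dim_cases) auto
  qed simp
  show "unit_it (omega D) (Suc (Suc i)) j a = a" using assms
  proof (induction j)
    case (Suc j) then show ?case by (cases j rule: dim_cases) auto
  qed simp
qed

lemma it_1: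
  assumes "x \<in> twos D"
  shows "dom_it (omega D) (Suc 0) (Suc (Suc n)) (enc2 D x) = enc1 D (src2 D x)"
    "cod_it (omega D) (Suc 0) (Suc (Suc n)) (enc2 D x) = enc1 D (tgt2 D x)"
  using assms by (induction n) auto

text \<open>Both ends are read off \<open>src2\<close>; for the codomain this uses globularity. In
  this form they match the side conditions of \<open>horiz2\<close>.\<close>

lemma it_0:
  assumes "x \<in> twos D"
  shows "dom_it (omega D) 0 (Suc (Suc n)) (enc2 D x) = enc0 D (src1 D (src2 D x))"
    "cod_it (omega D) 0 (Suc (Suc n)) (enc2 D x) = enc0 D (tgt1 D (src2 D x))"
  using assms by (induction n) auto

lemma it_unit:
  "f \<in> arrs D \<Longrightarrow> unit_it (omega D) (Suc 0) (Suc (Suc n)) (enc1 D f) = enc2 D (unit2 D f)"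
  "a \<in> objs D \<Longrightarrow> unit_it (omega D) 0 (Suc (Suc n)) (enc0 D a) = enc2 D (unit2 D (unit1 D a))"
  by (induction n) auto

lemma composable_0_1:
  "composable (omega D) 0 (Suc 0) (enc1 D f) (enc1 D g) \<longleftrightarrow> f \<in> arrs D \<and> g \<in> arrs D \<and> tgt1 D f = src1 D g"
  by (auto simp: composable_def)

lemma composable_0_2:
  "composable (omega D) 0 (Suc (Suc n)) (enc2 D x) (enc2 D y) \<longleftrightarrow>
    x \<in> twos D \<and> y \<in> twos D \<and> tgt1 D (src2 D x) = src1 D (src2 D y)"
  unfolding composable_def by (auto simp: it_0 simp del: dom_it.simps cod_it.simps)

lemma composable_1_2:
  "composable (omega D) (Suc 0) (Suc (Suc n)) (enc2 D x) (enc2 D y) \<longleftrightarrow>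
    x \<in> twos D \<and> y \<in> twos D \<and> tgt2 D x = src2 D y"
  unfolding composable_def by (auto simp: it_1 simp del: dom_it.simps cod_it.simps)

lemma composable_high:
  "composable (omega D) (Suc (Suc i)) (Suc (Suc j)) a b \<longleftrightarrow> i < j \<and> a \<in> enc2 D ` twos D \<and> a = b"
  unfolding composable_def by (auto simp: it_high simp del: dom_it.simps cod_it.simps)

lemmas composable_iffs = composable_0_1 composable_0_2 composable_1_2 composable_high

text \<open>The laws of an omega magma range over all pairs of dimensions. This split leaves
  horizontal composition of 1-cells and of 2-cells, vertical composition, and the trivial case; the
  actual dimension survives only in the index \<open>n\<close>.\<close>

lemma composableE:
  assumes "composable (omega D) i j a b"
  obtains
    (h1) f g where "i = 0" "j = Suc 0" "a = enc1 D f" "b = enc1 D g" "f \<in> arrs D" "g \<in> arrs D" "tgt1 D f = src1 D g"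
  | (h2) n x y where "i = 0" "j = Suc (Suc n)" "a = enc2 D x" "b = enc2 D y" "x \<in> twos D" "y \<in> twos D"
      "tgt1 D (src2 D x) = src1 D (src2 D y)"
  | (v) n x y where "i = Suc 0" "j = Suc (Suc n)" "a = enc2 D x" "b = enc2 D y" "x \<in> twos D" "y \<in> twos D"
      "tgt2 D x = src2 D y"
  | (high) k n x where "i = Suc (Suc k)" "j = Suc (Suc n)" "k < n" "a = enc2 D x" "b = enc2 D x" "x \<in> twos D"
proof -
  have ij: "i < j" "a \<in> omega_cells D j" "b \<in> omega_cells D j"
    using assms by (auto simp: composable_def)
  show ?thesis
  proof (cases j rule: dim_cases)
    case 0
    then show ?thesis using ij by simp
  next
    case 1
    then have "i = 0" using ij by simp
    then show ?thesis using 1 ij assms by (auto intro!: h1 simp: composable_0_1)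
  next
    case (2 n)
    then obtain x y where xy: "a = enc2 D x" "b = enc2 D y" "x \<in> twos D" "y \<in> twos D" using ij by auto
    show ?thesis
    proof (cases i rule: dim_cases)
      case 0
      then show ?thesis using 2 xy assms by (auto intro!: h2 simp: composable_0_2)
    next
      case 1
      then show ?thesis using 2 xy assms by (auto intro!: v simp: composable_1_2)
    next
      case (2 k)
      then show ?thesis using \<open>j = _\<close> xy assms by (auto intro!: high simp: composable_high)
    qed
  qed
qed

lemma omega_graph_omega: "omega_graph (omega D)" (is "omega_graph ?O")
proof
  fix i
  show "Dom ?O i \<in> cells ?O (Suc i) \<rightarrow>\<^sub>E cells ?O i"
    "Cod ?O i \<in> cells ?O (Suc i) \<rightarrow>\<^sub>E cells ?O i"
    "Unit ?O i \<in> cells ?O i \<rightarrow>\<^sub>E cells ?O (Suc i)"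
    by (cases i rule: dim_cases; force)+
next
  fix i a assume "a \<in> cells ?O (Suc (Suc i))"
  then show "Dom ?O i (Dom ?O (Suc i) a) = Dom ?O i (Cod ?O (Suc i) a)"
    "Cod ?O i (Dom ?O (Suc i) a) = Cod ?O i (Cod ?O (Suc i) a)"
    by (cases i rule: dim_cases; auto)+
next
  fix i a assume "a \<in> cells ?O i"
  then show "Dom ?O i (Unit ?O i a) = a" "Cod ?O i (Unit ?O i a) = a"
    by (cases i rule: dim_cases; auto)+
qed

lemma omega_magma_omega: "omega_magma (omega D)" (is "omega_magma ?O")
proof -
  interpret omega_graph "omega D" by (rule omega_graph_omega)
  show ?thesis
  proof
    fix i j a b assume "composable ?O i j a b"
    then show "ocomp ?O i j a b \<in> cells ?O j"
      by (cases rule: composableE) (auto simp: composable_iffs)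
  next
    fix i j a b assume "\<not> composable ?O i j a b"
    then show "ocomp ?O i j a b = undefined" by simp
  next
    fix i a b assume "composable ?O i (Suc i) a b"
    then show "Dom ?O i (ocomp ?O i (Suc i) a b) = Dom ?O i a"
      "Cod ?O i (ocomp ?O i (Suc i) a b) = Cod ?O i b"
      by (cases rule: composableE; auto simp: composable_iffs)+
  next
    fix i j a b assume "i < j" "composable ?O i (Suc j) a b"
    from this(2,1) show "Dom ?O j (ocomp ?O i (Suc j) a b) =
        ocomp ?O i j (Dom ?O j a) (Dom ?O j b)"
      "Cod ?O j (ocomp ?O i (Suc j) a b) =
        ocomp ?O i j (Cod ?O j a) (Cod ?O j b)"
      by (cases rule: composableE; cases j rule: dim_cases; auto simp: composable_iffs)+
  qed
qed

end

section \<open>Strict 2-categories as strict omega categories\<close>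

locale strict_two_magma = two_magma D for D :: "('a, 'b, 'c, 'u) two_magma" +
  assumes horiz1_assoc: "\<lbrakk>f \<in> arrs D; g \<in> arrs D; h \<in> arrs D; tgt1 D f = src1 D g; tgt1 D g = src1 D h\<rbrakk>
      \<Longrightarrow> horiz1 D (horiz1 D f g) h = horiz1 D f (horiz1 D g h)"
    and horiz1_unit: "f \<in> arrs D \<Longrightarrow> horiz1 D (unit1 D (src1 D f)) f = f"
      "f \<in> arrs D \<Longrightarrow> horiz1 D f (unit1 D (tgt1 D f)) = f"
    and vert_assoc: "\<lbrakk>x \<in> twos D; y \<in> twos D; z \<in> twos D; tgt2 D x = src2 D y; tgt2 D y = src2 D z\<rbrakk>
      \<Longrightarrow> vert D (vert D x y) z = vert D x (vert D y z)"
    and vert_unit: "x \<in> twos D \<Longrightarrow> vert D (unit2 D (src2 D x)) x = x"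
      "x \<in> twos D \<Longrightarrow> vert D x (unit2 D (tgt2 D x)) = x"
    and horiz2_assoc: "\<lbrakk>x \<in> twos D; y \<in> twos D; z \<in> twos D;
        tgt1 D (src2 D x) = src1 D (src2 D y); tgt1 D (src2 D y) = src1 D (src2 D z)\<rbrakk>
      \<Longrightarrow> horiz2 D (horiz2 D x y) z = horiz2 D x (horiz2 D y z)"
    and horiz2_unit: "x \<in> twos D \<Longrightarrow> horiz2 D (unit2 D (unit1 D (src1 D (src2 D x)))) x = x"
      "x \<in> twos D \<Longrightarrow> horiz2 D x (unit2 D (unit1 D (tgt1 D (src2 D x)))) = x"
    and horiz2_vert: "\<lbrakk>x \<in> twos D; y \<in> twos D; x' \<in> twos D; y' \<in> twos D; tgt2 D x = src2 D x';
        tgt2 D y = src2 D y'; tgt1 D (src2 D x) = src1 D (src2 D y)\<rbrakk>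
      \<Longrightarrow> horiz2 D (vert D x x') (vert D y y') = vert D (horiz2 D x y) (horiz2 D x' y')"
    and horiz2_unit2: "\<lbrakk>f \<in> arrs D; g \<in> arrs D; tgt1 D f = src1 D g\<rbrakk>
      \<Longrightarrow> horiz2 D (unit2 D f) (unit2 D g) = unit2 D (horiz1 D f g)"
begin

lemma strict_omega_category_omega: "strict_omega_category (omega D)" (is "strict_omega_category ?O")
proof -
  interpret omega_magma "omega D" by (rule omega_magma_omega)
  show ?thesis
  proof
    fix i j a b c assume ab: "composable ?O i j a b" and bc: "composable ?O i j b c"
    from ab show "ocomp ?O i j (ocomp ?O i j a b) c =
        ocomp ?O i j a (ocomp ?O i j b c)"
    proof (cases rule: composableE)
      case (h1 f g)
      with bc obtain h where "c = enc1 D h" by (cases rule: composableE) auto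
      with h1 bc show ?thesis by (auto simp: composable_iffs horiz1_assoc)
    next
      case (h2 n x y)
      with bc obtain h where "c = enc2 D h" by (cases rule: composableE) auto
      with h2 bc show ?thesis by (auto simp: composable_iffs horiz2_assoc)
    next
      case (v n x y)
      with bc obtain h where "c = enc2 D h" by (cases rule: composableE) auto
      with v bc show ?thesis by (auto simp: composable_iffs vert_assoc)
    next
      case (high k n x)
      then show ?thesis using bc by (auto simp: composable_iffs)
    qed
  next
    fix i j k a b c d
    assume lt: "i < j" "j < k" and ab: "composable ?O j k a b" and cd: "composable ?O j k c d"
      and ac: "composable ?O i k a c" and bd: "composable ?O i k b d"
    from ab show "ocomp ?O i k (ocomp ?O j k a b) (ocomp ?O j k c d) =
      ocomp ?O j k (ocomp ?O i k a c) (ocomp ?O i k b d)"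
    proof (cases rule: composableE)
      \<comment> \<open>With \<open>j = 1\<close> the inequality \<open>i < j\<close> forces
        \<open>i = 0\<close>, and the law becomes the interchange of vertical and horizontal
        composition.\<close>
      case (v n x y)
      with lt have i: "i = 0" by simp
      from cd v obtain z w where "c = enc2 D z" "d = enc2 D w" by (cases rule: composableE) auto
      with i v ab cd ac bd show ?thesis by (auto simp: composable_iffs horiz2_vert)
    next
      \<comment> \<open>Here \<open>a = b\<close> and \<open>c = d\<close>, and composition along
        dimension \<open>j\<close> is idempotent, so both sides are the composite of
        \<open>a\<close> and \<open>c\<close> along \<open>i\<close>.\<close>
      case (high l n x)
      with cd obtain z where cd': "c = enc2 D z" "d = enc2 D z" "z \<in> twos D" by (cases rule: composableE) auto
      have "ocomp ?O i k a c \<in> cells ?O k" by (rule comp_in[OF ac])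
      with high cd' ab cd show ?thesis by (auto simp: composable_iffs)
    qed (use lt in auto)
  next
    fix i j a assume lt: "i < j" and a: "a \<in> cells ?O j"
    show "ocomp ?O i j (unit_it ?O i j (dom_it ?O i j a)) a = a"
      and "ocomp ?O i j a (unit_it ?O i j (cod_it ?O i j a)) = a"
    proof -
      have "ocomp ?O i j (unit_it ?O i j (dom_it ?O i j a)) a = a \<and>
        ocomp ?O i j a (unit_it ?O i j (cod_it ?O i j a)) = a"
      proof (cases j rule: dim_cases)
        case 0
        then show ?thesis using lt by simp
      next
        case 1
        then show ?thesis using lt a by (auto simp: composable_iffs horiz1_unit)
      next
        case (2 n)
        with a obtain x where x: "a = enc2 D x" "x \<in> twos D" by auto
        note [simp del] = dom_it.simps cod_it.simps unit_it.simps
        show ?thesis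
        proof (cases i rule: dim_cases)
          case 0
          then show ?thesis using 2 x by (simp add: it_0 it_unit composable_iffs horiz2_unit)
        next
          case 1
          then show ?thesis using 2 x by (simp add: it_1 it_unit composable_iffs vert_unit)
        next
          case (2 k)
          then show ?thesis using x lt \<open>j = _\<close> by (simp add: it_high composable_iffs)
        qed
      qed
      then show "ocomp ?O i j (unit_it ?O i j (dom_it ?O i j a)) a = a"
        "ocomp ?O i j a (unit_it ?O i j (cod_it ?O i j a)) = a" by auto
    qed
  next
    fix i j a b assume "composable ?O i j a b"
    then show "ocomp ?O i (Suc j) (Unit ?O j a) (Unit ?O j b) =
      Unit ?O j (ocomp ?O i j a b)"
      by (cases rule: composableE) (auto simp: composable_iffs horiz2_unit2)
  qed
qed

end

section \<open>Morphisms determined in dimensions 0, 1 and 2\<close>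

fun omega_map :: "('a, 'b, 'c, 'u) two_magma \<Rightarrow> ('a', 'b', 'c', 'u) two_magma
    \<Rightarrow> ('a \<Rightarrow> 'a') \<Rightarrow> ('b \<Rightarrow> 'b') \<Rightarrow> ('c \<Rightarrow> 'c') \<Rightarrow> nat \<Rightarrow> 'u \<Rightarrow> 'u" where
  "omega_map D E f0 f1 f2 0 = (\<lambda>a\<in>omega_cells D 0. enc0 E (f0 (inv (enc0 D) a)))"
| "omega_map D E f0 f1 f2 (Suc 0) = (\<lambda>a\<in>omega_cells D (Suc 0). enc1 E (f1 (inv (enc1 D) a)))"
| "omega_map D E f0 f1 f2 (Suc (Suc i)) = (\<lambda>a\<in>omega_cells D (Suc (Suc i)). enc2 E (f2 (inv (enc2 D) a)))"

locale two_graph_map = source: two_magma D + target: two_magma E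
  for D :: "('a, 'b, 'c, 'u) two_magma" and E :: "('a', 'b', 'c', 'u) two_magma" +
  fixes f0 :: "'a \<Rightarrow> 'a'" and f1 :: "'b \<Rightarrow> 'b'" and f2 :: "'c \<Rightarrow> 'c'"
  assumes map_in [simp]: "a \<in> objs D \<Longrightarrow> f0 a \<in> objs E" "f \<in> arrs D \<Longrightarrow> f1 f \<in> arrs E"
      "x \<in> twos D \<Longrightarrow> f2 x \<in> twos E"
    and map_src1 [simp]: "f \<in> arrs D \<Longrightarrow> f0 (src1 D f) = src1 E (f1 f)"
    and map_tgt1 [simp]: "f \<in> arrs D \<Longrightarrow> f0 (tgt1 D f) = tgt1 E (f1 f)"
    and map_src2 [simp]: "x \<in> twos D \<Longrightarrow> f1 (src2 D x) = src2 E (f2 x)"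
    and map_tgt2 [simp]: "x \<in> twos D \<Longrightarrow> f1 (tgt2 D x) = tgt2 E (f2 x)"
    and map_unit1 [simp]: "a \<in> objs D \<Longrightarrow> f1 (unit1 D a) = unit1 E (f0 a)"
    and map_unit2 [simp]: "f \<in> arrs D \<Longrightarrow> f2 (unit2 D f) = unit2 E (f1 f)"
begin

lemma omega_graph_morphism_omega: "omega_graph_morphism (omega D) (omega E) (omega_map D E f0 f1 f2)" (is "omega_graph_morphism ?D ?E ?F")
proof
  fix i
  show "?F i \<in> cells ?D i \<rightarrow>\<^sub>E cells ?E i"
    by (cases i rule: dim_cases) auto
next
  fix i a assume "a \<in> cells ?D (Suc i)"
  then show "?F i (Dom ?D i a) = Dom ?E i (?F (Suc i) a)"
    "?F i (Cod ?D i a) = Cod ?E i (?F (Suc i) a)"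
    by (cases i rule: dim_cases; auto)+
next
  fix i a assume "a \<in> cells ?D i"
  then show "?F (Suc i) (Unit ?D i a) = Unit ?E i (?F i a)"
    by (cases i rule: dim_cases) auto
qed

end

locale two_magma_map = two_graph_map D E f0 f1 f2
  for D :: "('a, 'b, 'c, 'u) two_magma" and E :: "('a', 'b', 'c', 'u) two_magma"
    and f0 :: "'a \<Rightarrow> 'a'" and f1 :: "'b \<Rightarrow> 'b'" and f2 :: "'c \<Rightarrow> 'c'" +
  assumes map_horiz1: "\<lbrakk>f \<in> arrs D; g \<in> arrs D; tgt1 D f = src1 D g\<rbrakk>
      \<Longrightarrow> f1 (horiz1 D f g) = horiz1 E (f1 f) (f1 g)"
    and map_vert: "\<lbrakk>x \<in> twos D; y \<in> twos D; tgt2 D x = src2 D y\<rbrakk> \<Longrightarrow> f2 (vert D x y) = vert E (f2 x) (f2 y)"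
    and map_horiz2: "\<lbrakk>x \<in> twos D; y \<in> twos D; tgt1 D (src2 D x) = src1 D (src2 D y)\<rbrakk>
      \<Longrightarrow> f2 (horiz2 D x y) = horiz2 E (f2 x) (f2 y)"
begin

lemma omega_magma_morphism_omega: "omega_magma_morphism (omega D) (omega E) (omega_map D E f0 f1 f2)" (is "omega_magma_morphism ?D ?E ?F")
proof -
  interpret omega_graph_morphism ?D ?E ?F
    by (rule omega_graph_morphism_omega)
  show ?thesis
  proof
    fix i j a b assume "composable ?D i j a b"
    then show "?F j (ocomp ?D i j a b) =
      ocomp ?E i j (?F j a) (?F j b)"
    proof (cases rule: source.composableE)
      case (h1 f g)
      moreover have "tgt1 E (f1 f) = src1 E (f1 g)" using h1 by (metis map_src1 map_tgt1)
      ultimately show ?thesis by (simp add: source.composable_iffs target.composable_iffs map_horiz1)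
    next
      case (h2 n x y)
      moreover have "tgt1 E (src2 E (f2 x)) = src1 E (src2 E (f2 y))"
        using h2 by (metis map_src1 map_tgt1 map_src2 source.src2)
      ultimately show ?thesis by (simp add: source.composable_iffs target.composable_iffs map_horiz2)
    next
      case (v n x y)
      moreover have "tgt2 E (f2 x) = src2 E (f2 y)"
        using v by (metis map_src2 map_tgt2)
      ultimately show ?thesis by (simp add: source.composable_iffs target.composable_iffs map_vert)
    next
      case (high k n x)
      then show ?thesis by (simp add: source.composable_iffs target.composable_iffs)
    qed
  qed
qed

end

text \<open>Together with \<open>mor_comp_omega_map\<close> and \<open>mor_id_omega\<close> this
  reduces equations between morphisms in all dimensions to three functions compared on the
  carriers.\<close>

lemma omega_map_cong:
  assumes "two_magma D" "\<And>a. a \<in> objs D \<Longrightarrow> f0 a = g0 a" "\<And>a. a \<in> arrs D \<Longrightarrow> f1 a = g1 a"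
    "\<And>a. a \<in> twos D \<Longrightarrow> f2 a = g2 a"
  shows "omega_map D E f0 f1 f2 = omega_map D E g0 g1 g2"
proof -
  interpret two_magma D by fact
  show ?thesis
  proof
    fix i show "omega_map D E f0 f1 f2 i = omega_map D E g0 g1 g2 i"
      using assms(2-) by (cases i rule: dim_cases) (auto simp: restrict_def fun_eq_iff)
  qed
qed

lemma mor_comp_omega_map:
  assumes "two_magma D" "two_magma E" "f0 ` objs D \<subseteq> objs E" "f1 ` arrs D \<subseteq> arrs E" "f2 ` twos D \<subseteq> twos E"
  shows "mor_comp (omega D) (omega_map E E' g0 g1 g2) (omega_map D E f0 f1 f2) =
    omega_map D E' (\<lambda>a. g0 (f0 a)) (\<lambda>a. g1 (f1 a)) (\<lambda>a. g2 (f2 a))"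
proof -
  interpret D: two_magma D by fact
  interpret E: two_magma E by fact
  show ?thesis
  proof
    fix i show "mor_comp (omega D) (omega_map E E' g0 g1 g2) (omega_map D E f0 f1 f2) i =
      omega_map D E' (\<lambda>a. g0 (f0 a)) (\<lambda>a. g1 (f1 a)) (\<lambda>a. g2 (f2 a)) i"
      using assms(3-)
      by (cases i rule: dim_cases) (auto simp: mor_comp_def compose_def restrict_def fun_eq_iff)
  qed
qed

lemma mor_id_omega:
  assumes "two_magma D"
  shows "mor_id (omega D) = omega_map D D (\<lambda>a. a) (\<lambda>a. a) (\<lambda>a. a)"
proof -
  interpret D: two_magma D by fact
  show ?thesis
  proof
    fix i show "mor_id (omega D) i = omega_map D D (\<lambda>a. a) (\<lambda>a. a) (\<lambda>a. a) i"
      by (cases i rule: dim_cases) (auto simp: mor_id_def restrict_def fun_eq_iff)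
  qed
qed

lemma (in two_magma) omega_enc2:
  assumes "x \<in> twos D"
  shows "Dom (omega D) (Suc 0) (enc2 D x) = enc1 D (src2 D x)" "Cod (omega D) (Suc 0) (enc2 D x) = enc1 D (tgt2 D x)"
    "omega_map D E f0 f1 f2 (Suc (Suc n)) (enc2 D x) = enc2 E (f2 x)"
  using assms by auto

section \<open>Trees of 1-cells and the strictification\<close>

text \<open>The boundary trees belong to the cell, since different trees may have the same value and
  a 2-cell of \<open>B\<close> alone would not determine its ends.\<close>

definition tree_cells :: "'u bicategory \<Rightarrow> ('u tree \<times> 'u tree \<times> 'u) set" where
  "tree_cells B = {(s, t, x). wf_tree B s \<and> wf_tree B t \<and> tsrc B s = tsrc B t \<and> ttgt B s = ttgt B t \<and>
     x \<in> cells2 B \<and> dom2 B x = ev B s \<and> cod2 B x = ev B t}"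

fun tree_vert :: "'u bicategory \<Rightarrow> 'u tree \<times> 'u tree \<times> 'u \<Rightarrow> 'u tree \<times> 'u tree \<times> 'u \<Rightarrow> 'u tree \<times> 'u tree \<times> 'u" where
  "tree_vert B (s, t, x) (s', t', y) = (s, t', vcomp B x y)"

fun tree_horiz :: "'u bicategory \<Rightarrow> 'u tree \<times> 'u tree \<times> 'u \<Rightarrow> 'u tree \<times> 'u tree \<times> 'u \<Rightarrow> 'u tree \<times> 'u tree \<times> 'u" where
  "tree_horiz B (s, t, x) (s', t', y) = (Node s s', Node t t', hcomp2 B x y)"

fun tree_cell_map :: "'u bicat_hom \<Rightarrow> 'u tree \<times> 'u tree \<times> 'u \<Rightarrow> 'u tree \<times> 'u tree \<times> 'u" where
  "tree_cell_map F (s, t, x) = (map_tree (map1 F) s, map_tree (map1 F) t, map2 F x)"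

fun nf2 :: "'u bicategory \<Rightarrow> 'u tree \<times> 'u tree \<times> 'u \<Rightarrow> 'u tree \<times> 'u tree \<times> 'u" where
  "nf2 B (s, t, x) = (nf B s, nf B t, vcomp B (inv2 B (nf_cell B s)) (vcomp B x (nf_cell B t)))"

declare nf2.simps [simp del]

definition tree_unit :: "'u bicategory \<Rightarrow> 'u tree \<Rightarrow> 'u tree \<times> 'u tree \<times> 'u" where
  "tree_unit B s = (s, s, id2 B (ev B s))"

definition base :: "'u bicategory \<Rightarrow> ('u, 'u, 'u, 'u) two_magma" where
  "base B = \<lparr>objs = cells0 B, arrs = cells1 B, twos = cells2 B, src1 = dom1 B, tgt1 = cod1 B,
     src2 = dom2 B, tgt2 = cod2 B, unit1 = id1 B, unit2 = id2 B, vert = vcomp B,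
     horiz1 = hcomp1 B, horiz2 = hcomp2 B, enc0 = (\<lambda>a. a), enc1 = (\<lambda>a. a), enc2 = (\<lambda>a. a)\<rparr>"

text \<open>\<open>enc2\<close> packs a triple into a single tree with the 2-cell as an additional
  leaf, so one injection \<open>e\<close> of trees into the universe codes both dimensions. Codes
  from different dimensions may coincide; cells are only compared within a dimension.\<close>

definition trees :: "('u tree \<Rightarrow> 'u) \<Rightarrow> 'u bicategory \<Rightarrow> ('u, 'u tree, 'u tree \<times> 'u tree \<times> 'u, 'u) two_magma" where
  "trees e B = \<lparr>objs = cells0 B, arrs = {t. wf_tree B t}, twos = tree_cells B, src1 = tsrc B, tgt1 = ttgt B,
     src2 = fst, tgt2 = (\<lambda>c. fst (snd c)), unit1 = (\<lambda>a. Leaf (id1 B a)), unit2 = tree_unit B,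
     vert = tree_vert B, horiz1 = Node, horiz2 = tree_horiz B,
     enc0 = (\<lambda>a. a), enc1 = e, enc2 = (\<lambda>(s, t, x). e (Node (Node s t) (Leaf x)))\<rparr>"

text \<open>Grafting two normal trees leaves the identity that ends the first one in the middle, so
  horizontal composites must be renormalized. Vertical composites keep normal ends and need no
  correction.\<close>

definition normals :: "('u tree \<Rightarrow> 'u) \<Rightarrow> 'u bicategory \<Rightarrow> ('u, 'u tree, 'u tree \<times> 'u tree \<times> 'u, 'u) two_magma" where
  "normals e B = (trees e B)\<lparr>arrs := {t. wf_tree B t \<and> nf B t = t},
     twos := {c \<in> tree_cells B. nf B (fst c) = fst c \<and> nf B (fst (snd c)) = fst (snd c)},
     horiz1 := (\<lambda>s t. nf B (Node s t)), horiz2 := (\<lambda>c d. nf2 B (tree_horiz B c d))\<rparr>"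

lemma base_simps [simp]:
  "objs (base B) = cells0 B" "arrs (base B) = cells1 B" "twos (base B) = cells2 B"
  "src1 (base B) = dom1 B" "tgt1 (base B) = cod1 B" "src2 (base B) = dom2 B" "tgt2 (base B) = cod2 B"
  "unit1 (base B) = id1 B" "unit2 (base B) = id2 B" "vert (base B) = vcomp B"
  "horiz1 (base B) = hcomp1 B" "horiz2 (base B) = hcomp2 B"
  "enc0 (base B) = (\<lambda>a. a)" "enc1 (base B) = (\<lambda>a. a)" "enc2 (base B) = (\<lambda>a. a)"
  by (simp_all add: base_def)

lemma trees_simps [simp]:
  "objs (trees e B) = cells0 B" "arrs (trees e B) = {t. wf_tree B t}" "twos (trees e B) = tree_cells B"
  "src1 (trees e B) = tsrc B" "tgt1 (trees e B) = ttgt B" "src2 (trees e B) = fst"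
  "tgt2 (trees e B) = (\<lambda>c. fst (snd c))"
  "unit1 (trees e B) = (\<lambda>a. Leaf (id1 B a))" "unit2 (trees e B) = tree_unit B" "vert (trees e B) = tree_vert B"
  "horiz1 (trees e B) = Node" "horiz2 (trees e B) = tree_horiz B"
  "enc0 (trees e B) = (\<lambda>a. a)" "enc1 (trees e B) = e"
  "enc2 (trees e B) = (\<lambda>(s, t, x). e (Node (Node s t) (Leaf x)))"
  by (simp_all add: trees_def)

lemma normals_simps [simp]:
  "objs (normals e B) = cells0 B" "arrs (normals e B) = {t. wf_tree B t \<and> nf B t = t}"
  "twos (normals e B) = {c \<in> tree_cells B. nf B (fst c) = fst c \<and> nf B (fst (snd c)) = fst (snd c)}"
  "src1 (normals e B) = tsrc B" "tgt1 (normals e B) = ttgt B" "src2 (normals e B) = fst"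
  "tgt2 (normals e B) = (\<lambda>c. fst (snd c))"
  "unit1 (normals e B) = (\<lambda>a. Leaf (id1 B a))" "unit2 (normals e B) = tree_unit B" "vert (normals e B) = tree_vert B"
  "horiz1 (normals e B) = (\<lambda>s t. nf B (Node s t))" "horiz2 (normals e B) = (\<lambda>c d. nf2 B (tree_horiz B c d))"
  "enc0 (normals e B) = (\<lambda>a. a)" "enc1 (normals e B) = e"
  "enc2 (normals e B) = (\<lambda>(s, t, x). e (Node (Node s t) (Leaf x)))"
  by (simp_all add: normals_def)

lemma tree_cells_iff [simp]: "(s, t, x) \<in> tree_cells B \<longleftrightarrow>
    wf_tree B s \<and> wf_tree B t \<and> tsrc B s = tsrc B t \<and> ttgt B s = ttgt B t \<and>
    x \<in> cells2 B \<and> dom2 B x = ev B s \<and> cod2 B x = ev B t"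
  by (simp add: tree_cells_def)

lemma inj_enc_cell: "inj e \<Longrightarrow> inj (\<lambda>(s, t, x). e (Node (Node s t) (Leaf x)))"
  by (auto simp: inj_def)

section \<open>Normalization of 2-cells\<close>

context bicategory
begin

text \<open>Replaces the chosen inverse in \<open>nf2\<close> by a commuting square with sides
  \<open>nf_cell B s\<close> and \<open>nf_cell B t\<close>; the square is what later proofs
  calculate with.\<close>

lemma nf2_spec:
  assumes "(s, t, x) \<in> tree_cells B"
  obtains k where "nf2 B (s, t, x) = (nf B s, nf B t, k)" "k \<in> C2" "s2 k = ev B (nf B s)" "t2 k = ev B (nf B t)"
    "nf_cell B s \<cdot> k = x \<cdot> nf_cell B t" "nf2 B (s, t, x) \<in> tree_cells B"
proof -
  let ?i = "inv2 B (nf_cell B s)" and ?k = "inv2 B (nf_cell B s) \<cdot> x \<cdot> nf_cell B t"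
  have st: "wf_tree B s" "wf_tree B t" using assms by auto
  note i = inv2_props[OF nf_cell_invertible[OF st(1)] nf_cell_in(1)[OF st(1)]]
  have "nf_cell B s \<cdot> ?k = (nf_cell B s \<cdot> ?i) \<cdot> x \<cdot> nf_cell B t"
    using assms i(1-3) by simp
  then have "nf_cell B s \<cdot> ?k = x \<cdot> nf_cell B t" using assms i by simp
  then show ?thesis using assms i by (intro that[of ?k]) (auto simp: nf2.simps)
qed

text \<open>Two 2-cells joined by a commuting square with coherent sides have the same
  normalization, because coherent sides are absorbed by \<open>nf_cell\<close>. This is how laws
  that hold in \<open>B\<close> up to structure isomorphisms become equalities in
  \<open>normals\<close>.\<close>

lemma nf2_eqI:
  assumes c: "(s, t, x) \<in> tree_cells B" "(s', t', x') \<in> tree_cells B"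
    and u: "coherent B s s' u" and v: "coherent B t t' v" and e: "x \<cdot> v = u \<cdot> x'"
  shows "nf2 B (s, t, x) = nf2 B (s', t', x')"
proof -
  obtain k where k: "nf2 B (s, t, x) = (nf B s, nf B t, k)" "k \<in> C2" "s2 k = ev B (nf B s)" "t2 k = ev B (nf B t)"
    "nf_cell B s \<cdot> k = x \<cdot> nf_cell B t" by (rule nf2_spec[OF c(1)])
  obtain k' where k': "nf2 B (s', t', x') = (nf B s', nf B t', k')" "k' \<in> C2" "s2 k' = ev B (nf B s')"
    "t2 k' = ev B (nf B t')" "nf_cell B s' \<cdot> k' = x' \<cdot> nf_cell B t'" by (rule nf2_spec[OF c(2)])
  note d = coherentD[OF u] coherentD[OF v] coherent_nf_cell[OF u] coherent_nf_cell[OF v]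
  have "nf_cell B s \<cdot> k = (x \<cdot> v) \<cdot> nf_cell B t'" using c d k(5) by simp
  also have "\<dots> = u \<cdot> x' \<cdot> nf_cell B t'" using c d unfolding e by simp
  also have "\<dots> = nf_cell B s \<cdot> k'" using c d k'(2-4) by (simp add: k'(5)[symmetric])
  finally have "k = k'"
    by (rule cancel_left) (use c d(1-16) d(17,19) k(2-4) k'(2-4) nf_cell_invertible[of s] in simp_all)
  then show ?thesis using k k' d by simp
qed

lemma nf2_normal:
  assumes "c \<in> tree_cells B" "nf B (fst c) = fst c" "nf B (fst (snd c)) = fst (snd c)"
  shows "nf2 B c = c"
proof -
  obtain s t x where c: "c = (s, t, x)" by (cases c)
  obtain k where "nf2 B (s, t, x) = (nf B s, nf B t, k)" "k \<in> C2" "s2 k = ev B (nf B s)" "t2 k = ev B (nf B t)"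
    "nf_cell B s \<cdot> k = x \<cdot> nf_cell B t" using assms(1) unfolding c by (elim nf2_spec)
  then show ?thesis using assms c by (simp add: nf_cell_nf)
qed

text \<open>Conjugation by isomorphisms is faithful. Hence parallel 2-cells with the same image
  under \<open>kap\<close> are equal, and the diagonal suffices for bridges between 2-cells.\<close>

lemma nf2_inj:
  assumes "(s, t, x) \<in> tree_cells B" "(s, t, y) \<in> tree_cells B" "nf2 B (s, t, x) = nf2 B (s, t, y)"
  shows "x = y"
proof -
  obtain k where k: "nf2 B (s, t, x) = (nf B s, nf B t, k)" "nf_cell B s \<cdot> k = x \<cdot> nf_cell B t"
    by (rule nf2_spec[OF assms(1)])
  obtain l where l: "nf2 B (s, t, y) = (nf B s, nf B t, l)" "nf_cell B s \<cdot> l = y \<cdot> nf_cell B t"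
    by (rule nf2_spec[OF assms(2)])
  have "x \<cdot> nf_cell B t = y \<cdot> nf_cell B t" using k l assms(3) by simp
  then show ?thesis by (rule cancel_right) (use assms nf_cell_invertible in auto)
qed

lemma nf2_in:
  assumes "c \<in> tree_cells B"
  shows "nf2 B c \<in> tree_cells B" "fst (nf2 B c) = nf B (fst c)" "fst (snd (nf2 B c)) = nf B (fst (snd c))"
proof -
  obtain s t x where c: "c = (s, t, x)" by (cases c)
  show "nf2 B c \<in> tree_cells B" using assms unfolding c by (elim nf2_spec)
qed (cases c; simp add: nf2.simps)+

lemma tree_horiz_in:
  assumes "c \<in> tree_cells B" "d \<in> tree_cells B" "ttgt B (fst c) = tsrc B (fst d)"
  shows "tree_horiz B c d \<in> tree_cells B" "fst (tree_horiz B c d) = Node (fst c) (fst d)"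
    "fst (snd (tree_horiz B c d)) = Node (fst (snd c)) (fst (snd d))"
  using assms by (cases c; cases d; auto)+

lemma tree_vert_in:
  assumes "c \<in> tree_cells B" "d \<in> tree_cells B" "fst (snd c) = fst d"
  shows "tree_vert B c d \<in> tree_cells B" "fst (tree_vert B c d) = fst c" "fst (snd (tree_vert B c d)) = fst (snd d)"
  using assms by (cases c; cases d; auto)+

lemma tree_unit_in: "wf_tree B s \<Longrightarrow> tree_unit B s \<in> tree_cells B"
  by (simp add: tree_unit_def)

lemma nf_Node:
  assumes "wf_tree B s" "wf_tree B t" "ttgt B s = tsrc B t"
  shows "nf B (Node (nf B s) (nf B t)) = nf B (Node s t)"
  using coherent_nf_cell(1)[OF coherent_Node[OF coherent_nf[OF assms(1)] coherent_nf[OF assms(2)] assms(3)]] ..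

text \<open>By interchange the horizontal composite of the normalization squares of \<open>c\<close>
  and \<open>d\<close> is again a square, and its sides are coherent by
  \<open>coherent_Node\<close>.\<close>

lemma nf2_horiz:
  assumes "c \<in> tree_cells B" "d \<in> tree_cells B" "ttgt B (fst c) = tsrc B (fst d)"
  shows "nf2 B (tree_horiz B (nf2 B c) (nf2 B d)) = nf2 B (tree_horiz B c d)"
proof -
  obtain s t x where c: "c = (s, t, x)" by (cases c)
  obtain s' t' y where d: "d = (s', t', y)" by (cases d)
  obtain k where k: "nf2 B (s, t, x) = (nf B s, nf B t, k)" "k \<in> C2" "s2 k = ev B (nf B s)" "t2 k = ev B (nf B t)"
    "nf_cell B s \<cdot> k = x \<cdot> nf_cell B t" using assms(1) unfolding c by (elim nf2_spec)
  obtain l where l: "nf2 B (s', t', y) = (nf B s', nf B t', l)" "l \<in> C2" "s2 l = ev B (nf B s')" "t2 l = ev B (nf B t')"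
    "nf_cell B s' \<cdot> l = y \<cdot> nf_cell B t'" using assms(2) unfolding d by (elim nf2_spec)
  have [simp]: "wf_tree B s" "wf_tree B s'" "wf_tree B t" "wf_tree B t'" "ttgt B s = ttgt B t"
    "ttgt B t = tsrc B t'" "tsrc B s = tsrc B t" "tsrc B s' = tsrc B t'" "ttgt B s' = ttgt B t'"
    "x \<in> C2" "s2 x = ev B s" "t2 x = ev B t" "y \<in> C2" "s2 y = ev B s'" "t2 y = ev B t'"
    using assms c d by auto
  have "nf2 B (tree_horiz B c d) = nf2 B (Node (nf B s) (nf B s'), Node (nf B t) (nf B t'), k \<star> l)"
    unfolding c d tree_horiz.simps
  proof (rule nf2_eqI)
    show "coherent B (Node s s') (Node (nf B s) (nf B s')) (nf_cell B s \<star> nf_cell B s')"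
      "coherent B (Node t t') (Node (nf B t) (nf B t')) (nf_cell B t \<star> nf_cell B t')"
      by (auto intro!: coherent_Node coherent_nf)
    have "(x \<star> y) \<cdot> (nf_cell B t \<star> nf_cell B t') = (x \<cdot> nf_cell B t) \<star> (y \<cdot> nf_cell B t')"
      by (simp add: interchange)
    also have "\<dots> = (nf_cell B s \<cdot> k) \<star> (nf_cell B s' \<cdot> l)" using k l by simp
    also have "\<dots> = (nf_cell B s \<star> nf_cell B s') \<cdot> (k \<star> l)"
      using k(2-4) l(2-4) by (simp add: interchange)
    finally show "(x \<star> y) \<cdot> (nf_cell B t \<star> nf_cell B t') = (nf_cell B s \<star> nf_cell B s') \<cdot> (k \<star> l)" .
  qed (use k l in auto)
  then show ?thesis using c d k l by simp
qed

text \<open>The two normalization squares share the side \<open>nf_cell B t\<close> and paste along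
  it. The composite of the normalized cells already has normal ends, so \<open>nf2\<close> fixes
  it.\<close>

lemma nf2_vert:
  assumes "c \<in> tree_cells B" "d \<in> tree_cells B" "fst (snd c) = fst d"
  shows "nf2 B (tree_vert B c d) = tree_vert B (nf2 B c) (nf2 B d)"
proof -
  obtain s t x where c: "c = (s, t, x)" by (cases c)
  obtain u y where d: "d = (t, u, y)" using assms(3) c by (cases d) auto
  obtain k where k: "nf2 B (s, t, x) = (nf B s, nf B t, k)" "k \<in> C2" "s2 k = ev B (nf B s)" "t2 k = ev B (nf B t)"
    "nf_cell B s \<cdot> k = x \<cdot> nf_cell B t" using assms(1) unfolding c by (elim nf2_spec)
  obtain l where l: "nf2 B (t, u, y) = (nf B t, nf B u, l)" "l \<in> C2" "s2 l = ev B (nf B t)" "t2 l = ev B (nf B u)"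
    "nf_cell B t \<cdot> l = y \<cdot> nf_cell B u" using assms(2) unfolding d by (elim nf2_spec)
  have [simp]: "wf_tree B s" "wf_tree B t" "wf_tree B u" "ttgt B s = ttgt B t"
    "ttgt B t = ttgt B u" "tsrc B s = tsrc B t" "tsrc B t = tsrc B u"
    "x \<in> C2" "s2 x = ev B s" "t2 x = ev B t" "y \<in> C2" "s2 y = ev B t" "t2 y = ev B u"
    using assms c d by auto
  have "nf2 B (s, u, x \<cdot> y) = nf2 B (nf B s, nf B u, k \<cdot> l)"
  proof (rule nf2_eqI)
    show "coherent B s (nf B s) (nf_cell B s)" "coherent B u (nf B u) (nf_cell B u)"
      by (auto intro!: coherent_nf)
    have "(x \<cdot> y) \<cdot> nf_cell B u = x \<cdot> (nf_cell B t \<cdot> l)" using l by simp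
    also have "\<dots> = (x \<cdot> nf_cell B t) \<cdot> l" using l(2-4) by simp
    also have "\<dots> = (nf_cell B s \<cdot> k) \<cdot> l" using k by simp
    also have "\<dots> = nf_cell B s \<cdot> k \<cdot> l" using k(2-4) l(2-4) by simp
    finally show "(x \<cdot> y) \<cdot> nf_cell B u = nf_cell B s \<cdot> k \<cdot> l" .
  qed (use k l in auto)
  also have "\<dots> = (nf B s, nf B u, k \<cdot> l)"
    using k l by (intro nf2_normal) auto
  finally show ?thesis using c d k l by simp
qed

lemma nf2_unit:
  assumes "wf_tree B s"
  shows "nf2 B (tree_unit B s) = tree_unit B (nf B s)"
proof -
  have "nf2 B (tree_unit B s) = nf2 B (tree_unit B (nf B s))"
    unfolding tree_unit_def using assms
    by (intro nf2_eqI[where u = "nf_cell B s" and v = "nf_cell B s"]) (auto intro: coherent_nf)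
  then show ?thesis using assms nf2_normal[OF tree_unit_in] by (simp add: tree_unit_def)
qed

lemma nf_unit: "a \<in> C0 \<Longrightarrow> nf B (Leaf (I1 a)) = Leaf (I1 a)"
  by (simp add: nf_def unit_tree_def)

lemma two_magma_base: "two_magma (base B)"
  by unfold_locales (auto simp: inj_def)

context
  fixes e :: "'u tree \<Rightarrow> 'u"
  assumes e: "inj e"
begin

lemma two_magma_trees: "two_magma (trees e B)"
  by unfold_locales (use e in \<open>auto simp: inj_enc_cell tree_unit_def\<close>)

text \<open>Strict laws for 1-cells say that coherent trees have equal normal forms. For 2-cells the
  unit and associativity laws follow from \<open>nf2_eqI\<close>, whose squares are the naturality
  squares of \<open>lunit\<close>, \<open>runit\<close> and \<open>alpha\<close>.\<close>

lemma strict_two_magma_normals: "strict_two_magma (normals e B)" (is "strict_two_magma ?N")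
proof unfold_locales
  show "inj (enc0 ?N)" "inj (enc1 ?N)" "inj (enc2 ?N)"
    using e by (auto simp: inj_enc_cell)
next
  fix f assume "f \<in> arrs ?N"
  then have f: "wf_tree B f" "nf B f = f" by auto
  then show "src1 ?N f \<in> objs ?N" "tgt1 ?N f \<in> objs ?N" by auto
  show "unit2 ?N f \<in> twos ?N" "src2 ?N (unit2 ?N f) = f"
    "tgt2 ?N (unit2 ?N f) = f" using f by (auto simp: tree_unit_def)
  show "horiz1 ?N (unit1 ?N (src1 ?N f)) f = f"
    using coherent_nf_cell(1)[OF coherent_lunit[of f]] f by simp
  show "horiz1 ?N f (unit1 ?N (tgt1 ?N f)) = f"
    using coherent_nf_cell(1)[OF coherent_runit[of f]] f by simp
next
  fix a assume "a \<in> objs ?N"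
  then show "unit1 ?N a \<in> arrs ?N"
    "src1 ?N (unit1 ?N a) = a" "tgt1 ?N (unit1 ?N a) = a"
    by (auto simp: nf_unit)
next
  fix f g assume fg: "f \<in> arrs ?N" "g \<in> arrs ?N" "tgt1 ?N f = src1 ?N g"
  then show "horiz1 ?N f g \<in> arrs ?N"
    "src1 ?N (horiz1 ?N f g) = src1 ?N f"
    "tgt1 ?N (horiz1 ?N f g) = tgt1 ?N g" by auto
  have "tree_horiz B (tree_unit B f) (tree_unit B g) = tree_unit B (Node f g)"
    using fg by (simp add: tree_unit_def)
  then show "horiz2 ?N (unit2 ?N f) (unit2 ?N g) =
    unit2 ?N (horiz1 ?N f g)"
    using fg by (simp add: nf2_unit)
  fix h assume h: "h \<in> arrs ?N" "tgt1 ?N g = src1 ?N h"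
  have "nf B (Node (nf B (Node f g)) (nf B h)) = nf B (Node (Node f g) h)"
    "nf B (Node (nf B f) (nf B (Node g h))) = nf B (Node f (Node g h))"
    "nf B (Node (Node f g) h) = nf B (Node f (Node g h))"
    using fg h nf_Node[of "Node f g" h] nf_Node[of f "Node g h"]
    by (auto intro!: coherent_nf_cell(1)[OF coherent_alpha])
  then show "horiz1 ?N (horiz1 ?N f g) h = horiz1 ?N f (horiz1 ?N g h)"
    using fg h by simp
next
  fix x assume "x \<in> twos ?N"
  then obtain s t c where x: "x = (s, t, c)" "(s, t, c) \<in> tree_cells B" "nf B s = s" "nf B t = t"
    by (cases x) auto
  then show "src2 ?N x \<in> arrs ?N" "tgt2 ?N x \<in> arrs ?N"
    "src1 ?N (tgt2 ?N x) = src1 ?N (src2 ?N x)"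
    "tgt1 ?N (tgt2 ?N x) = tgt1 ?N (src2 ?N x)" by auto
  show "vert ?N (unit2 ?N (src2 ?N x)) x = x"
    "vert ?N x (unit2 ?N (tgt2 ?N x)) = x"
    using x by (auto simp: tree_unit_def)
  have [simp]: "nf2 B (s, t, c) = (s, t, c)" using x by (intro nf2_normal) auto
  have "nf2 B (tree_horiz B (tree_unit B (Leaf (I1 (tsrc B s)))) x) = nf2 B x"
    unfolding x(1) tree_unit_def tree_horiz.simps
    by (rule nf2_eqI[where u = "lunit B (ev B s)" and v = "lunit B (ev B t)"])
      (use x lunit_natural[of c] coherent_lunit[of s] coherent_lunit[of t] in auto)
  then show "horiz2 ?N (unit2 ?N (unit1 ?N (src1 ?N (src2 ?N x)))) x = x"
    using x by simp
  have "nf2 B (tree_horiz B x (tree_unit B (Leaf (I1 (ttgt B s))))) = nf2 B x"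
    unfolding x(1) tree_unit_def tree_horiz.simps
    by (rule nf2_eqI[where u = "runit B (ev B s)" and v = "runit B (ev B t)"])
      (use x runit_natural[of c] coherent_runit[of s] coherent_runit[of t] in auto)
  then show "horiz2 ?N x (unit2 ?N (unit1 ?N (tgt1 ?N (src2 ?N x)))) = x"
    using x by simp
next
  fix x y assume xy: "x \<in> twos ?N" "y \<in> twos ?N" "tgt2 ?N x = src2 ?N y"
  then show "vert ?N x y \<in> twos ?N"
    "src2 ?N (vert ?N x y) = src2 ?N x"
    "tgt2 ?N (vert ?N x y) = tgt2 ?N y"
    using tree_vert_in[of x y] by auto
  fix z assume "z \<in> twos ?N" "tgt2 ?N y = src2 ?N z"
  then show "vert ?N (vert ?N x y) z = vert ?N x (vert ?N y z)"
    using xy by (cases x; cases y; cases z) auto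
next
  fix x y assume xy: "x \<in> twos ?N" "y \<in> twos ?N"
    "tgt1 ?N (src2 ?N x) = src1 ?N (src2 ?N y)"
  have n: "nf2 B x = x" "nf2 B y = y" using xy by (auto intro: nf2_normal)
  have xy': "x \<in> tree_cells B" "y \<in> tree_cells B" "ttgt B (fst x) = tsrc B (fst y)" using xy by auto
  note th = tree_horiz_in[OF xy']
  have wf: "wf_tree B (Node (fst x) (fst y))" "wf_tree B (Node (fst (snd x)) (fst (snd y)))"
    using xy' by (auto simp: tree_cells_def)
  show "horiz2 ?N x y \<in> twos ?N"
    "src2 ?N (horiz2 ?N x y) = horiz1 ?N (src2 ?N x) (src2 ?N y)"
    "tgt2 ?N (horiz2 ?N x y) = horiz1 ?N (tgt2 ?N x) (tgt2 ?N y)"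
    using nf2_in[OF th(1)] th wf by (auto simp del: wf_tree.simps)
  fix z assume z: "z \<in> twos ?N"
    "tgt1 ?N (src2 ?N y) = src1 ?N (src2 ?N z)"
  have z': "z \<in> tree_cells B" "ttgt B (fst y) = tsrc B (fst z)" using z by auto
  have nz: "nf2 B z = z" using z by (auto intro: nf2_normal)
  note th' = tree_horiz_in[OF xy'(2) z']
  have "nf2 B (tree_horiz B (nf2 B (tree_horiz B x y)) (nf2 B z)) = nf2 B (tree_horiz B (tree_horiz B x y) z)"
    using th z' by (intro nf2_horiz) auto
  also have "\<dots> = nf2 B (tree_horiz B x (tree_horiz B y z))"
  proof -
    obtain s t a where x: "x = (s, t, a)" by (cases x)
    obtain s' t' b where y: "y = (s', t', b)" by (cases y)
    obtain s'' t'' c where z: "z = (s'', t'', c)" by (cases z)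
    show ?thesis unfolding x y z tree_horiz.simps
      by (rule nf2_eqI[where u = "alpha B (ev B s) (ev B s') (ev B s'')" and v = "alpha B (ev B t) (ev B t') (ev B t'')"])
        (use xy' z' alpha_nat[of a b c] x y z in \<open>auto intro!: coherent_alpha\<close>)
  qed
  also have "\<dots> = nf2 B (tree_horiz B (nf2 B x) (nf2 B (tree_horiz B y z)))"
    using th' xy' by (intro nf2_horiz[symmetric]) auto
  finally show "horiz2 ?N (horiz2 ?N x y) z = horiz2 ?N x (horiz2 ?N y z)"
    using n nz by simp
next
  fix x y x' y'
  assume a: "x \<in> twos ?N" "y \<in> twos ?N" "x' \<in> twos ?N" "y' \<in> twos ?N"
    "tgt2 ?N x = src2 ?N x'" "tgt2 ?N y = src2 ?N y'"
    "tgt1 ?N (src2 ?N x) = src1 ?N (src2 ?N y)"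
  have "tree_horiz B (tree_vert B x x') (tree_vert B y y') = tree_vert B (tree_horiz B x y) (tree_horiz B x' y')"
    using a by (cases x; cases y; cases x'; cases y') (auto simp: interchange)
  moreover have "nf2 B (tree_vert B (tree_horiz B x y) (tree_horiz B x' y')) =
      tree_vert B (nf2 B (tree_horiz B x y)) (nf2 B (tree_horiz B x' y'))"
  proof -
    have "ttgt B (fst x') = tsrc B (fst y')" using a by (cases x; cases y; cases x'; cases y') auto
    then show ?thesis using a tree_horiz_in[of x y] tree_horiz_in[of x' y'] by (intro nf2_vert) auto
  qed
  ultimately show "horiz2 ?N (vert ?N x x') (vert ?N y y') =
    vert ?N (horiz2 ?N x y) (horiz2 ?N x' y')"
    by simp
qed

end

end

section \<open>From bicategories to weak 2-categories\<close>

text \<open>Bridges have to join parallel cells that \<open>kap\<close> identifies. Only in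
  dimension 1 can these differ: on 0-cells \<open>kap\<close> is the identity, on parallel 2-cells
  it is injective by \<open>nf2_inj\<close>, and above dimension 2 parallel cells are equal.\<close>

definition tree_bridge :: "('u tree \<Rightarrow> 'u) \<Rightarrow> 'u bicategory \<Rightarrow> 'u relation_family" where
  "tree_bridge e B i = (if i = 1
     then {(e s, e t, enc2 (trees e B) (s, t, x)) | s t x. coherent B s t x}
     else diagonal_bridge (omega (trees e B)) i)"

definition weak_of :: "('u tree \<Rightarrow> 'u) \<Rightarrow> 'u bicategory \<Rightarrow> 'u weak_omega_category" where
  "weak_of e B =
    \<lparr>mag1 = omega (base B), mag2 = omega (trees e B),
     lam = omega_map (trees e B) (base B) (\<lambda>a. a) (ev B) (\<lambda>(s, t, x). x),
     rho = omega_map (base B) (trees e B) (\<lambda>a. a) Leaf (\<lambda>x. (Leaf (dom2 B x), Leaf (cod2 B x), x)),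
     bridge = tree_bridge e B, cat3 = omega (normals e B),
     kap = omega_map (trees e B) (normals e B) (\<lambda>a. a) (nf B) (nf2 B)\<rparr>"

text \<open>The third component normalizes again after applying \<open>F\<close>, since the image of
  a normal tree may contain new identity leaves.\<close>

definition weak_functor_of ::
    "('u tree \<Rightarrow> 'u) \<Rightarrow> 'u bicategory \<Rightarrow> 'u bicategory \<Rightarrow> 'u bicat_hom \<Rightarrow> 'u omega_functor" where
  "weak_functor_of e A B F =
    \<lparr>fun1 = omega_map (base A) (base B) (map0 F) (map1 F) (map2 F),
     fun2 = omega_map (trees e A) (trees e B) (map0 F) (map_tree (map1 F)) (tree_cell_map F),
     fun3 = omega_map (normals e A) (normals e B) (map0 F) (\<lambda>t. nf B (map_tree (map1 F) t))
       (\<lambda>c. nf2 B (tree_cell_map F c))\<rparr>"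

lemma weak_of_simps [simp]:
  "mag1 (weak_of e B) = omega (base B)" "mag2 (weak_of e B) = omega (trees e B)"
  "lam (weak_of e B) = omega_map (trees e B) (base B) (\<lambda>a. a) (ev B) (\<lambda>(s, t, x). x)"
  "rho (weak_of e B) = omega_map (base B) (trees e B) (\<lambda>a. a) Leaf (\<lambda>x. (Leaf (dom2 B x), Leaf (cod2 B x), x))"
  "bridge (weak_of e B) = tree_bridge e B" "cat3 (weak_of e B) = omega (normals e B)"
  "kap (weak_of e B) = omega_map (trees e B) (normals e B) (\<lambda>a. a) (nf B) (nf2 B)"
  by (simp_all add: weak_of_def)

context bicategory
begin

context
  fixes e :: "'u tree \<Rightarrow> 'u"
  assumes e: "inj e"
begin

lemma two_magma_normals: "two_magma (normals e B)"
  using strict_two_magma_normals[OF e] by (simp add: strict_two_magma_def)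

lemma lam_map: "two_magma_map (trees e B) (base B) (\<lambda>a. a) (ev B) (\<lambda>(s, t, x). x)"
proof -
  interpret T: two_magma "trees e B" by (rule two_magma_trees[OF e])
  interpret D: two_magma "base B" by (rule two_magma_base)
  show ?thesis by unfold_locales (auto simp: tree_unit_def)
qed

lemma rho_map: "two_graph_map (base B) (trees e B) (\<lambda>a. a) Leaf (\<lambda>x. (Leaf (dom2 B x), Leaf (cod2 B x), x))"
proof -
  interpret T: two_magma "trees e B" by (rule two_magma_trees[OF e])
  interpret D: two_magma "base B" by (rule two_magma_base)
  show ?thesis by unfold_locales (auto simp: tree_unit_def)
qed

lemma kap_map: "two_magma_map (trees e B) (normals e B) (\<lambda>a. a) (nf B) (nf2 B)"
proof -
  interpret T: two_magma "trees e B" by (rule two_magma_trees[OF e])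
  interpret N: two_magma "normals e B" by (rule two_magma_normals)
  show ?thesis
  proof unfold_locales
    fix x assume x: "x \<in> twos (trees e B)"
    then show "nf2 B x \<in> twos (normals e B)" using nf2_in[of x] by (auto simp: tree_cells_def)
    show "nf B (src2 (trees e B) x) = src2 (normals e B) (nf2 B x)"
      "nf B (tgt2 (trees e B) x) = tgt2 (normals e B) (nf2 B x)"
      using nf2_in[of x] x by auto
    fix y assume y: "y \<in> twos (trees e B)"
    show "nf2 B (vert (trees e B) x y) = vert (normals e B) (nf2 B x) (nf2 B y)"
      if "tgt2 (trees e B) x = src2 (trees e B) y" using that x y nf2_vert by simp
    show "nf2 B (horiz2 (trees e B) x y) = horiz2 (normals e B) (nf2 B x) (nf2 B y)"
      if "tgt1 (trees e B) (src2 (trees e B) x) = src1 (trees e B) (src2 (trees e B) y)"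
      using that x y nf2_horiz by simp
  qed (auto simp: nf_unit nf2_unit nf_Node)
qed

text \<open>That a bridge is determined by its ends is the coherence theorem
  \<open>coherent_unique\<close>; the remaining conditions concern boundaries and
  identities.\<close>

lemma bridge_relation_trees: "bridge_relation (omega (trees e B)) (tree_bridge e B)" (is "bridge_relation ?O ?R")
proof -
  interpret T: two_magma "trees e B" by (rule two_magma_trees[OF e])
  interpret O: omega_magma "omega (trees e B)" by (rule T.omega_magma_omega)
  have coh: "(s, t, x) \<in> tree_cells B" if "coherent B s t x" for s t x
    using coherentD[OF that] by simp
  have inj: "e s = e t \<longleftrightarrow> s = t" for s t using e by (auto simp: inj_def)
  show ?thesis
  proof
    fix a b c i assume R: "(a, b, c) \<in> tree_bridge e B i"
    have "a \<in> cells ?O i \<and> b \<in> cells ?O i \<and> c \<in> cells ?O (Suc i)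
      \<and> parallel ?O i a b \<and> Dom ?O i c = a \<and> Cod ?O i c = b"
    proof (cases "i = 1")
      case True
      with R obtain s t x where x: "coherent B s t x" "a = e s" "b = e t" "c = enc2 (trees e B) (s, t, x)"
        unfolding tree_bridge_def by auto
      note t = coherentD[OF x(1)] T.inv_enc[simplified] coh[OF x(1)]
      show ?thesis using x(2-4) True t T.inv_enc(3)[of "(s, t, x)"]
        by (auto simp: parallel_def intro!: image_eqI[where x = "(s, t, x)"])
    next
      case False
      with R have "a \<in> cells ?O i" "b = a" "c = Unit ?O i a"
        by (auto simp: tree_bridge_def diagonal_bridge_def)
      then show ?thesis using O.Unit_in[of i] O.Dom_Unit[of a i] O.Cod_Unit[of a i]
        by (auto simp: parallel_def simp del: omega_simps split: nat.splits)
    qed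
    then show "a \<in> cells ?O i \<and> b \<in> cells ?O i \<and> c \<in> cells ?O (Suc i)"
      "parallel ?O i a b" "Dom ?O i c = a" "Cod ?O i c = b"
      by auto
    fix d assume "(a, b, d) \<in> tree_bridge e B i"
    with R show "c = d"
      by (auto simp: tree_bridge_def diagonal_bridge_def inj split: if_splits dest: coherent_unique)
  next
    fix a i assume a: "a \<in> cells ?O i"
    show "(a, a, Unit ?O i a) \<in> tree_bridge e B i"
    proof (cases "i = 1")
      case True
      with a obtain s where "a = e s" "wf_tree B s" by auto
      then show ?thesis using True coherent_id[of s] T.inv_enc(2)[of s]
        by (auto simp: tree_bridge_def tree_unit_def)
    next
      case False
      then show ?thesis using a by (auto simp: tree_bridge_def diagonal_bridge_def simp del: omega_simps)
    qed
  qed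
qed

lemma weak_omega_category_weak_of: "weak_omega_category (weak_of e B)"
proof -
  let ?O = "omega (trees e B)"
  let ?N = "omega (normals e B)"
  interpret T: two_magma "trees e B" by (rule two_magma_trees[OF e])
  interpret D: two_magma "base B" by (rule two_magma_base)
  interpret N: strict_two_magma "normals e B" by (rule strict_two_magma_normals[OF e])
  interpret lam: two_magma_map "trees e B" "base B" "\<lambda>a. a" "ev B" "\<lambda>(s, t, x). x" by (rule lam_map)
  interpret rho: two_graph_map "base B" "trees e B" "\<lambda>a. a" Leaf "\<lambda>x. (Leaf (dom2 B x), Leaf (cod2 B x), x)"
    by (rule rho_map)
  interpret kap: two_magma_map "trees e B" "normals e B" "\<lambda>a. a" "nf B" "nf2 B" by (rule kap_map)
  have inj: "e s = e t \<longleftrightarrow> s = t" for s t using e by (auto simp: inj_def)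
  let ?K = "omega_map (trees e B) (normals e B) (\<lambda>a. a) (nf B) (nf2 B)"
  have collapse: "?K i a = ?K i b \<and> ?K (Suc i) c = Unit ?N i (?K i a)
      \<and> (?K i a, ?K i b, ?K (Suc i) c) \<in> diagonal_bridge ?N i"
    if R: "(a, b, c) \<in> tree_bridge e B i" for a b c i
  proof -
    interpret K: omega_magma_morphism "omega (trees e B)" "omega (normals e B)" ?K
      by (rule kap.omega_magma_morphism_omega)
    have "?K i a = ?K i b \<and> ?K (Suc i) c = Unit ?N i (?K i a)"
    proof (cases "i = 1")
      case True
      with R obtain s t x where x: "coherent B s t x" "a = e s" "b = e t" "c = enc2 (trees e B) (s, t, x)"
        unfolding tree_bridge_def by auto
      note d = coherentD[OF x(1)] coherent_nf_cell[OF x(1)]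
      \<comment> \<open>A coherent \<open>x\<close> is joined to the identity of \<open>t\<close> by
        the square with sides \<open>x\<close> and the identity, so \<open>kap\<close> sends the
        bridge to an identity.\<close>
      have "nf2 B (s, t, x) = nf2 B (tree_unit B t)"
        unfolding tree_unit_def using d by (intro nf2_eqI[OF _ _ x(1) coherent_id]) auto
      also have "\<dots> = tree_unit B (nf B t)" using d by (intro nf2_unit)
      finally have n: "nf2 B (s, t, x) = tree_unit B (nf B s)" using d by simp
      show ?thesis using x(2-4) True d n T.inv_enc(2)[of s] T.inv_enc(2)[of t] T.inv_enc(3)[of "(s, t, x)"]
        by (auto simp: tree_unit_def inj inv_f_f[OF e] intro!: image_eqI[where x = "(s, t, x)"])
    next
      case False
      with R have "a \<in> cells ?O i" "b = a" "c = Unit ?O i a"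
        by (auto simp: tree_bridge_def diagonal_bridge_def)
      then show ?thesis using K.map_Unit by simp
    qed
    moreover have "?K i a \<in> cells ?N i"
      using K.map_in[of i] bridge_relation.bridge_cells[OF bridge_relation_trees R] by blast
    ultimately show ?thesis by (auto simp: diagonal_bridge_def simp del: omega_simps)
  qed
  have "categorical_Penon_morphism ?O (tree_bridge e B) ?N ?K"
  proof (intro categorical_Penon_morphism.intro categorical_Penon_morphism_axioms.intro bridge_morphism.intro
      bridge_morphism_axioms.intro)
    show "omega_magma ?O" by (rule T.omega_magma_omega)
    show "bridge_relation ?O (tree_bridge e B)" by (rule bridge_relation_trees)
    show "strict_omega_category ?N" by (rule N.strict_omega_category_omega)
    show "omega_magma_morphism ?O ?N ?K"
      by (rule kap.omega_magma_morphism_omega)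
  next
    fix a b c i assume "(a, b, c) \<in> tree_bridge e B i"
    from collapse[OF this] show "?K i a = ?K i b \<and> ?K (Suc i) c = Unit ?N i (?K i a)"
      "(?K i a, ?K i b, ?K (Suc i) c) \<in> diagonal_bridge ?N i" by auto
  next
    fix i a b assume p: "parallel ?O i a b" and k: "?K i a = ?K i b"
    have diag: "\<exists>c. (a, b, c) \<in> tree_bridge e B i" if "i \<noteq> 1" "a = b"
      using that p by (auto simp: tree_bridge_def diagonal_bridge_def parallel_def simp del: omega_simps)
    show "\<exists>c. (a, b, c) \<in> tree_bridge e B i"
    proof (cases i rule: dim_cases)
      case 0
      then show ?thesis using diag p k by (auto simp: parallel_def)
    next
      case 1
      with p obtain s t where st: "a = e s" "b = e t" "wf_tree B s" "wf_tree B t"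
        by (auto simp: parallel_def)
      with 1 k have "nf B s = nf B t" using T.inv_enc(2)[of s] T.inv_enc(2)[of t] by (simp add: inj)
      then obtain x where "coherent B s t x" using coherent_exists st by blast
      then show ?thesis using st 1 by (auto simp: tree_bridge_def)
    next
      case (2 n)
      with p obtain s t x s' t' x' where c: "a = enc2 (trees e B) (s, t, x)" "b = enc2 (trees e B) (s', t', x')"
        "(s, t, x) \<in> tree_cells B" "(s', t', x') \<in> tree_cells B"
        by (auto simp: parallel_def simp del: tree_cells_iff)
      show ?thesis
      proof (cases n)
        case 0
        have c': "(s, t, x) \<in> twos (trees e B)" "(s', t', x') \<in> twos (trees e B)" using c by auto
        note E = T.omega_enc2[OF c'(1)] T.omega_enc2[OF c'(2)]
        have "Dom ?O (Suc 0) a = Dom ?O (Suc 0) b"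
          "Cod ?O (Suc 0) a = Cod ?O (Suc 0) b"
          using p 0 2 by (auto simp: parallel_def simp del: omega_simps)
        then have "e s = e s'" "e t = e t'" unfolding c(1,2) E by simp_all
        then have st: "s' = s" "t' = t" by (auto simp: inj)
        have "nf2 B (s, t, x) = nf2 B (s', t', x')" using k unfolding 2 c(1,2) E by (simp only: N.enc_eq)
        then have "x = x'" using c nf2_inj unfolding st by blast
        then show ?thesis using diag 2 c st by auto
      next
        \<comment> \<open>Above dimension 2 the boundary maps are identities, so parallel cells
          coincide.\<close>
        case (Suc m)
        then show ?thesis using diag 2 p by (auto simp: parallel_def split: if_splits)
      qed
    qed
  qed
  moreover have "mor_comp (omega (base B)) (omega_map (trees e B) (base B) (\<lambda>a. a) (ev B) (\<lambda>(s, t, x). x))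
     (omega_map (base B) (trees e B) (\<lambda>a. a) Leaf (\<lambda>x. (Leaf (dom2 B x), Leaf (cod2 B x), x))) = mor_id (omega (base B))"
    unfolding mor_id_omega[OF two_magma_base]
    by (subst mor_comp_omega_map[OF two_magma_base two_magma_trees[OF e]])
       (auto intro!: omega_map_cong two_magma_base)
  ultimately show ?thesis
    by (intro weak_omega_category.intro weak_omega_category_axioms.intro)
      (simp_all del: omega_simps add: T.omega_magma_omega D.omega_magma_omega lam.omega_magma_morphism_omega
        rho.omega_graph_morphism_omega)
qed

end

end

section \<open>The omega functor induced by a strong homomorphism\<close>

context
  fixes A B :: "'u bicategory" and F :: "'u bicat_hom" and e :: "'u tree \<Rightarrow> 'u"
  assumes A: "bicategory A" and B: "bicategory B" and F: "strong_homomorphism A B F" and e: "inj e"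
begin

interpretation A: bicategory A by (fact A)
interpretation B: bicategory B by (fact B)
interpretation F: strong_homomorphism A B F by (fact F)

lemma tree_cell_map_in:
  assumes "c \<in> tree_cells A"
  shows "tree_cell_map F c \<in> tree_cells B"
    "fst (tree_cell_map F c) = map_tree (map1 F) (fst c)"
    "fst (snd (tree_cell_map F c)) = map_tree (map1 F) (fst (snd c))"
  using assms F.map2_in
  by (cases c; auto simp: B.map_tree_hom[OF A F] F.map_dom2[symmetric] F.map_cod2[symmetric])+

lemma nf_map:
  assumes "wf_tree A t"
  shows "nf B (map_tree (map1 F) (nf A t)) = nf B (map_tree (map1 F) t)"
  using B.coherent_nf_cell(1)[OF coherent_map[OF A B F A.coherent_nf[OF assms]]] by simp

text \<open>\<open>F\<close> maps the normalization square in \<open>A\<close> to a square in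
  \<open>B\<close> whose sides are coherent by \<open>coherent_map\<close>, so
  \<open>nf2_eqI\<close> applies. Normalizing before \<open>F\<close> thus makes no difference once
  one normalizes after it.\<close>

lemma nf2_map:
  assumes "c \<in> tree_cells A"
  shows "nf2 B (tree_cell_map F (nf2 A c)) = nf2 B (tree_cell_map F c)"
proof -
  obtain s t x where c: "c = (s, t, x)" by (cases c)
  obtain k where k: "nf2 A (s, t, x) = (nf A s, nf A t, k)" "k \<in> cells2 A" "dom2 A k = ev A (nf A s)"
    "cod2 A k = ev A (nf A t)" "vcomp A (nf_cell A s) k = vcomp A x (nf_cell A t)"
    "nf2 A (s, t, x) \<in> tree_cells A"
    using assms unfolding c by (elim A.nf2_spec)
  let ?f = "map_tree (map1 F)"
  have st: "wf_tree A s" "wf_tree A t" using assms c by auto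
  have "vcomp B (map2 F (nf_cell A s)) (map2 F k) = map2 F (vcomp A (nf_cell A s) k)"
    using st k(2-4) by (simp add: F.map_vcomp vcomposable_def)
  also have "\<dots> = vcomp B (map2 F x) (map2 F (nf_cell A t))"
    using assms c unfolding k(5) by (simp add: F.map_vcomp vcomposable_def)
  finally have "nf2 B (?f s, ?f t, map2 F x) = nf2 B (?f (nf A s), ?f (nf A t), map2 F k)"
    using tree_cell_map_in(1)[OF assms] tree_cell_map_in(1)[OF k(6)] c k(1)
    by (intro B.nf2_eqI[OF _ _ coherent_map[OF A B F A.coherent_nf[OF st(1)]] coherent_map[OF A B F A.coherent_nf[OF st(2)]]])
      simp_all
  then show ?thesis using c k(1) by simp
qed

lemma map_hom [simp]:
  "a \<in> cells0 A \<Longrightarrow> map0 F a \<in> cells0 B" "f \<in> cells1 A \<Longrightarrow> map1 F f \<in> cells1 B" "x \<in> cells2 A \<Longrightarrow> map2 F x \<in> cells2 B"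
  using F.map0_in F.map1_in F.map2_in by auto

lemma fun1_map: "two_magma_map (base A) (base B) (map0 F) (map1 F) (map2 F)"
proof -
  interpret DA: two_magma "base A" by (rule A.two_magma_base)
  interpret DB: two_magma "base B" by (rule B.two_magma_base)
  show ?thesis
    by unfold_locales (simp_all add: F.map_dom1 F.map_cod1 F.map_dom2 F.map_cod2 F.map_id1 F.map_id2
      F.map_vcomp F.map_hcomp1 F.map_hcomp2 vcomposable_def hcomposable1_def hcomposable2_def)
qed

lemma fun2_map: "two_magma_map (trees e A) (trees e B) (map0 F) (map_tree (map1 F)) (tree_cell_map F)"
proof -
  let ?TB = "trees e B"
  let ?TA = "trees e A"
  interpret TA: two_magma "trees e A" by (rule A.two_magma_trees[OF e])
  interpret TB: two_magma "trees e B" by (rule B.two_magma_trees[OF e])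
  show ?thesis
  proof unfold_locales
    fix x assume x: "x \<in> twos ?TA"
    then show "tree_cell_map F x \<in> twos ?TB"
      "map_tree (map1 F) (src2 ?TA x) = src2 ?TB (tree_cell_map F x)"
      "map_tree (map1 F) (tgt2 ?TA x) = tgt2 ?TB (tree_cell_map F x)"
      using tree_cell_map_in by auto
    fix y assume y: "y \<in> twos ?TA"
    show "tree_cell_map F (vert ?TA x y) = vert ?TB (tree_cell_map F x) (tree_cell_map F y)"
      if "tgt2 ?TA x = src2 ?TA y"
      using that x y by (cases x; cases y) (auto simp: F.map_vcomp vcomposable_def)
    show "tree_cell_map F (horiz2 ?TA x y) = horiz2 ?TB (tree_cell_map F x) (tree_cell_map F y)"
      if "tgt1 ?TA (src2 ?TA x) = src1 ?TA (src2 ?TA y)"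
      using that x y by (cases x; cases y) (auto simp: F.map_hcomp2 hcomposable2_def)
  qed (auto simp: B.map_tree_hom[OF A F] F.map_id1 F.map_id2 tree_unit_def)
qed

text \<open>Composites in \<open>normals\<close> are normalized both before and after
  \<open>F\<close>; \<open>nf_map\<close> and \<open>nf2_map\<close> remove the inner normalization
  on one side, \<open>nf_Node\<close> and \<open>nf2_horiz\<close> on the other.\<close>

lemma fun3_map: "two_magma_map (normals e A) (normals e B) (map0 F) (\<lambda>t. nf B (map_tree (map1 F) t))
    (\<lambda>c. nf2 B (tree_cell_map F c))"
proof -
  let ?NB = "normals e B"
  let ?NA = "normals e A"
  interpret NA: two_magma "normals e A" by (rule A.two_magma_normals[OF e])
  interpret NB: two_magma "normals e B" by (rule B.two_magma_normals[OF e])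
  interpret F2: two_magma_map "trees e A" "trees e B" "map0 F" "map_tree (map1 F)" "tree_cell_map F"
    by (rule fun2_map)
  note th = B.map_tree_hom[OF A F]
  show ?thesis
  proof unfold_locales
    fix x assume x: "x \<in> twos ?NA"
    then have x': "x \<in> tree_cells A" by simp
    note xx = tree_cell_map_in[OF x']
    show "nf2 B (tree_cell_map F x) \<in> twos ?NB"
      using B.nf2_in[OF xx(1)] xx x' by (auto simp: tree_cells_def)
    show
      "nf B (map_tree (map1 F) (src2 ?NA x)) = src2 ?NB (nf2 B (tree_cell_map F x))"
      "nf B (map_tree (map1 F) (tgt2 ?NA x)) = tgt2 ?NB (nf2 B (tree_cell_map F x))"
      using B.nf2_in[OF xx(1)] xx by auto
    fix y assume y: "y \<in> twos ?NA"
    then have y': "y \<in> tree_cells A" by simp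
    note yy = tree_cell_map_in[OF y']
    show "nf2 B (tree_cell_map F (vert ?NA x y)) =
        vert ?NB (nf2 B (tree_cell_map F x)) (nf2 B (tree_cell_map F y))"
      if "tgt2 ?NA x = src2 ?NA y"
      using that xx yy x' y' F2.map_vert[of x y] B.nf2_vert by simp
    show "nf2 B (tree_cell_map F (horiz2 ?NA x y)) =
        horiz2 ?NB (nf2 B (tree_cell_map F x)) (nf2 B (tree_cell_map F y))"
      if c: "tgt1 ?NA (src2 ?NA x) = src1 ?NA (src2 ?NA y)"
    proof -
      have c': "ttgt A (fst x) = tsrc A (fst y)" using c by simp
      have "nf2 B (tree_cell_map F (nf2 A (tree_horiz A x y))) = nf2 B (tree_cell_map F (tree_horiz A x y))"
        using A.tree_horiz_in[OF x' y' c'] by (intro nf2_map)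
      also have "\<dots> = nf2 B (tree_horiz B (tree_cell_map F x) (tree_cell_map F y))"
        using F2.map_horiz2[of x y] x' y' c' by simp
      also have "\<dots> = nf2 B (tree_horiz B (nf2 B (tree_cell_map F x)) (nf2 B (tree_cell_map F y)))"
        using xx yy x' y' c' by (intro B.nf2_horiz[symmetric]) (auto simp: th tree_cells_def)
      finally show ?thesis by simp
    qed
  next
    fix f g assume f: "f \<in> arrs ?NA" "g \<in> arrs ?NA" "tgt1 ?NA f = src1 ?NA g"
    then show "nf B (map_tree (map1 F) (horiz1 ?NA f g)) =
        horiz1 ?NB (nf B (map_tree (map1 F) f)) (nf B (map_tree (map1 F) g))"
      using nf_map[of "Node f g"] B.nf_Node[of "map_tree (map1 F) f" "map_tree (map1 F) g"] by (simp add: th)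
  next
    fix f assume "f \<in> arrs ?NA"
    then have f: "wf_tree A f" by simp
    then show "nf2 B (tree_cell_map F (unit2 ?NA f)) = unit2 ?NB (nf B (map_tree (map1 F) f))"
      using F2.map_unit2[of f] B.nf2_unit[of "map_tree (map1 F) f"] by (simp add: th)
  qed (auto simp: th F.map_id1 B.nf_unit)
qed

lemma omega_functor_weak: "omega_functor (weak_of e A) (weak_of e B) (weak_functor_of e A B F)"
proof -
  let ?W = "weak_functor_of e A B F"
  let ?TA = "omega (trees e A)"
  let ?TB = "omega (trees e B)"
  interpret F1: two_magma_map "base A" "base B" "map0 F" "map1 F" "map2 F" by (rule fun1_map)
  interpret F2: two_magma_map "trees e A" "trees e B" "map0 F" "map_tree (map1 F)" "tree_cell_map F"
    by (rule fun2_map)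
  interpret F3: two_magma_map "normals e A" "normals e B" "map0 F" "\<lambda>t. nf B (map_tree (map1 F) t)"
    "\<lambda>c. nf2 B (tree_cell_map F c)" by (rule fun3_map)
  note th = B.map_tree_hom[OF A F]
  note D = A.two_magma_base A.two_magma_trees[OF e] A.two_magma_normals[OF e]
    B.two_magma_base B.two_magma_trees[OF e] B.two_magma_normals[OF e]
  have im: "map0 F ` cells0 A \<subseteq> cells0 B" "map1 F ` cells1 A \<subseteq> cells1 B" "map2 F ` cells2 A \<subseteq> cells2 B"
    "map_tree (map1 F) ` {t. wf_tree A t} \<subseteq> {t. wf_tree B t}" "tree_cell_map F ` tree_cells A \<subseteq> tree_cells B"
    "nf A ` {t. wf_tree A t} \<subseteq> {t. wf_tree A t \<and> nf A t = t}"
    "nf2 A ` tree_cells A \<subseteq> {c \<in> tree_cells A. nf A (fst c) = fst c \<and> nf A (fst (snd c)) = fst (snd c)}"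
    "ev A ` {t. wf_tree A t} \<subseteq> cells1 A" "(\<lambda>(s, t, x). x) ` tree_cells A \<subseteq> cells2 A"
    "Leaf ` cells1 A \<subseteq> {t. wf_tree A t}" "(\<lambda>x. (Leaf (dom2 A x), Leaf (cod2 A x), x)) ` cells2 A \<subseteq> tree_cells A"
    using tree_cell_map_in(1) A.nf2_in
    by (auto simp: th image_subset_iff tree_cells_def)
  let ?F2 = "omega_map (trees e A) (trees e B) (map0 F) (map_tree (map1 F)) (tree_cell_map F)"
  have "bridge_morphism ?TA (tree_bridge e A) ?TB (tree_bridge e B) ?F2"
  proof (intro bridge_morphism.intro bridge_morphism_axioms.intro)
    show m: "omega_magma_morphism ?TA ?TB ?F2"
      by (rule F2.omega_magma_morphism_omega)
    interpret M: omega_magma_morphism "omega (trees e A)" "omega (trees e B)" ?F2 by (fact m)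
    fix a b c i assume R: "(a, b, c) \<in> tree_bridge e A i"
    show "(?F2 i a, ?F2 i b, ?F2 (Suc i) c) \<in> tree_bridge e B i"
    proof (cases "i = 1")
      case True
      with R obtain s t x where x: "coherent A s t x" "a = e s" "b = e t" "c = enc2 (trees e A) (s, t, x)"
        unfolding tree_bridge_def by auto
      have "?F2 i a = e (map_tree (map1 F) s)" "?F2 i b = e (map_tree (map1 F) t)"
        "?F2 (Suc i) c = enc2 (trees e B) (tree_cell_map F (s, t, x))"
        using x(2-4) True A.coherentD[OF x(1)] F2.source.inv_enc(2)[of s] F2.source.inv_enc(2)[of t]
          F2.source.inv_enc(3)[of "(s, t, x)"]
        by (auto intro!: image_eqI[where x = "(s, t, x)"])
      then show ?thesis using True coherent_map[OF A B F x(1)] unfolding tree_bridge_def by auto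
    next
      case False
      with R have "a \<in> cells ?TA i" "b = a" "c = Unit ?TA i a"
        by (auto simp: tree_bridge_def diagonal_bridge_def)
      moreover have "?F2 i a \<in> cells ?TB i" if "a \<in> cells ?TA i"
        using M.map_in[of i] that by blast
      ultimately show ?thesis using False M.map_Unit[of a i]
        by (auto simp: tree_bridge_def diagonal_bridge_def simp del: omega_simps)
    qed
  qed
  moreover have "mor_comp ?TA (fun1 ?W) (lam (weak_of e A))
    = mor_comp ?TA (lam (weak_of e B)) (fun2 ?W)"
    using im
    by (simp add: weak_functor_of_def D mor_comp_omega_map)
      (auto intro!: omega_map_cong D simp: th tree_cells_def)
  moreover have "mor_comp ?TA (fun3 ?W) (kap (weak_of e A))
    = mor_comp ?TA (kap (weak_of e B)) (fun2 ?W)"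
    using im
    by (simp add: weak_functor_of_def D mor_comp_omega_map)
      (auto intro!: omega_map_cong D simp: th nf_map nf2_map simp del: tree_cells_iff)
  moreover have "mor_comp (omega (base A)) (fun2 ?W) (rho (weak_of e A))
    = mor_comp (omega (base A)) (rho (weak_of e B)) (fun1 ?W)"
    using im
    by (simp add: weak_functor_of_def D mor_comp_omega_map)
      (auto intro!: omega_map_cong D simp: F.map_dom2 F.map_cod2)
  ultimately show ?thesis
    by (intro omega_functor.intro omega_functor_axioms.intro)
      (simp_all del: omega_simps add: weak_functor_of_def F1.omega_magma_morphism_omega F3.omega_magma_morphism_omega)
qed

end

section \<open>Reflection into bicategories\<close>

definition bicat_comp :: "'u bicategory \<Rightarrow> 'u bicat_hom \<Rightarrow> 'u bicat_hom \<Rightarrow> 'u bicat_hom" where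
  "bicat_comp B G F =
    \<lparr>map0 = compose (cells0 B) (map0 G) (map0 F),
     map1 = compose (cells1 B) (map1 G) (map1 F),
     map2 = compose (cells2 B) (map2 G) (map2 F)\<rparr>"

lemma bicat_comp_at:
  "a \<in> cells0 B \<Longrightarrow> map0 (bicat_comp B G F) a = map0 G (map0 F a)"
  "f \<in> cells1 B \<Longrightarrow> map1 (bicat_comp B G F) f = map1 G (map1 F f)"
  "x \<in> cells2 B \<Longrightarrow> map2 (bicat_comp B G F) x = map2 G (map2 F x)"
  by (simp_all add: bicat_comp_def compose_eq)

lemma (in pre_bicategory) hom_comp:
  assumes F: "strong_homomorphism B B' F" and G: "strong_homomorphism B' B'' G"
  shows "strong_homomorphism B B'' (bicat_comp B G F)"
proof -
  note F' = hom_simps[OF F]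
  interpret G: strong_homomorphism B' B'' G by fact
  have in1: "map0 G a \<in> cells0 B''" if "a \<in> cells0 B'" for a using G.map0_in that by auto
  have in2: "map1 G a \<in> cells1 B''" if "a \<in> cells1 B'" for a using G.map1_in that by auto
  have in3: "map2 G a \<in> cells2 B''" if "a \<in> cells2 B'" for a using G.map2_in that by auto
  show ?thesis
    by unfold_locales
      (auto simp: bicat_comp_def compose_def F' in1 in2 in3 vcomposable_def hcomposable1_def hcomposable2_def
        G.map_dom1[symmetric] G.map_cod1[symmetric] G.map_dom2[symmetric] G.map_cod2[symmetric]
        G.map_id1 G.map_id2 G.map_vcomp G.map_hcomp1 G.map_hcomp2 G.map_alpha G.map_lunit G.map_runit)
qed

text \<open>As the common kernel of homomorphisms this is a congruence at once. The targets range
  over all bicategories on the type \<open>'u\<close>, small or not; when \<open>P\<close> is a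
  bicategory it is among them, with its identity homomorphism.\<close>

definition identified :: "'u bicategory \<Rightarrow> 'u \<Rightarrow> 'u \<Rightarrow> bool" where
  "identified P x y \<longleftrightarrow> x \<in> cells2 P \<and> y \<in> cells2 P \<and> dom2 P x = dom2 P y \<and> cod2 P x = cod2 P y \<and>
    (\<forall>B G. bicategory B \<longrightarrow> strong_homomorphism P B G \<longrightarrow> map2 G x = map2 G y)"

definition rep :: "'u bicategory \<Rightarrow> 'u \<Rightarrow> 'u" where
  "rep P x = (SOME y. identified P x y)"

text \<open>The quotient is carried by chosen representatives, so its 2-cells stay in the universe
  and form a subset of the old ones. If distinct 2-cells are never identified, the construction
  changes nothing.\<close>

definition reflect :: "'u bicategory \<Rightarrow> 'u bicategory" where
  "reflect P = P\<lparr>cells2 := rep P ` cells2 P,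
     dom2 := restrict (dom2 P) (rep P ` cells2 P),
     cod2 := restrict (cod2 P) (rep P ` cells2 P),
     id2 := (\<lambda>f\<in>cells1 P. rep P (id2 P f)),
     vcomp := (\<lambda>x y. if x \<in> rep P ` cells2 P \<and> y \<in> rep P ` cells2 P \<and> cod2 P x = dom2 P y
       then rep P (vcomp P x y) else undefined),
     hcomp2 := (\<lambda>x y. if x \<in> rep P ` cells2 P \<and> y \<in> rep P ` cells2 P \<and>
         cod1 P (dom2 P x) = dom1 P (dom2 P y)
       then rep P (hcomp2 P x y) else undefined),
     alpha := (\<lambda>f g h. if hcomposable1 P f g \<and> hcomposable1 P g h then rep P (alpha P f g h) else undefined),
     lunit := (\<lambda>f\<in>cells1 P. rep P (lunit P f)),
     runit := (\<lambda>f\<in>cells1 P. rep P (runit P f))\<rparr>"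

definition reflect_map :: "'u bicategory \<Rightarrow> 'u bicategory \<Rightarrow> 'u bicat_hom \<Rightarrow> 'u bicat_hom" where
  "reflect_map P P' F = F\<lparr>map2 := (\<lambda>x\<in>rep P ` cells2 P. rep P' (map2 F x))\<rparr>"

context pre_bicategory
begin

lemma identified_refl: "x \<in> C2 \<Longrightarrow> identified B x x"
  by (simp add: identified_def)

lemma identified_rep: "x \<in> C2 \<Longrightarrow> identified B x (rep B x)"
  unfolding rep_def by (rule someI_ex) (auto intro: identified_refl)

lemma rep_eq: "identified B x y \<Longrightarrow> rep B x = rep B y"
proof -
  assume a: "identified B x y"
  have "identified B x = identified B y"
    using a unfolding identified_def fun_eq_iff by metis
  then show ?thesis unfolding rep_def by simp
qed

lemma rep_eqI:
  assumes "x \<in> C2" "y \<in> C2" "s2 x = s2 y" "t2 x = t2 y"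
    "\<And>B' G. \<lbrakk>bicategory B'; strong_homomorphism B B' G\<rbrakk> \<Longrightarrow> map2 G x = map2 G y"
  shows "rep B x = rep B y"
  using assms by (intro rep_eq) (auto simp: identified_def)

lemma rep_in [simp]:
  assumes "x \<in> C2"
  shows "rep B x \<in> C2" "s2 (rep B x) = s2 x" "t2 (rep B x) = t2 x"
  using identified_rep[OF assms] by (auto simp: identified_def)

lemma rep_rep [simp]: "x \<in> C2 \<Longrightarrow> rep B (rep B x) = rep B x"
  using rep_eq[OF identified_rep] by simp

lemma hom_rep: "\<lbrakk>x \<in> C2; bicategory B'; strong_homomorphism B B' G\<rbrakk> \<Longrightarrow> map2 G (rep B x) = map2 G x"
  using identified_rep[of x] by (auto simp: identified_def)

lemma reflect_simps [simp]:
  "cells0 (reflect B) = C0" "cells1 (reflect B) = C1" "dom1 (reflect B) = s1" "cod1 (reflect B) = t1"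
  "id1 (reflect B) = I1" "hcomp1 (reflect B) = hcomp1 B" "cells2 (reflect B) = rep B ` C2"
  "x \<in> C2 \<Longrightarrow> dom2 (reflect B) (rep B x) = s2 x" "x \<in> C2 \<Longrightarrow> cod2 (reflect B) (rep B x) = t2 x"
  "f \<in> C1 \<Longrightarrow> id2 (reflect B) f = rep B (I2 f)"
  "hcomposable1 (reflect B) = hcomposable1 B"
  by (simp_all add: reflect_def hcomposable1_def fun_eq_iff)

text \<open>An operation on representatives may yield a 2-cell other than the representative of the
  composite. Every homomorphism into a bicategory sends both results to the same 2-cell, so the two
  are identified.\<close>

lemma reflect_ops [simp]:
  "\<lbrakk>x \<in> C2; y \<in> C2; t2 x = s2 y\<rbrakk> \<Longrightarrow> vcomp (reflect B) (rep B x) (rep B y) = rep B (x \<cdot> y)"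
  "\<lbrakk>x \<in> C2; y \<in> C2; t1 (s2 x) = s1 (s2 y)\<rbrakk> \<Longrightarrow> hcomp2 (reflect B) (rep B x) (rep B y) = rep B (x \<star> y)"
  "\<lbrakk>f \<in> C1; g \<in> C1; h \<in> C1; t1 f = s1 g; t1 g = s1 h\<rbrakk> \<Longrightarrow> alpha (reflect B) f g h = rep B (alpha B f g h)"
  "f \<in> C1 \<Longrightarrow> lunit (reflect B) f = rep B (lunit B f)"
  "f \<in> C1 \<Longrightarrow> runit (reflect B) f = rep B (runit B f)"
proof -
  show "\<lbrakk>x \<in> C2; y \<in> C2; t2 x = s2 y\<rbrakk> \<Longrightarrow> vcomp (reflect B) (rep B x) (rep B y) = rep B (x \<cdot> y)"
    by (auto simp: reflect_def hom_simps hom_rep intro!: rep_eqI)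
  show "\<lbrakk>x \<in> C2; y \<in> C2; t1 (s2 x) = s1 (s2 y)\<rbrakk> \<Longrightarrow> hcomp2 (reflect B) (rep B x) (rep B y) = rep B (x \<star> y)"
    by (auto simp: reflect_def hom_simps hom_rep intro!: rep_eqI)
qed (simp_all add: reflect_def hcomposable1_def)

lemma invertible2_reflect:
  assumes "invertible2 B x" "x \<in> C2"
  shows "invertible2 (reflect B) (rep B x)"
proof -
  obtain y where y: "y \<in> C2" "s2 y = t2 x" "t2 y = s2 x" "x \<cdot> y = I2 (s2 x)" "y \<cdot> x = I2 (t2 x)"
    using assms unfolding invertible2_def two_cell_def by auto
  then show ?thesis using assms
    unfolding invertible2_def two_cell_def by (intro exI[of _ "rep B y"]) auto
qed

text \<open>Both sides of an axiom are lifted to 2-cells of \<open>B\<close> and compared by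
  \<open>rep_eqI\<close>. Under any homomorphism into a bicategory \<open>B'\<close> the lifted
  equation becomes the same axiom of \<open>B'\<close>.\<close>

lemma bicategory_reflect: "bicategory (reflect B)" (is "bicategory ?Q")
proof -
  have st: "dom2 ?Q \<in> rep B ` C2 \<rightarrow>\<^sub>E C1" "cod2 ?Q \<in> rep B ` C2 \<rightarrow>\<^sub>E C1"
    "id2 ?Q \<in> C1 \<rightarrow>\<^sub>E rep B ` C2" "lunit ?Q \<in> C1 \<rightarrow>\<^sub>E rep B ` C2"
    "runit ?Q \<in> C1 \<rightarrow>\<^sub>E rep B ` C2"
    by (auto simp: reflect_def)
  have vc: "vcomposable ?Q x y \<longleftrightarrow> (\<exists>a b. x = rep B a \<and> y = rep B b \<and> a \<in> C2 \<and> b \<in> C2 \<and> t2 a = s2 b)" for x y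
    unfolding vcomposable_def reflect_simps(7) by (auto; blast)
  have hc: "hcomposable2 ?Q x y \<longleftrightarrow>
      (\<exists>a b. x = rep B a \<and> y = rep B b \<and> a \<in> C2 \<and> b \<in> C2 \<and> t1 (s2 a) = s1 (s2 b))" for x y
    unfolding hcomposable2_def reflect_simps(7) by (auto; blast)
  have G: "map2 G x = map2 G y"
    if "identified B x y" "bicategory B'" "strong_homomorphism B B' G" for x y B' G
    using that by (auto simp: identified_def)
  show ?thesis
  proof
    fix x y assume "\<not> vcomposable ?Q x y"
    then show "vcomp ?Q x y = undefined"
      by (auto simp: reflect_def vcomposable_def)
  next
    fix x y assume "\<not> hcomposable2 ?Q x y"
    then show "hcomp2 ?Q x y = undefined"
      by (auto simp: reflect_def hcomposable2_def)
  next
    fix f g h assume "\<not> (hcomposable1 ?Q f g \<and> hcomposable1 ?Q g h)"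
    then show "alpha ?Q f g h = undefined"
      by (auto simp: reflect_def hcomposable1_def)
  next
    fix x y z assume "vcomposable ?Q x y" "vcomposable ?Q y z"
    then obtain a b c where abc: "x = rep B a" "y = rep B b" "z = rep B c" "a \<in> C2" "b \<in> C2" "c \<in> C2"
      "t2 a = s2 b" "t2 b = s2 c"
      by (force simp: vcomposable_def)
    have "rep B ((a \<cdot> b) \<cdot> c) = rep B (a \<cdot> b \<cdot> c)"
    proof (rule rep_eqI)
      fix B' G assume B': "bicategory B'" and G: "strong_homomorphism B B' G"
      interpret B': bicategory B' by fact
      show "map2 G ((a \<cdot> b) \<cdot> c) = map2 G (a \<cdot> b \<cdot> c)" using abc by (simp add: hom_simps[OF G])
    qed (use abc in auto)
    then show "vcomp ?Q (vcomp ?Q x y) z = vcomp ?Q x (vcomp ?Q y z)"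
      using abc by simp
  next
    fix x assume "x \<in> cells2 ?Q"
    then obtain a where a: "x = rep B a" "a \<in> C2" by auto
    have "rep B (I2 (s2 a) \<cdot> a) = rep B a" (is "rep _ ?l = _")
      and "rep B (a \<cdot> I2 (t2 a)) = rep B a" (is "rep _ ?r = _")
      and "rep B ((I2 (I1 (s1 (s2 a))) \<star> a) \<cdot> lunit B (t2 a)) = rep B (lunit B (s2 a) \<cdot> a)" (is "rep _ ?p = rep _ ?p'")
      and "rep B ((a \<star> I2 (I1 (t1 (s2 a)))) \<cdot> runit B (t2 a)) = rep B (runit B (s2 a) \<cdot> a)" (is "rep _ ?q = rep _ ?q'")
    proof -
      have "map2 G ?l = map2 G a \<and> map2 G ?r = map2 G a \<and> map2 G ?p = map2 G ?p' \<and> map2 G ?q = map2 G ?q'"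
        if B': "bicategory B'" and G: "strong_homomorphism B B' G" for B' G
      proof -
        interpret B': bicategory B' by fact
        show ?thesis
          using a B'.lunit_natural[of "map2 G a"] B'.runit_natural[of "map2 G a"] by (simp add: hom_simps[OF G])
      qed
      then show "rep B ?l = rep B a" "rep B ?r = rep B a" "rep B ?p = rep B ?p'" "rep B ?q = rep B ?q'"
        using a by (auto intro!: rep_eqI)
    qed
    then show "vcomp ?Q (id2 ?Q (dom2 ?Q x)) x = x"
      "vcomp ?Q x (id2 ?Q (cod2 ?Q x)) = x"
      "vcomp ?Q (hcomp2 ?Q (id2 ?Q (id1 ?Q (dom1 ?Q (dom2 ?Q x)))) x)
         (lunit ?Q (cod2 ?Q x)) = vcomp ?Q (lunit ?Q (dom2 ?Q x)) x"
      "vcomp ?Q (hcomp2 ?Q x (id2 ?Q (id1 ?Q (cod1 ?Q (dom2 ?Q x)))))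
         (runit ?Q (cod2 ?Q x)) = vcomp ?Q (runit ?Q (dom2 ?Q x)) x"
      using a by simp_all
  next
    fix f g assume "hcomposable1 ?Q f g"
    then have fg: "f \<in> C1" "g \<in> C1" "t1 f = s1 g" by (auto simp: hcomposable1_def)
    have "rep B (I2 f \<star> I2 g) = rep B (I2 (f \<odot> g))" (is "rep _ ?l = rep _ ?l'")
      and "rep B (alpha B f (I1 (t1 f)) g \<cdot> (I2 f \<star> lunit B g)) = rep B (runit B f \<star> I2 g)" (is "rep _ ?r = rep _ ?r'")
    proof -
      have "map2 G ?l = map2 G ?l' \<and> map2 G ?r = map2 G ?r'"
        if B': "bicategory B'" and G: "strong_homomorphism B B' G" for B' G
      proof -
        interpret B': bicategory B' by fact
        show ?thesis using fg B'.triangle'[of "map1 G f" "map1 G g"] by (simp add: hom_simps[OF G])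
      qed
      then show "rep B ?l = rep B ?l'" "rep B ?r = rep B ?r'" using fg by (auto intro!: rep_eqI)
    qed
    then show "hcomp2 ?Q (id2 ?Q f) (id2 ?Q g) = id2 ?Q (hcomp1 ?Q f g)"
      "vcomp ?Q (alpha ?Q f (id1 ?Q (cod1 ?Q f)) g)
        (hcomp2 ?Q (id2 ?Q f) (lunit ?Q g)) =
       hcomp2 ?Q (runit ?Q f) (id2 ?Q g)"
      using fg by simp_all
  next
    fix x x' y y' assume a: "vcomposable ?Q x x'" "vcomposable ?Q y y'" "hcomposable2 ?Q x y"
    then obtain a a' b b' where abc: "x = rep B a" "x' = rep B a'" "y = rep B b" "y' = rep B b'" "a \<in> C2" "b \<in> C2" "a' \<in> C2" "b' \<in> C2"
      "t2 a = s2 a'" "t2 b = s2 b'" "t1 (s2 a) = s1 (s2 b)"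
      by (force simp: vcomposable_def hcomposable2_def)
    have [simp]: "t1 (s2 a') = t1 (s2 a)" "s1 (s2 b') = s1 (s2 b)"
      using abc typing0(5)[of b] typing0(6)[of a] by auto
    have "rep B ((a \<cdot> a') \<star> (b \<cdot> b')) = rep B ((a \<star> b) \<cdot> (a' \<star> b'))"
    proof (rule rep_eqI)
      fix B' G assume B': "bicategory B'" and G: "strong_homomorphism B B' G"
      interpret B': bicategory B' by fact
      show "map2 G ((a \<cdot> a') \<star> (b \<cdot> b')) = map2 G ((a \<star> b) \<cdot> (a' \<star> b'))"
        using abc by (simp add: hom_simps[OF G] B'.interchange)
    qed (use abc in auto)
    then show "hcomp2 ?Q (vcomp ?Q x x') (vcomp ?Q y y') =
        vcomp ?Q (hcomp2 ?Q x y) (hcomp2 ?Q x' y')"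
      using abc by simp
  next
    fix x y z assume a: "hcomposable2 ?Q x y" "hcomposable2 ?Q y z"
    then obtain a b c where abc: "x = rep B a" "y = rep B b" "z = rep B c" "a \<in> C2" "b \<in> C2" "c \<in> C2"
      "t1 (s2 a) = s1 (s2 b)" "t1 (s2 b) = s1 (s2 c)"
      by (force simp: hcomposable2_def)
    have "rep B (((a \<star> b) \<star> c) \<cdot> alpha B (t2 a) (t2 b) (t2 c)) =
        rep B (alpha B (s2 a) (s2 b) (s2 c) \<cdot> (a \<star> b \<star> c))"
    proof (rule rep_eqI)
      fix B' G assume B': "bicategory B'" and G: "strong_homomorphism B B' G"
      interpret B': bicategory B' by fact
      show "map2 G (((a \<star> b) \<star> c) \<cdot> alpha B (t2 a) (t2 b) (t2 c)) =
          map2 G (alpha B (s2 a) (s2 b) (s2 c) \<cdot> (a \<star> b \<star> c))"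
        using abc B'.alpha_nat[of "map2 G a" "map2 G b" "map2 G c"] by (simp add: hom_simps[OF G])
    qed (use abc in auto)
    then show "vcomp ?Q (hcomp2 ?Q (hcomp2 ?Q x y) z)
          (alpha ?Q (cod2 ?Q x) (cod2 ?Q y) (cod2 ?Q z)) =
        vcomp ?Q (alpha ?Q (dom2 ?Q x) (dom2 ?Q y) (dom2 ?Q z))
          (hcomp2 ?Q x (hcomp2 ?Q y z))"
      using abc by simp
  next
    fix f g h k assume "hcomposable1 ?Q f g" "hcomposable1 ?Q g h" "hcomposable1 ?Q h k"
    then have c: "f \<in> C1" "g \<in> C1" "h \<in> C1" "k \<in> C1" "t1 f = s1 g" "t1 g = s1 h" "t1 h = s1 k"
      by (auto simp: hcomposable1_def)
    have "rep B (alpha B (f \<odot> g) h k \<cdot> alpha B f g (h \<odot> k)) =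
        rep B ((alpha B f g h \<star> I2 k) \<cdot> alpha B f (g \<odot> h) k \<cdot> (I2 f \<star> alpha B g h k))"
    proof (rule rep_eqI)
      fix B' G assume B': "bicategory B'" and G: "strong_homomorphism B B' G"
      interpret B': bicategory B' by fact
      show "map2 G (alpha B (f \<odot> g) h k \<cdot> alpha B f g (h \<odot> k)) =
          map2 G ((alpha B f g h \<star> I2 k) \<cdot> alpha B f (g \<odot> h) k \<cdot> (I2 f \<star> alpha B g h k))"
        using c B'.pentagon'[of "map1 G f" "map1 G g" "map1 G h" "map1 G k"] by (simp add: hom_simps[OF G])
    qed (use c in auto)
    then show "vcomp ?Q (alpha ?Q (hcomp1 ?Q f g) h k) (alpha ?Q f g (hcomp1 ?Q h k)) =
      vcomp ?Q (hcomp2 ?Q (alpha ?Q f g h) (id2 ?Q k))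
        (vcomp ?Q (alpha ?Q f (hcomp1 ?Q g h) k)
          (hcomp2 ?Q (id2 ?Q f) (alpha ?Q g h k)))"
      using c by simp
  next
    fix f g h assume "hcomposable1 ?Q f g" "hcomposable1 ?Q g h"
    then show "two_cell ?Q (alpha ?Q f g h) (hcomp1 ?Q (hcomp1 ?Q f g) h)
        (hcomp1 ?Q f (hcomp1 ?Q g h))"
      "invertible2 ?Q (alpha ?Q f g h)"
      using alpha_invertible[of f g h] by (auto simp: two_cell_def hcomposable1_def intro: invertible2_reflect)
  qed (use dom1_in cod1_in id1_in hcomp1_undefined lunit_invertible runit_invertible in
    \<open>auto simp: st vc hc two_cell_def hcomposable1_def intro: invertible2_reflect\<close>)
qed

end

text \<open>Homomorphisms respect the identification: a homomorphism out of \<open>P'\<close>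
  composed with \<open>F\<close> is one of the homomorphisms that test 2-cells of
  \<open>P\<close>.\<close>

lemma rep_map:
  assumes P: "pre_bicategory P" and P': "pre_bicategory P'" and F: "strong_homomorphism P P' F"
    and x: "x \<in> cells2 P"
  shows "rep P' (map2 F (rep P x)) = rep P' (map2 F x)"
proof -
  interpret P: pre_bicategory P by fact
  interpret P': pre_bicategory P' by fact
  show ?thesis
  proof (rule P'.rep_eqI)
    fix B' G assume B': "bicategory B'" and G: "strong_homomorphism P' B' G"
    have "map2 (bicat_comp P G F) (rep P x) = map2 (bicat_comp P G F) x"
      using P.hom_rep[OF x B' P.hom_comp[OF F G]] .
    then show "map2 G (map2 F (rep P x)) = map2 G (map2 F x)"
      using x by (simp add: bicat_comp_def compose_eq)
  qed (use x in \<open>simp_all add: P.hom_simps[OF F]\<close>)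
qed

lemma strong_homomorphism_reflect_map:
  assumes P: "pre_bicategory P" and P': "pre_bicategory P'" and F: "strong_homomorphism P P' F"
  shows "strong_homomorphism (reflect P) (reflect P') (reflect_map P P' F)"
proof -
  let ?Q' = "reflect P'"
  let ?Q = "reflect P"
  let ?R = "reflect_map P P' F"
  interpret P: pre_bicategory P by fact
  interpret P': pre_bicategory P' by fact
  interpret F: strong_homomorphism P P' F by fact
  have m2: "map2 ?R (rep P x) = rep P' (map2 F x)" if "x \<in> cells2 P" for x
    using that by (simp add: reflect_map_def rep_map[OF P P' F])
  have m1: "map1 ?R = map1 F" "map0 ?R = map0 F"
    by (simp_all add: reflect_map_def)
  show ?thesis
  proof
    show "map2 ?R \<in> cells2 ?Q \<rightarrow>\<^sub>E cells2 ?Q'"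
      by (auto simp: m2 P.hom_simps[OF F]) (auto simp: reflect_map_def)
  next
    fix x y assume "vcomposable ?Q x y"
    then obtain a b where "x = rep P a" "y = rep P b" "a \<in> cells2 P" "b \<in> cells2 P" "cod2 P a = dom2 P b"
      unfolding vcomposable_def P.reflect_simps(7) by auto
    then show "map2 ?R (vcomp ?Q x y) =
      vcomp ?Q' (map2 ?R x) (map2 ?R y)"
      by (simp add: m2 P.hom_simps[OF F])
  next
    fix x y assume "hcomposable2 ?Q x y"
    then obtain a b where "x = rep P a" "y = rep P b" "a \<in> cells2 P" "b \<in> cells2 P"
      "cod1 P (dom2 P a) = dom1 P (dom2 P b)"
      unfolding hcomposable2_def P.reflect_simps(7) by auto
    then show "map2 ?R (hcomp2 ?Q x y) =
      hcomp2 ?Q' (map2 ?R x) (map2 ?R y)"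
      by (simp add: m2 P.hom_simps[OF F])
  qed (use F.map0_in F.map1_in in \<open>auto simp: m1 m2 P.hom_simps[OF F] hcomposable1_def\<close>)
qed

text \<open>The identity homomorphism of a bicategory separates all its 2-cells, so every class is a
  singleton.\<close>

lemma (in bicategory) rep_id:
  assumes "x \<in> C2"
  shows "rep B x = x"
  using hom_rep[OF assms bicategory_axioms hom_id] assms by (simp add: bicat_id_def)

lemma (in bicategory) reflect_id: "reflect B = B"
proof -
  have [simp]: "rep B ` C2 = C2" using rep_id by force
  have ext: "restrict f A = f" if "f \<in> A \<rightarrow>\<^sub>E D" for f :: "'u \<Rightarrow> 'u" and A D
    using that by (simp add: PiE_restrict)
  have "(\<lambda>f\<in>C1. rep B (I2 f)) = I2" "(\<lambda>f\<in>C1. rep B (lunit B f)) = lunit B" "(\<lambda>f\<in>C1. rep B (runit B f)) = runit B"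
    using ext[OF id2_in] ext[OF lunit_in] ext[OF runit_in] by (auto simp: rep_id cong: restrict_cong)
  moreover have "(\<lambda>x y. if x \<in> C2 \<and> y \<in> C2 \<and> t2 x = s2 y then rep B (x \<cdot> y) else undefined) = vcomp B"
    using vcomp_undefined by (auto simp: fun_eq_iff rep_id vcomposable_def)
  moreover have "(\<lambda>x y. if x \<in> C2 \<and> y \<in> C2 \<and> t1 (s2 x) = s1 (s2 y) then rep B (x \<star> y) else undefined) = hcomp2 B"
    using hcomp2_undefined by (auto simp: fun_eq_iff rep_id hcomposable2_def)
  moreover have "(\<lambda>f g h. if hcomposable1 B f g \<and> hcomposable1 B g h then rep B (alpha B f g h) else undefined) = alpha B"
    using alpha_undefined by (auto simp: fun_eq_iff rep_id hcomposable1_def)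
  ultimately show ?thesis
    unfolding reflect_def by (simp add: ext[OF dom2_in] ext[OF cod2_in])
qed

lemma reflect_map_id:
  assumes "bicategory A" "bicategory B" "strong_homomorphism A B F"
  shows "reflect_map A B F = F"
proof -
  interpret A: bicategory A by fact
  interpret B: bicategory B by fact
  interpret F: strong_homomorphism A B F by fact
  have [simp]: "rep A ` cells2 A = cells2 A" using A.rep_id by force
  have "(\<lambda>x\<in>cells2 A. rep B (map2 F x)) = map2 F"
    using F.map2_in by (auto simp: fun_eq_iff B.rep_id PiE_iff extensional_def)
  then show ?thesis by (simp add: reflect_map_def)
qed

section \<open>From weak 2-categories to bicategories\<close>

definition bridge_cell :: "'u weak_omega_category \<Rightarrow> 'u \<Rightarrow> 'u \<Rightarrow> 'u" where
  "bridge_cell X a b = (THE c. (a, b, c) \<in> bridge X 1)"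

definition comp01 :: "'u weak_omega_category \<Rightarrow> 'u \<Rightarrow> 'u \<Rightarrow> 'u" where
  "comp01 X = ocomp (mag2 X) 0 1"

text \<open>The unit cells start from \<open>rho\<close> of an identity composed with
  \<open>rho\<close> of \<open>f\<close>. Since \<open>rho\<close> preserves units,
  \<open>kap\<close> sends this composite to \<open>kap (rho f)\<close> by a unit law of
  \<open>cat3\<close>, so the required bridge exists.\<close>

definition pre_of :: "'u weak_omega_category \<Rightarrow> 'u bicategory" where
  "pre_of X =
    \<lparr>cells0 = cells (mag1 X) 0, cells1 = cells (mag1 X) 1, cells2 = cells (mag1 X) 2,
     dom1 = Dom (mag1 X) 0, cod1 = Cod (mag1 X) 0, dom2 = Dom (mag1 X) 1, cod2 = Cod (mag1 X) 1,
     id1 = Unit (mag1 X) 0, id2 = Unit (mag1 X) 1,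
     vcomp = ocomp (mag1 X) 1 2, hcomp1 = ocomp (mag1 X) 0 1, hcomp2 = ocomp (mag1 X) 0 2,
     alpha = (\<lambda>f g h. if composable (mag1 X) 0 1 f g \<and> composable (mag1 X) 0 1 g h
       then lam X 2 (bridge_cell X (comp01 X (comp01 X (rho X 1 f) (rho X 1 g)) (rho X 1 h))
         (comp01 X (rho X 1 f) (comp01 X (rho X 1 g) (rho X 1 h))))
       else undefined),
     lunit = (\<lambda>f\<in>cells (mag1 X) 1. lam X 2 (bridge_cell X
       (comp01 X (rho X 1 (Unit (mag1 X) 0 (Dom (mag1 X) 0 f))) (rho X 1 f)) (rho X 1 f))),
     runit = (\<lambda>f\<in>cells (mag1 X) 1. lam X 2 (bridge_cell X
       (comp01 X (rho X 1 f) (rho X 1 (Unit (mag1 X) 0 (Cod (mag1 X) 0 f)))) (rho X 1 f)))\<rparr>"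

definition pre_map :: "'u omega_functor \<Rightarrow> 'u bicat_hom" where
  "pre_map F = \<lparr>map0 = fun1 F 0, map1 = fun1 F 1, map2 = fun1 F 2\<rparr>"

lemma composable_01: "composable X 0 (Suc 0) a b \<longleftrightarrow>
    a \<in> cells X (Suc 0) \<and> b \<in> cells X (Suc 0) \<and> Cod X 0 a = Dom X 0 b"
  by (simp add: composable_def)

lemma composable_12: "composable X (Suc 0) (Suc (Suc 0)) a b \<longleftrightarrow>
    a \<in> cells X (Suc (Suc 0)) \<and> b \<in> cells X (Suc (Suc 0)) \<and> Cod X (Suc 0) a = Dom X (Suc 0) b"
  by (simp add: composable_def)

lemma (in globular_set) composable_02: "composable X 0 (Suc (Suc 0)) a b \<longleftrightarrow>
    a \<in> cells X (Suc (Suc 0)) \<and> b \<in> cells X (Suc (Suc 0)) \<and> Cod X 0 (Dom X (Suc 0) a) = Dom X 0 (Dom X (Suc 0) b)"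
  using Cod_Dom by (auto simp: composable_def)

lemma (in globular_set) Dom_Cod_in [simp]:
  "a \<in> cells X (Suc i) \<Longrightarrow> Dom X i a \<in> cells X i" "a \<in> cells X (Suc i) \<Longrightarrow> Cod X i a \<in> cells X i"
  using Dom_in Cod_in by (auto simp: PiE_iff)

lemma (in omega_graph) Unit_in' [simp]: "a \<in> cells X i \<Longrightarrow> Unit X i a \<in> cells X (Suc i)"
  using Unit_in by (auto simp: PiE_iff)

lemma (in globular_morphism) map_in' [simp]: "a \<in> cells X i \<Longrightarrow> F i a \<in> cells Y i"
  using map_in by (auto simp: PiE_iff)

locale weak_two_category = weak_omega_category X for X :: "'u weak_omega_category" +
  assumes skeletal: "skeletal 2 (mag1 X)"
begin

abbreviation r where "r \<equiv> rho X (Suc 0)"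
abbreviation c2 (infixl \<open>\<bullet>\<close> 70) where "f \<bullet> g \<equiv> ocomp (mag2 X) 0 (Suc 0) f g"

lemma lam_rho_at: "a \<in> cells (mag1 X) i \<Longrightarrow> lam X i (rho X i a) = a"
  using fun_cong[OF fun_cong[OF lam_rho, of i], of a] by (simp add: mor_comp_def mor_id_def compose_eq)

text \<open>In dimension 3 the bridge is mapped by \<open>lam\<close> to an identity cell.\<close>

lemma lam_eq:
  assumes "parallel (mag2 X) (Suc (Suc 0)) x y" "kap X (Suc (Suc 0)) x = kap X (Suc (Suc 0)) y"
  shows "lam X (Suc (Suc 0)) x = lam X (Suc (Suc 0)) y"
proof -
  obtain d where d: "(x, y, d) \<in> bridge X (Suc (Suc 0))" using kappa.bridge_exists[OF assms] by blast
  then have d3: "d \<in> cells (mag2 X) (Suc (Suc (Suc 0)))" "Dom (mag2 X) (Suc (Suc 0)) d = x" "Cod (mag2 X) (Suc (Suc 0)) d = y"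
    using kappa.bridge.bridge_cells kappa.bridge.bridge_Dom kappa.bridge.bridge_Cod by blast+
  then have "lam X (Suc (Suc (Suc 0))) d \<in> cells (mag1 X) (Suc (Suc (Suc 0)))" by simp
  then obtain z where z: "z \<in> cells (mag1 X) (Suc (Suc 0))" "lam X (Suc (Suc (Suc 0))) d = Unit (mag1 X) (Suc (Suc 0)) z"
    using skeletal unfolding skeletal_def by (metis imageE le_refl numeral_2_eq_2)
  have "lam X (Suc (Suc 0)) x = Dom (mag1 X) (Suc (Suc 0)) (lam X (Suc (Suc (Suc 0))) d)"
    "lam X (Suc (Suc 0)) y = Cod (mag1 X) (Suc (Suc 0)) (lam X (Suc (Suc (Suc 0))) d)"
    using lambda.map_Dom[OF d3(1)] lambda.map_Cod[OF d3(1)] d3 by auto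
  then show ?thesis using z M1.Dom_Unit M1.Cod_Unit by simp
qed

definition bridged :: "'u \<Rightarrow> 'u \<Rightarrow> bool" where
  "bridged a b \<longleftrightarrow> parallel (mag2 X) (Suc 0) a b \<and> kap X (Suc 0) a = kap X (Suc 0) b"

lemma bridged_sym: "bridged a b \<Longrightarrow> bridged b a"
  by (auto simp: bridged_def parallel_def)

lemma bridge_cell:
  assumes "bridged a b"
  shows "(a, b, bridge_cell X a b) \<in> bridge X (Suc 0)"
proof -
  obtain c where c: "(a, b, c) \<in> bridge X (Suc 0)" using kappa.bridge_exists assms unfolding bridged_def by blast
  then show ?thesis unfolding bridge_cell_def One_nat_def
    by (rule theI) (use c kappa.bridge.bridge_unique in blast)
qed

lemma bridge_cell_eq: "(a, b, c) \<in> bridge X (Suc 0) \<Longrightarrow> bridge_cell X a b = c"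
  unfolding bridge_cell_def One_nat_def using kappa.bridge.bridge_unique by blast

lemma bridge_cell_in:
  assumes "bridged a b"
  shows "bridge_cell X a b \<in> cells (mag2 X) (Suc (Suc 0))"
    "Dom (mag2 X) (Suc 0) (bridge_cell X a b) = a" "Cod (mag2 X) (Suc 0) (bridge_cell X a b) = b"
    "kap X (Suc (Suc 0)) (bridge_cell X a b) = Unit (cat3 X) (Suc 0) (kap X (Suc 0) a)"
    "a \<in> cells (mag2 X) (Suc 0)" "b \<in> cells (mag2 X) (Suc 0)"
  using bridge_cell[OF assms] kappa.bridge.bridge_cells kappa.bridge.bridge_Dom kappa.bridge.bridge_Cod
    kappa.bridge_collapse by blast+

text \<open>The inverse is the image of the bridge in the opposite direction. In \<open>cat3\<close>
  the composite of the two bridges and the identity have the same image, so \<open>lam_eq\<close>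
  makes their images under \<open>lam\<close> equal.\<close>

lemma lam_bridge_cell:
  assumes "bridged a b"
  shows "two_cell (pre_of X) (lam X 2 (bridge_cell X a b)) (lam X 1 a) (lam X 1 b)"
    "invertible2 (pre_of X) (lam X 2 (bridge_cell X a b))"
proof -
  have two: "two_cell (pre_of X) (lam X 2 (bridge_cell X a b)) (lam X 1 a) (lam X 1 b)" if "bridged a b" for a b
    using bridge_cell_in[OF that] lambda.map_Dom[of "bridge_cell X a b" "Suc 0"]
      lambda.map_Cod[of "bridge_cell X a b" "Suc 0"]
    by (simp add: two_cell_def pre_of_def numeral_2_eq_2)
  have inv: "ocomp (mag1 X) (Suc 0) (Suc (Suc 0)) (lam X 2 (bridge_cell X a b)) (lam X 2 (bridge_cell X b a))
      = Unit (mag1 X) (Suc 0) (lam X 1 a)" if b: "bridged a b" for a b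
  proof -
    note i = bridge_cell_in[OF b] bridge_cell_in[OF bridged_sym[OF b]]
    have c: "composable (mag2 X) (Suc 0) (Suc (Suc 0)) (bridge_cell X a b) (bridge_cell X b a)"
      using i by (simp add: composable_12)
    let ?c = "ocomp (mag2 X) (Suc 0) (Suc (Suc 0)) (bridge_cell X a b) (bridge_cell X b a)"
    have k: "kap X (Suc 0) a = kap X (Suc 0) b" using b by (simp add: bridged_def)
    have ka: "kap X (Suc 0) a \<in> cells (cat3 X) (Suc 0)" using i by simp
    have "kap X (Suc (Suc 0)) ?c = ocomp (cat3 X) (Suc 0) (Suc (Suc 0))
        (Unit (cat3 X) (Suc 0) (kap X (Suc 0) a)) (Unit (cat3 X) (Suc 0) (kap X (Suc 0) a))"
      using kappa.map_comp[OF c] i k by simp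
    also have "\<dots> = Unit (cat3 X) (Suc 0) (kap X (Suc 0) a)"
      using kappa.target.comp_unit_left[of "Suc 0" "Suc (Suc 0)" "Unit (cat3 X) (Suc 0) (kap X (Suc 0) a)"] ka
      by (simp add: kappa.target.Dom_Unit)
    also have "\<dots> = kap X (Suc (Suc 0)) (Unit (mag2 X) (Suc 0) a)"
      using i by (simp add: kappa.map_Unit)
    finally have "lam X (Suc (Suc 0)) ?c = lam X (Suc (Suc 0)) (Unit (mag2 X) (Suc 0) a)"
      using i c by (intro lam_eq)
        (simp_all add: parallel_def M2.comp_in M2.Dom_comp_top M2.Cod_comp_top M2.Dom_Unit M2.Cod_Unit)
    then show ?thesis using lambda.map_comp[OF c] lambda.map_Unit i by (simp add: numeral_2_eq_2)
  qed
  show "two_cell (pre_of X) (lam X 2 (bridge_cell X a b)) (lam X 1 a) (lam X 1 b)"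
    using two assms .
  show "invertible2 (pre_of X) (lam X 2 (bridge_cell X a b))"
    unfolding invertible2_def
    using two[OF assms] two[OF bridged_sym[OF assms]] inv[OF assms] inv[OF bridged_sym[OF assms]]
    by (intro exI[of _ "lam X 2 (bridge_cell X b a)"]) (simp add: two_cell_def pre_of_def numeral_2_eq_2)
qed

lemma comp01_in [simp]:
  assumes "f \<in> cells (mag2 X) (Suc 0)" "g \<in> cells (mag2 X) (Suc 0)" "Cod (mag2 X) 0 f = Dom (mag2 X) 0 g"
  shows "f \<bullet> g \<in> cells (mag2 X) (Suc 0)" "Dom (mag2 X) 0 (f \<bullet> g) = Dom (mag2 X) 0 f"
    "Cod (mag2 X) 0 (f \<bullet> g) = Cod (mag2 X) 0 g"
    "kap X (Suc 0) (f \<bullet> g) = ocomp (cat3 X) 0 (Suc 0) (kap X (Suc 0) f) (kap X (Suc 0) g)"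
    "lam X (Suc 0) (f \<bullet> g) = ocomp (mag1 X) 0 (Suc 0) (lam X (Suc 0) f) (lam X (Suc 0) g)"
  using assms M2.comp_in[of 0 "Suc 0" f g] M2.Dom_comp_top[of 0 f g] M2.Cod_comp_top[of 0 f g]
    kappa.map_comp[of 0 "Suc 0" f g] lambda.map_comp[of 0 "Suc 0" f g]
  by (auto simp: composable_01)

lemma rho_in [simp]:
  assumes "f \<in> cells (mag1 X) (Suc 0)"
  shows "Dom (mag2 X) 0 (r f) = rho X 0 (Dom (mag1 X) 0 f)" "Cod (mag2 X) 0 (r f) = rho X 0 (Cod (mag1 X) 0 f)"
    "lam X (Suc 0) (r f) = f"
  using assms rho.map_Dom rho.map_Cod lam_rho_at by auto

lemma kap_composable:
  "\<lbrakk>f \<in> cells (mag2 X) (Suc 0); g \<in> cells (mag2 X) (Suc 0); Cod (mag2 X) 0 f = Dom (mag2 X) 0 g\<rbrakk>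
    \<Longrightarrow> composable (cat3 X) 0 (Suc 0) (kap X (Suc 0) f) (kap X (Suc 0) g)"
  by (simp add: composable_01 kappa.map_Dom[symmetric] kappa.map_Cod[symmetric])

text \<open>\<open>kap\<close> preserves composition and composition in \<open>cat3\<close> is
  strictly associative.\<close>

lemma bridged_assoc:
  assumes "f \<in> cells (mag2 X) (Suc 0)" "g \<in> cells (mag2 X) (Suc 0)" "h \<in> cells (mag2 X) (Suc 0)"
    "Cod (mag2 X) 0 f = Dom (mag2 X) 0 g" "Cod (mag2 X) 0 g = Dom (mag2 X) 0 h"
  shows "bridged (f \<bullet> g \<bullet> h) (f \<bullet> (g \<bullet> h))"
  using assms kappa.target.comp_assoc[OF kap_composable[of f g] kap_composable[of g h]]
  by (simp add: bridged_def parallel_def)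

lemma bridged_unit:
  assumes "f \<in> cells (mag2 X) (Suc 0)"
  shows "bridged (Unit (mag2 X) 0 (Dom (mag2 X) 0 f) \<bullet> f) f" "bridged (f \<bullet> Unit (mag2 X) 0 (Cod (mag2 X) 0 f)) f"
  using assms kappa.target.comp_unit_left[of 0 "Suc 0" "kap X (Suc 0) f"]
    kappa.target.comp_unit_right[of 0 "Suc 0" "kap X (Suc 0) f"]
  by (simp_all add: bridged_def parallel_def M2.Dom_Unit M2.Cod_Unit kappa.map_Unit kappa.map_Dom kappa.map_Cod)

lemma bridged_rho:
  "\<lbrakk>composable (mag1 X) 0 (Suc 0) f g; composable (mag1 X) 0 (Suc 0) g h\<rbrakk>
    \<Longrightarrow> bridged (r f \<bullet> r g \<bullet> r h) (r f \<bullet> (r g \<bullet> r h))"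
  "f \<in> cells (mag1 X) (Suc 0) \<Longrightarrow> bridged (r (Unit (mag1 X) 0 (Dom (mag1 X) 0 f)) \<bullet> r f) (r f)"
  "f \<in> cells (mag1 X) (Suc 0) \<Longrightarrow> bridged (r f \<bullet> r (Unit (mag1 X) 0 (Cod (mag1 X) 0 f))) (r f)"
  using bridged_assoc[of "r f" "r g" "r h"] bridged_unit[of "r f"]
  by (auto simp: composable_01 rho.map_Unit)

lemma pre_bicategory_pre_of: "pre_bicategory (pre_of X)" (is "pre_bicategory ?P")
proof
  fix x y assume xy: "vcomposable ?P x y"
  have "composable (mag1 X) (Suc 0) (Suc (Suc 0)) x y"
    using xy by (simp add: vcomposable_def pre_of_def composable_12 numeral_2_eq_2)
  then show "two_cell ?P (vcomp ?P x y) (dom2 ?P x) (cod2 ?P y)"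
    using M1.comp_in M1.Dom_comp_top M1.Cod_comp_top
    by (simp add: two_cell_def pre_of_def numeral_2_eq_2)
next
  fix x y assume "hcomposable2 ?P x y"
  then have xy: "composable (mag1 X) 0 (Suc (Suc 0)) x y"
    by (simp add: hcomposable2_def pre_of_def M1.composable_02 numeral_2_eq_2)
  then show "two_cell ?P (hcomp2 ?P x y) (hcomp1 ?P (dom2 ?P x) (dom2 ?P y))
      (hcomp1 ?P (cod2 ?P x) (cod2 ?P y))"
    using M1.comp_in[OF xy] M1.Dom_comp[of 0 "Suc 0" x y] M1.Cod_comp[of 0 "Suc 0" x y]
    by (simp add: two_cell_def pre_of_def numeral_2_eq_2)
next
  fix f g assume fg: "hcomposable1 ?P f g"
  then have c: "composable (mag1 X) 0 (Suc 0) f g" by (simp add: hcomposable1_def pre_of_def composable_01)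
  then show "hcomp1 ?P f g \<in> cells1 ?P"
    "dom1 ?P (hcomp1 ?P f g) = dom1 ?P f"
    "cod1 ?P (hcomp1 ?P f g) = cod1 ?P g"
    using M1.comp_in[OF c] M1.Dom_comp_top[OF c] M1.Cod_comp_top[OF c]
    by (simp_all add: pre_of_def)
  fix h assume gh: "hcomposable1 ?P g h"
  then have c': "composable (mag1 X) 0 (Suc 0) g h" by (simp add: hcomposable1_def pre_of_def composable_01)
  show "two_cell ?P (alpha ?P f g h) (hcomp1 ?P (hcomp1 ?P f g) h)
      (hcomp1 ?P f (hcomp1 ?P g h))" "invertible2 ?P (alpha ?P f g h)"
    \<comment> \<open>\<open>pre_of_def\<close> is unfolded only in the field \<open>alpha\<close>,
      so that \<open>two_cell\<close> and \<open>invertible2\<close> still match their form in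
      \<open>lam_bridge_cell\<close>.\<close>
    using lam_bridge_cell[OF bridged_rho(1)[OF c c']] c c'
    by (simp_all add: pre_of_def[of X, THEN arg_cong, of alpha] comp01_def)
      (simp add: pre_of_def composable_01)
next
  fix f g assume "\<not> hcomposable1 ?P f g"
  then show "hcomp1 ?P f g = undefined"
    using M1.comp_undefined[of 0 "Suc 0" f g] by (simp add: hcomposable1_def pre_of_def composable_01)
next
  fix f assume "f \<in> cells1 ?P"
  then have f: "f \<in> cells (mag1 X) (Suc 0)" by (simp add: pre_of_def)
  show "two_cell ?P (id2 ?P f) f f"
    using f by (simp add: two_cell_def pre_of_def numeral_2_eq_2 M1.Dom_Unit M1.Cod_Unit)
  show "two_cell ?P (lunit ?P f) (hcomp1 ?P (id1 ?P (dom1 ?P f)) f) f"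
    "invertible2 ?P (lunit ?P f)"
    using lam_bridge_cell[OF bridged_rho(2)[OF f]] f
    by (simp_all add: pre_of_def[of X, THEN arg_cong, of lunit] comp01_def)
      (simp add: pre_of_def M1.Dom_Unit M1.Cod_Unit)
  show "two_cell ?P (runit ?P f) (hcomp1 ?P f (id1 ?P (cod1 ?P f))) f"
    "invertible2 ?P (runit ?P f)"
    using lam_bridge_cell[OF bridged_rho(3)[OF f]] f
    by (simp_all add: pre_of_def[of X, THEN arg_cong, of runit] comp01_def)
      (simp add: pre_of_def M1.Dom_Unit M1.Cod_Unit)
next
  show "dom2 ?P \<in> cells2 ?P \<rightarrow>\<^sub>E cells1 ?P"
    "cod2 ?P \<in> cells2 ?P \<rightarrow>\<^sub>E cells1 ?P"
    using M1.Dom_in[of "Suc 0"] M1.Cod_in[of "Suc 0"] by (simp_all add: pre_of_def numeral_2_eq_2)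
  show "dom1 ?P \<in> cells1 ?P \<rightarrow>\<^sub>E cells0 ?P"
    "cod1 ?P \<in> cells1 ?P \<rightarrow>\<^sub>E cells0 ?P"
    "id1 ?P \<in> cells0 ?P \<rightarrow>\<^sub>E cells1 ?P"
    using M1.Dom_in[of 0] M1.Cod_in[of 0] M1.Unit_in[of 0] by (simp_all add: pre_of_def)
next
  fix x assume "x \<in> cells2 ?P"
  then show "dom1 ?P (dom2 ?P x) = dom1 ?P (cod2 ?P x)"
    "cod1 ?P (dom2 ?P x) = cod1 ?P (cod2 ?P x)"
    using M1.Dom_Dom[of x 0] M1.Cod_Dom[of x 0] by (simp_all add: pre_of_def numeral_2_eq_2)
next
  fix a assume "a \<in> cells0 ?P"
  then show "dom1 ?P (id1 ?P a) = a" "cod1 ?P (id1 ?P a) = a"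
    using M1.Dom_Unit[of a 0] M1.Cod_Unit[of a 0] by (simp_all add: pre_of_def)
qed

end

text \<open>The structure cells are preserved because an omega functor takes bridges to bridges and
  commutes with \<open>lam\<close> and \<open>rho\<close>. A bridge being unique, the image of a
  chosen bridge is the chosen one.\<close>

lemma strong_homomorphism_pre_map:
  assumes X: "weak_two_category X" and Y: "weak_two_category Y" and F: "omega_functor X Y F"
  shows "strong_homomorphism (pre_of X) (pre_of Y) (pre_map F)"
proof -
  interpret X: weak_two_category X by fact
  interpret Y: weak_two_category Y by fact
  interpret F: omega_functor X Y F by fact
  have lam: "fun1 F i (lam X i a) = lam Y i (fun2 F i a)" if "a \<in> cells (mag2 X) i" for i a
    using fun_cong[OF fun_cong[OF F.fun_lam, of i], of a] that by (simp add: mor_comp_def compose_eq)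
  have rho: "fun2 F i (rho X i a) = rho Y i (fun1 F i a)" if "a \<in> cells (mag1 X) i" for i a
    using fun_cong[OF fun_cong[OF F.fun_rho, of i], of a] that by (simp add: mor_comp_def compose_eq)
  have br: "fun1 F 2 (lam X 2 (bridge_cell X a b)) = lam Y 2 (bridge_cell Y (fun2 F 1 a) (fun2 F 1 b))"
    if "X.bridged a b" for a b
    using lam[OF X.bridge_cell_in(1)[OF that]] Y.bridge_cell_eq[OF F.F2.map_bridge[OF X.bridge_cell[OF that]]]
    by (simp add: numeral_2_eq_2)
  have c2: "fun2 F (Suc 0) (X.c2 f g) = Y.c2 (fun2 F (Suc 0) f) (fun2 F (Suc 0) g)"
    if "f \<in> cells (mag2 X) (Suc 0)" "g \<in> cells (mag2 X) (Suc 0)" "Cod (mag2 X) 0 f = Dom (mag2 X) 0 g" for f g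
    using that F.F2.map_comp[of 0 "Suc 0" f g] by (simp add: composable_01)
  have comp: "composable (mag1 Y) 0 (Suc 0) (fun1 F (Suc 0) f) (fun1 F (Suc 0) g)"
    if "composable (mag1 X) 0 (Suc 0) f g" for f g
    using that by (simp add: composable_01 F.F1.map_Dom[symmetric] F.F1.map_Cod[symmetric])
  show ?thesis
  proof
    fix f g h assume "hcomposable1 (pre_of X) f g" "hcomposable1 (pre_of X) g h"
    then have c: "composable (mag1 X) 0 (Suc 0) f g" "composable (mag1 X) 0 (Suc 0) g h"
      by (simp_all add: hcomposable1_def pre_of_def composable_01)
    then have "fun2 F 1 (X.c2 (X.c2 (X.r f) (X.r g)) (X.r h)) =
        Y.c2 (Y.c2 (Y.r (fun1 F (Suc 0) f)) (Y.r (fun1 F (Suc 0) g))) (Y.r (fun1 F (Suc 0) h))"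
      "fun2 F 1 (X.c2 (X.r f) (X.c2 (X.r g) (X.r h))) =
        Y.c2 (Y.r (fun1 F (Suc 0) f)) (Y.c2 (Y.r (fun1 F (Suc 0) g)) (Y.r (fun1 F (Suc 0) h)))"
      by (simp_all add: composable_01 c2 rho)
    with br[OF X.bridged_rho(1)[OF c]]
    show "map2 (pre_map F) (alpha (pre_of X) f g h) =
      alpha (pre_of Y) (map1 (pre_map F) f) (map1 (pre_map F) g) (map1 (pre_map F) h)"
      using c comp by (simp add: pre_of_def pre_map_def comp01_def)
  next
    fix f assume "f \<in> cells1 (pre_of X)"
    then have f: "f \<in> cells (mag1 X) (Suc 0)" by (simp add: pre_of_def)
    have e: "fun2 F 1 (X.c2 (X.r (Unit (mag1 X) 0 (Dom (mag1 X) 0 f))) (X.r f)) =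
        Y.c2 (Y.r (Unit (mag1 Y) 0 (Dom (mag1 Y) 0 (fun1 F (Suc 0) f)))) (Y.r (fun1 F (Suc 0) f))"
      "fun2 F 1 (X.c2 (X.r f) (X.r (Unit (mag1 X) 0 (Cod (mag1 X) 0 f)))) =
        Y.c2 (Y.r (fun1 F (Suc 0) f)) (Y.r (Unit (mag1 Y) 0 (Cod (mag1 Y) 0 (fun1 F (Suc 0) f))))"
      "fun2 F 1 (X.r f) = Y.r (fun1 F (Suc 0) f)"
      using f by (simp_all add: c2 rho X.M1.Dom_Unit X.M1.Cod_Unit F.F1.map_Unit F.F1.map_Dom F.F1.map_Cod)
    show "map2 (pre_map F) (lunit (pre_of X) f) = lunit (pre_of Y) (map1 (pre_map F) f)"
      using br[OF X.bridged_rho(2)[OF f]] e f by (simp add: pre_of_def pre_map_def comp01_def)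
    show "map2 (pre_map F) (runit (pre_of X) f) = runit (pre_of Y) (map1 (pre_map F) f)"
      using br[OF X.bridged_rho(3)[OF f]] e f by (simp add: pre_of_def pre_map_def comp01_def)
  next
    fix x y assume "vcomposable (pre_of X) x y"
    then show "map2 (pre_map F) (vcomp (pre_of X) x y) = vcomp (pre_of Y) (map2 (pre_map F) x) (map2 (pre_map F) y)"
      using F.F1.map_comp[of "Suc 0" "Suc (Suc 0)" x y]
      by (simp add: pre_of_def pre_map_def vcomposable_def composable_12 numeral_2_eq_2)
  next
    fix x y assume "hcomposable2 (pre_of X) x y"
    then show "map2 (pre_map F) (hcomp2 (pre_of X) x y) = hcomp2 (pre_of Y) (map2 (pre_map F) x) (map2 (pre_map F) y)"
      using F.F1.map_comp[of 0 "Suc (Suc 0)" x y]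
      by (simp add: pre_of_def pre_map_def hcomposable2_def X.M1.composable_02 numeral_2_eq_2)
  next
    fix f g assume "hcomposable1 (pre_of X) f g"
    then show "map1 (pre_map F) (hcomp1 (pre_of X) f g) = hcomp1 (pre_of Y) (map1 (pre_map F) f) (map1 (pre_map F) g)"
      using F.F1.map_comp[of 0 "Suc 0" f g]
      by (simp add: pre_of_def pre_map_def hcomposable1_def composable_01)
  qed (use F.F1.map_in[of 0] F.F1.map_in[of "Suc 0"] F.F1.map_in[of "Suc (Suc 0)"] in
    \<open>simp_all add: pre_of_def pre_map_def numeral_2_eq_2 F.F1.map_Dom F.F1.map_Cod F.F1.map_Unit\<close>)
qed

section \<open>Smallness\<close>

context
  includes cardinal_syntax
begin

text \<open>The trees of bounded size have cardinality at most that of \<open>K\<close> by induction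
  on the bound, as \<open>K\<close> is infinite; all trees form a countable union of these
  sets.\<close>

lemma trees_ordLeq:
  fixes K :: "'a set"
  assumes "infinite K"
  shows "|{t. leaves t \<subseteq> K}| \<le>o |K|"
proof -
  \<comment> \<open>\<open>size\<close> counts the inner nodes: \<open>T 0\<close> consists of
    leaves only, and the two subtrees of a node in \<open>T (Suc n)\<close> lie in
    \<open>T n\<close>.\<close>
  define T where "T n = {t. leaves t \<subseteq> K \<and> size t \<le> n}" for n
  have "|T n| \<le>o |K|" for n
  proof (induction n)
    case 0
    have "T 0 \<subseteq> Leaf ` K"
    proof
      fix t assume "t \<in> T 0" then show "t \<in> Leaf ` K" unfolding T_def by (cases t) auto
    qed
    then show ?case using card_of_mono1 card_of_image ordLeq_transitive by blast
  next
    case (Suc n)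
    have "T (Suc n) \<subseteq> Leaf ` K \<union> (\<lambda>(s, t). Node s t) ` (T n \<times> T n)"
    proof
      fix t assume "t \<in> T (Suc n)"
      then show "t \<in> Leaf ` K \<union> (\<lambda>(s, t). Node s t) ` (T n \<times> T n)"
        unfolding T_def by (cases t) auto
    qed
    moreover have "|(\<lambda>(s, t). Node s t) ` (T n \<times> T n)| \<le>o |K|"
      using card_of_Sigma_ordLeq_infinite[OF assms Suc.IH, of "\<lambda>_. T n"] Suc.IH card_of_image ordLeq_transitive by blast
    moreover have "|Leaf ` K| \<le>o |K|" by (rule card_of_image)
    ultimately show ?case
      using ordLeq_transitive[OF card_of_mono1]
        card_of_Un_ordLeq_infinite_Field[of "|K|", OF _ _ _ card_of_Card_order] assms
      by (metis Field_card_of)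
  qed
  then have "|\<Union>n. T n| \<le>o |K|"
    using assms by (intro card_of_UNION_ordLeq_infinite) (auto simp: infinite_iff_card_of_nat)
  moreover have "{t. leaves t \<subseteq> K} = (\<Union>n. T n)" unfolding T_def by auto
  ultimately show ?thesis by simp
qed

lemma ex_tree_code:
  assumes "infinite (UNIV :: 'u set)"
  shows "\<exists>e :: 'u tree \<Rightarrow> 'u. inj e"
  using trees_ordLeq[OF assms] by (simp flip: card_of_ordLeq)

lemma small_iff: "small (A :: 'u set) \<longleftrightarrow> |A| <o |UNIV :: 'u set|"
  unfolding small_def lesspoll_def lepoll_def eqpoll_def
  by (metis card_of_ordIso card_of_ordLeq ordLeq_iff_ordLess_or_ordIso not_ordLess_ordIso)

lemma small_mono: "small B \<Longrightarrow> A \<subseteq> B \<Longrightarrow> small A"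
  unfolding small_iff using card_of_mono1 ordLeq_ordLess_trans by blast

lemma small_Un: "infinite (UNIV :: 'u set) \<Longrightarrow> small (A :: 'u set) \<Longrightarrow> small B \<Longrightarrow> small (A \<union> B)"
  unfolding small_iff by (rule card_of_Un_ordLess_infinite)

text \<open>The bound on trees needs infinitely many labels, while \<open>A\<close> may be finite.
  Adding a countably infinite set to \<open>A\<close> keeps it small because the universe is
  uncountable.\<close>

lemma small_trees:
  fixes A :: "'u set"
  assumes U: "uncountable (UNIV :: 'u set)" and A: "small A"
  shows "small ((e :: 'u tree \<Rightarrow> 'u) ` {t. leaves t \<subseteq> A})"
proof -
  have inf: "infinite (UNIV :: 'u set)" using U uncountable_infinite by blast
  then obtain f :: "nat \<Rightarrow> 'u" where f: "inj f" by (meson infinite_countable_subset)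
  have "\<not> |UNIV :: 'u set| \<le>o |range f|"
  proof
    assume "|UNIV :: 'u set| \<le>o |range f|"
    then obtain g :: "'u \<Rightarrow> 'u" where "inj g" "range g \<subseteq> range f" by (auto simp flip: card_of_ordLeq)
    then have "countable (UNIV :: 'u set)"
      using countable_image_inj_on[of g UNIV] countable_subset[of "range g" "range f"] by auto
    then show False using U by simp
  qed
  then have "small (range f)" unfolding small_iff by (simp add: not_ordLeq_iff_ordLess[OF card_of_Well_order card_of_Well_order])
  then have K: "small (A \<union> range f)" using small_Un[OF inf A] by simp
  have "infinite (A \<union> range f)" using f by (simp add: range_inj_infinite)
  then have "|{t. leaves t \<subseteq> A \<union> range f}| \<le>o |A \<union> range f|" by (rule trees_ordLeq)
  moreover have "{t. leaves t \<subseteq> A} \<subseteq> {t. leaves t \<subseteq> A \<union> range f}" by auto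
  ultimately have "|e ` {t. leaves t \<subseteq> A}| \<le>o |A \<union> range f|"
    using ordLeq_transitive[OF card_of_image ordLeq_transitive[OF card_of_mono1]] by blast
  then show ?thesis using K unfolding small_iff by (rule ordLeq_ordLess_trans)
qed

lemma omega_cells_small:
  "\<lbrakk>small (enc0 D ` objs D); small (enc1 D ` arrs D); small (enc2 D ` twos D)\<rbrakk> \<Longrightarrow> small (omega_cells D i)"
  by (cases i rule: dim_cases) auto

lemma small_weak_of:
  fixes B :: "'u bicategory"
  assumes U: "uncountable (UNIV :: 'u set)" and B: "bicategory B" "small_bicategory B"
  shows "small_weak_omega_category (weak_of e B)"
proof -
  interpret bicategory B by fact
  have inf: "infinite (UNIV :: 'u set)" using U uncountable_infinite by blast
  have s: "small C0" "small C1" "small C2" using B(2) by (auto simp: small_bicategory_def)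
  \<comment> \<open>The leaves range over 1-cells and 2-cells together, because the code of a 2-cell
    of \<open>trees\<close> contains a 2-cell of \<open>B\<close> as a leaf.\<close>
  have T: "small (e ` {t. leaves t \<subseteq> C1 \<union> C2})" by (rule small_trees[OF U small_Un[OF inf s(2,3)]])
  have "e ` {t. wf_tree B t} \<subseteq> e ` {t. leaves t \<subseteq> C1 \<union> C2}" using leaves_in by auto
  moreover have "(\<lambda>(s, t, x). e (Node (Node s t) (Leaf x))) ` tree_cells B \<subseteq> e ` {t. leaves t \<subseteq> C1 \<union> C2}"
    using leaves_in by (fastforce simp: tree_cells_def)
  ultimately have t: "small (e ` {t. wf_tree B t})"
    "small ((\<lambda>(s, t, x). e (Node (Node s t) (Leaf x))) ` tree_cells B)"
    using small_mono[OF T] by auto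
  have "small (e ` {t. wf_tree B t \<and> nf B t = t})"
    "small ((\<lambda>(s, t, x). e (Node (Node s t) (Leaf x))) ` {c \<in> tree_cells B. nf B (fst c) = fst c \<and> nf B (fst (snd c)) = fst (snd c)})"
    by (rule small_mono[OF t(1)], blast) (rule small_mono[OF t(2)], blast)
  then show ?thesis
    unfolding small_weak_omega_category_def weak_of_simps using s t
    by (simp add: omega_cells_small)
qed

end

section \<open>The categories and the functors\<close>

lemma category_Bicat: "category Bicat"
proof -
  have "Cmp Bicat A B C = bicat_comp A" "Idn Bicat = bicat_id" for A B C :: "'a bicategory"
    by (auto simp: Bicat_def bicat_comp_def bicat_id_def fun_eq_iff)
  note s = this
  have o: "bicategory A" if "A \<in> Ob Bicat" for A :: "'a bicategory" using that by (simp add: Bicat_def)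
  have h: "f \<in> Hom Bicat A B \<longleftrightarrow> strong_homomorphism A B f" for A B :: "'a bicategory" and f by (simp add: Bicat_def)
  have comp: "bicat_comp A f (bicat_id A) = f" "bicat_comp A (bicat_id B) f = f"
    if "strong_homomorphism A B f" for A B :: "'a bicategory" and f
  proof -
    interpret strong_homomorphism A B f by fact
    have "compose S g (\<lambda>x\<in>S. x) = g" "compose S (\<lambda>x\<in>T. x) g = g" if "g \<in> S \<rightarrow>\<^sub>E T" for S T and g :: "'a \<Rightarrow> 'a"
      using that by (auto simp: fun_eq_iff compose_def PiE_iff extensional_def)
    then show "bicat_comp A f (bicat_id A) = f" "bicat_comp A (bicat_id B) f = f"
      using map0_in map1_in map2_in by (simp_all add: bicat_comp_def bicat_id_def)
  qed
  show ?thesis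
  proof
    fix A :: "'a bicategory" assume "A \<in> Ob Bicat"
    then show "Idn Bicat A \<in> Hom Bicat A A" using bicategory.hom_id[OF o] by (simp add: s h)
  next
    fix A B D :: "'a bicategory" and f g
    assume A: "A \<in> Ob Bicat" and fg: "f \<in> Hom Bicat A B" "g \<in> Hom Bicat B D"
    interpret A: bicategory A using A by (rule o)
    show "Cmp Bicat A B D g f \<in> Hom Bicat A D" using fg A.hom_comp by (auto simp: s h)
  next
    fix A B :: "'a bicategory" and f assume "f \<in> Hom Bicat A B"
    then show "Cmp Bicat A A B f (Idn Bicat A) = f" "Cmp Bicat A B B (Idn Bicat B) f = f"
      using comp by (auto simp: s h)
  next
    fix A B D E :: "'a bicategory" and f g k
    assume "A \<in> Ob Bicat" "f \<in> Hom Bicat A B"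
    then interpret F: strong_homomorphism A B f by (simp add: h)
    show "Cmp Bicat A D E k (Cmp Bicat A B D g f) = Cmp Bicat A B E (Cmp Bicat B D E k g) f"
      using F.map0_in F.map1_in F.map2_in by (auto simp: s bicat_comp_def compose_def fun_eq_iff)
  qed
qed

lemma category_full_subcategory: "category C \<Longrightarrow> category (full_subcategory C P)"
  unfolding category_def full_subcategory_def by simp

lemma mor_comp_eq_iff:
  "mor_comp X G F = mor_comp X G' F' \<longleftrightarrow> (\<forall>i. \<forall>a \<in> cells X i. G i (F i a) = G' i (F' i a))"
  by (auto simp: mor_comp_def compose_def fun_eq_iff restrict_def)

lemma mor_comp_at: "a \<in> cells X i \<Longrightarrow> mor_comp X G F i a = G i (F i a)"
  by (simp add: mor_comp_def compose_eq)

lemma mor_id_at: "a \<in> cells X i \<Longrightarrow> mor_id X i a = a"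
  by (simp add: mor_id_def)

lemma mor_comp_in: "\<lbrakk>\<And>a. a \<in> cells X i \<Longrightarrow> F i a \<in> cells Y i; \<And>a. a \<in> cells Y i \<Longrightarrow> G i a \<in> cells Z i\<rbrakk>
    \<Longrightarrow> mor_comp X G F i \<in> cells X i \<rightarrow>\<^sub>E cells Z i"
  by (auto simp: mor_comp_def compose_def)

lemma (in globular_morphism) mor_comp_id: "mor_comp X F (mor_id X) = F" "mor_comp X (mor_id Y) F = F"
proof -
  have e: "F i a = undefined" if "a \<notin> cells X i" for i a
    using map_in[of i] that by (simp add: PiE_iff extensional_def)
  show "mor_comp X F (mor_id X) = F" "mor_comp X (mor_id Y) F = F"
    by (auto simp: mor_comp_def mor_id_def compose_def restrict_def fun_eq_iff e)
qed

lemma (in globular_morphism) mor_comp_assoc: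
  "mor_comp X H (mor_comp X G F) = mor_comp X (mor_comp Y H G) F"
  by (auto simp: mor_comp_eq_iff mor_comp_at)

lemma (in globular_set) map_it:
  assumes "globular_morphism X Y F" "i \<le> j" "a \<in> cells X j"
  shows "F i (dom_it X i j a) = dom_it Y i j (F j a)" "F i (cod_it X i j a) = cod_it Y i j (F j a)"
proof -
  interpret F: globular_morphism X Y F by fact
  have "F i (dom_it X i j a) = dom_it Y i j (F j a) \<and> F i (cod_it X i j a) = cod_it Y i j (F j a)"
    using assms(2,3)
  proof (induction j arbitrary: a)
    case (Suc j)
    then show ?case by (cases "i = Suc j") (simp_all add: F.map_Dom[symmetric] F.map_Cod[symmetric])
  qed simp
  then show "F i (dom_it X i j a) = dom_it Y i j (F j a)" "F i (cod_it X i j a) = cod_it Y i j (F j a)" by auto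
qed

lemma (in globular_set) map_composable:
  assumes "globular_morphism X Y F" "composable X i j a b"
  shows "composable Y i j (F j a) (F j b)"
proof -
  interpret F: globular_morphism X Y F by fact
  have "F i (cod_it X i j a) = F i (dom_it X i j b)" using assms(2) by (simp add: composable_def)
  then show ?thesis using assms map_it[OF assms(1), of i j a] map_it[OF assms(1), of i j b]
    by (simp add: composable_def)
qed

lemma omega_graph_morphism_id: "omega_graph X \<Longrightarrow> omega_graph_morphism X X (mor_id X)"
proof -
  assume "omega_graph X" then interpret omega_graph X .
  show ?thesis by unfold_locales (auto simp: mor_id_def)
qed

lemma omega_graph_morphism_comp:
  assumes X: "omega_graph X" and F: "omega_graph_morphism X Y F" and G: "omega_graph_morphism Y Z G"
  shows "omega_graph_morphism X Z (mor_comp X G F)"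
proof -
  interpret omega_graph X by fact
  interpret F: omega_graph_morphism X Y F by fact
  interpret G: omega_graph_morphism Y Z G by fact
  show ?thesis
  proof
    fix i show "mor_comp X G F i \<in> cells X i \<rightarrow>\<^sub>E cells Z i" by (rule mor_comp_in[where Y = Y]) auto
  qed (auto simp: mor_comp_at F.map_Dom G.map_Dom F.map_Cod G.map_Cod F.map_Unit G.map_Unit)
qed

lemma omega_magma_morphism_id: "omega_magma X \<Longrightarrow> omega_magma_morphism X X (mor_id X)"
proof -
  assume "omega_magma X" then interpret omega_magma X .
  interpret omega_graph_morphism X X "mor_id X" by (rule omega_graph_morphism_id) unfold_locales
  show ?thesis
  proof
    fix i j a b assume c: "composable X i j a b"
    then have "a \<in> cells X j" "b \<in> cells X j" by (auto simp: composable_def)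
    then show "mor_id X j (ocomp X i j a b) = ocomp X i j (mor_id X j a) (mor_id X j b)"
      using comp_in[OF c] by (simp add: mor_id_at)
  qed
qed

lemma omega_magma_morphism_comp:
  assumes X: "omega_magma X" and F: "omega_magma_morphism X Y F" and G: "omega_magma_morphism Y Z G"
  shows "omega_magma_morphism X Z (mor_comp X G F)"
proof -
  interpret omega_magma X by fact
  interpret F: omega_magma_morphism X Y F by fact
  interpret G: omega_magma_morphism Y Z G by fact
  interpret omega_graph_morphism X Z "mor_comp X G F"
    by (rule omega_graph_morphism_comp) unfold_locales
  show ?thesis
  proof
    fix i j a b assume c: "composable X i j a b"
    then have "a \<in> cells X j" "b \<in> cells X j" by (auto simp: composable_def)
    then show "mor_comp X G F j (ocomp X i j a b) = ocomp Z i j (mor_comp X G F j a) (mor_comp X G F j b)"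
      using comp_in[OF c] F.map_comp[OF c] G.map_comp[OF map_composable[OF F.globular_morphism_axioms c]]
      by (simp add: mor_comp_at)
  qed
qed

lemma omega_functor_id:
  assumes "weak_omega_category X"
  shows "omega_functor X X \<lparr>fun1 = mor_id (mag1 X), fun2 = mor_id (mag2 X), fun3 = mor_id (cat3 X)\<rparr>"
proof -
  interpret weak_omega_category X by fact
  have b: "(mor_id (mag2 X) i a, mor_id (mag2 X) i b, mor_id (mag2 X) (Suc i) c) \<in> bridge X i"
    if "(a, b, c) \<in> bridge X i" for a b c i
    using that kappa.bridge.bridge_cells[OF that] by (simp add: mor_id_at)
  show ?thesis
    by (intro omega_functor.intro omega_functor_axioms.intro bridge_morphism.intro bridge_morphism_axioms.intro)
      (simp_all add: b omega_magma_morphism_id M1.omega_magma_axioms M2.omega_magma_axioms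
        kappa.target.omega_magma_axioms mor_comp_eq_iff mor_id_at)
qed

lemma omega_functor_comp:
  assumes "weak_omega_category X" "omega_functor X Y F" "omega_functor Y Z G"
  shows "omega_functor X Z \<lparr>fun1 = mor_comp (mag1 X) (fun1 G) (fun1 F),
    fun2 = mor_comp (mag2 X) (fun2 G) (fun2 F), fun3 = mor_comp (cat3 X) (fun3 G) (fun3 F)\<rparr>"
proof -
  interpret weak_omega_category X by fact
  interpret F: omega_functor X Y F by fact
  interpret G: omega_functor Y Z G by fact
  have b: "(mor_comp (mag2 X) (fun2 G) (fun2 F) i a, mor_comp (mag2 X) (fun2 G) (fun2 F) i b,
      mor_comp (mag2 X) (fun2 G) (fun2 F) (Suc i) c) \<in> bridge Z i"
    if "(a, b, c) \<in> bridge X i" for a b c i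
    using G.F2.map_bridge[OF F.F2.map_bridge[OF that]] kappa.bridge.bridge_cells[OF that] by (simp add: mor_comp_at)
  have lam: "fun1 F i (lam X i a) = lam Y i (fun2 F i a)" "fun3 F i (kap X i a) = kap Y i (fun2 F i a)"
    if "a \<in> cells (mag2 X) i" for i a
    using F.fun_lam F.fun_kap that by (auto simp: mor_comp_eq_iff)
  have rho: "fun2 F i (rho X i a) = rho Y i (fun1 F i a)" if "a \<in> cells (mag1 X) i" for i a
    using F.fun_rho that by (auto simp: mor_comp_eq_iff)
  have lam': "fun1 G i (lam Y i a) = lam Z i (fun2 G i a)" "fun3 G i (kap Y i a) = kap Z i (fun2 G i a)"
    if "a \<in> cells (mag2 Y) i" for i a
    using G.fun_lam G.fun_kap that by (auto simp: mor_comp_eq_iff)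
  have rho': "fun2 G i (rho Y i a) = rho Z i (fun1 G i a)" if "a \<in> cells (mag1 Y) i" for i a
    using G.fun_rho that by (auto simp: mor_comp_eq_iff)
  show ?thesis
    by (intro omega_functor.intro omega_functor_axioms.intro bridge_morphism.intro bridge_morphism_axioms.intro)
      (simp_all add: b mor_comp_eq_iff mor_comp_at lam rho lam' rho'
        omega_magma_morphism_comp[OF M1.omega_magma_axioms F.F1.omega_magma_morphism_axioms G.F1.omega_magma_morphism_axioms]
        omega_magma_morphism_comp[OF M2.omega_magma_axioms F.F2.omega_magma_morphism_axioms G.F2.omega_magma_morphism_axioms]
        omega_magma_morphism_comp[OF kappa.target.omega_magma_axioms F.F3.omega_magma_morphism_axioms G.F3.omega_magma_morphism_axioms])
qed

lemma category_Weak_Omega_Cat: "category Weak_Omega_Cat"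
proof
  fix A B D E :: "'a weak_omega_category" and f g h
  assume "A \<in> Ob Weak_Omega_Cat" "f \<in> Hom Weak_Omega_Cat A B"
  then interpret F: omega_functor A B f by (simp add: Weak_Omega_Cat_def)
  show "Cmp Weak_Omega_Cat A A B f (Idn Weak_Omega_Cat A) = f" "Cmp Weak_Omega_Cat A B B (Idn Weak_Omega_Cat B) f = f"
    by (simp_all add: Weak_Omega_Cat_def F.F1.mor_comp_id F.F2.mor_comp_id F.F3.mor_comp_id)
  show "Cmp Weak_Omega_Cat A D E h (Cmp Weak_Omega_Cat A B D g f) = Cmp Weak_Omega_Cat A B E (Cmp Weak_Omega_Cat B D E h g) f"
    by (simp add: Weak_Omega_Cat_def F.F1.mor_comp_assoc F.F2.mor_comp_assoc F.F3.mor_comp_assoc)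
qed (auto simp: Weak_Omega_Cat_def omega_functor_id omega_functor_comp)

lemma category_Weak_2_Cat: "category Weak_2_Cat"
  unfolding Weak_2_Cat_def by (intro category_full_subcategory category_Weak_Omega_Cat)

lemma Weak_2_Cat_simps:
  "X \<in> Ob Weak_2_Cat \<longleftrightarrow> weak_two_category X \<and> small_weak_omega_category X"
  "F \<in> Hom Weak_2_Cat X Y \<longleftrightarrow> omega_functor X Y F"
  "Idn Weak_2_Cat X = \<lparr>fun1 = mor_id (mag1 X), fun2 = mor_id (mag2 X), fun3 = mor_id (cat3 X)\<rparr>"
  "Cmp Weak_2_Cat X Y Z G F = \<lparr>fun1 = mor_comp (mag1 X) (fun1 G) (fun1 F),
     fun2 = mor_comp (mag2 X) (fun2 G) (fun2 F), fun3 = mor_comp (cat3 X) (fun3 G) (fun3 F)\<rparr>"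
  by (auto simp: Weak_2_Cat_def full_subcategory_def Weak_Omega_Cat_def weak_two_category_def
      weak_two_category_axioms_def)

lemma Bicat_simps:
  "B \<in> Ob Bicat \<longleftrightarrow> bicategory B \<and> small_bicategory B"
  "F \<in> Hom Bicat A B \<longleftrightarrow> strong_homomorphism A B F"
  "Idn Bicat B = bicat_id B" "Cmp Bicat A B C G F = bicat_comp A G F"
  by (simp_all add: Bicat_def bicat_id_def bicat_comp_def)

section \<open>The two functors\<close>

definition to_bicat :: "('u weak_omega_category, 'u omega_functor, 'u bicategory, 'u bicat_hom) functor_data" where
  "to_bicat = \<lparr>obj_map = (\<lambda>X. reflect (pre_of X)),
     arr_map = (\<lambda>X Y F. reflect_map (pre_of X) (pre_of Y) (pre_map F))\<rparr>"

definition from_bicat :: "('u tree \<Rightarrow> 'u) \<Rightarrow> ('u bicategory, 'u bicat_hom, 'u weak_omega_category, 'u omega_functor) functor_data" where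
  "from_bicat e = \<lparr>obj_map = weak_of e, arr_map = weak_functor_of e\<rparr>"

lemma is_functor_to_bicat: "is_functor Weak_2_Cat Bicat to_bicat"
proof (intro is_functor.intro is_functor_axioms.intro category_Weak_2_Cat category_Bicat)
  fix X :: "'a weak_omega_category" assume X: "X \<in> Ob Weak_2_Cat"
  then interpret X: weak_two_category X by (simp add: Weak_2_Cat_simps)
  interpret P: pre_bicategory "pre_of X" by (rule X.pre_bicategory_pre_of)
  have sm: "small_weak_omega_category X" using X by (simp add: Weak_2_Cat_simps)
  have c: "cells0 (pre_of X) = cells (mag1 X) 0" "cells1 (pre_of X) = cells (mag1 X) 1" "cells2 (pre_of X) = cells (mag1 X) 2"
    by (simp_all add: pre_of_def)
  have r: "rep (pre_of X) ` cells2 (pre_of X) \<subseteq> cells2 (pre_of X)" by auto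
  have "small_bicategory (reflect (pre_of X))"
    using sm small_mono[OF _ r] by (simp add: small_bicategory_def small_weak_omega_category_def c)
  then show "obj_map to_bicat X \<in> Ob Bicat"
    using P.bicategory_reflect by (simp add: Bicat_simps to_bicat_def)
  show "arr_map to_bicat X X (Idn Weak_2_Cat X) = Idn Bicat (obj_map to_bicat X)"
    using r by (auto simp: to_bicat_def Weak_2_Cat_simps Bicat_simps bicat_id_def reflect_map_def pre_map_def
        mor_id_def c restrict_def fun_eq_iff)
next
  fix X Y :: "'a weak_omega_category" and F
  assume "X \<in> Ob Weak_2_Cat" "Y \<in> Ob Weak_2_Cat" "F \<in> Hom Weak_2_Cat X Y"
  then have "weak_two_category X" "weak_two_category Y" "omega_functor X Y F" by (auto simp: Weak_2_Cat_simps)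
  then show "arr_map to_bicat X Y F \<in> Hom Bicat (obj_map to_bicat X) (obj_map to_bicat Y)"
    by (simp add: Bicat_simps to_bicat_def strong_homomorphism_reflect_map weak_two_category.pre_bicategory_pre_of
        strong_homomorphism_pre_map)
next
  fix X Y Z :: "'a weak_omega_category" and F G
  assume a: "X \<in> Ob Weak_2_Cat" "Y \<in> Ob Weak_2_Cat" "Z \<in> Ob Weak_2_Cat"
    "F \<in> Hom Weak_2_Cat X Y" "G \<in> Hom Weak_2_Cat Y Z"
  interpret X: pre_bicategory "pre_of X"
    using a by (auto simp: Weak_2_Cat_simps weak_two_category.pre_bicategory_pre_of)
  have p: "pre_bicategory (pre_of Y)" "pre_bicategory (pre_of Z)"
    using a by (auto simp: Weak_2_Cat_simps weak_two_category.pre_bicategory_pre_of)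
  have F: "strong_homomorphism (pre_of X) (pre_of Y) (pre_map F)"
    and G: "strong_homomorphism (pre_of Y) (pre_of Z) (pre_map G)"
    using a by (auto simp: Weak_2_Cat_simps strong_homomorphism_pre_map)
  have pc: "pre_map (Cmp Weak_2_Cat X Y Z G F) = bicat_comp (pre_of X) (pre_map G) (pre_map F)"
    by (simp add: pre_map_def Weak_2_Cat_simps bicat_comp_def pre_of_def mor_comp_def)
  \<comment> \<open>The right side passes to a representative between \<open>F\<close> and
    \<open>G\<close>; by \<open>rep_map\<close> this is invisible after the final passage to
    representatives.\<close>
  have "reflect_map (pre_of X) (pre_of Z) (bicat_comp (pre_of X) (pre_map G) (pre_map F)) =
    bicat_comp (reflect (pre_of X)) (reflect_map (pre_of Y) (pre_of Z) (pre_map G)) (reflect_map (pre_of X) (pre_of Y) (pre_map F))"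
    using rep_map[OF p G]
    by (auto simp: reflect_map_def bicat_comp_def compose_def fun_eq_iff X.hom_simps[OF F])
  then show "arr_map to_bicat X Z (Cmp Weak_2_Cat X Y Z G F) =
    Cmp Bicat (obj_map to_bicat X) (obj_map to_bicat Y) (obj_map to_bicat Z) (arr_map to_bicat Y Z G) (arr_map to_bicat X Y F)"
    by (simp add: to_bicat_def Bicat_simps pc)
qed

lemma map_tree_comp:
  assumes A: "bicategory A" and t: "wf_tree A t"
  shows "map_tree (map1 (bicat_comp A G F)) t = map_tree (map1 G) (map_tree (map1 F) t)"
proof -
  have "map_tree (map1 (bicat_comp A G F)) t = map_tree (map1 G \<circ> map1 F) t"
    using bicategory.leaves_in[OF A t] by (intro tree.map_cong) (auto simp: bicat_comp_def compose_eq)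
  then show ?thesis by (simp add: tree.map_comp)
qed

lemma tree_cell_map_comp:
  "\<lbrakk>bicategory A; c \<in> tree_cells A\<rbrakk>
    \<Longrightarrow> tree_cell_map (bicat_comp A G F) c = tree_cell_map G (tree_cell_map F c)"
  by (cases c) (auto simp: map_tree_comp bicat_comp_at)

lemma tree_cell_map_id: "\<lbrakk>bicategory A; c \<in> tree_cells A\<rbrakk> \<Longrightarrow> tree_cell_map (bicat_id A) c = c"
  by (cases c) (auto simp: bicategory.map_tree_id bicat_id_at)

lemma is_functor_from_bicat:
  assumes U: "uncountable (UNIV :: 'u set)" and e: "inj (e :: 'u tree \<Rightarrow> 'u)"
  shows "is_functor Bicat Weak_2_Cat (from_bicat e)"
proof (intro is_functor.intro is_functor_axioms.intro category_Weak_2_Cat category_Bicat)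
  fix B :: "'u bicategory" assume B: "B \<in> Ob Bicat"
  then interpret bicategory B by (simp add: Bicat_simps)
  show "obj_map (from_bicat e) B \<in> Ob Weak_2_Cat"
    using B weak_omega_category_weak_of[OF e] small_weak_of[OF U bicategory_axioms]
    by (simp add: Bicat_simps Weak_2_Cat_simps from_bicat_def weak_two_category_def weak_two_category_axioms_def
        skeletal_omega)
  note D = two_magma_base two_magma_trees[OF e] two_magma_normals[OF e]
  have "omega_map (base B) (base B) (map0 (bicat_id B)) (map1 (bicat_id B)) (map2 (bicat_id B)) = mor_id (omega (base B))"
    unfolding mor_id_omega[OF D(1)] by (rule omega_map_cong) (auto simp: D bicat_id_at)
  moreover have "omega_map (trees e B) (trees e B) (map0 (bicat_id B)) (map_tree (map1 (bicat_id B))) (tree_cell_map (bicat_id B))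
      = mor_id (omega (trees e B))"
    unfolding mor_id_omega[OF D(2)]
    by (rule omega_map_cong) (auto simp: D map_tree_id tree_cell_map_id bicat_id_at bicategory_axioms simp del: tree_cells_iff tree_cell_map.simps)
  moreover have "omega_map (normals e B) (normals e B) (map0 (bicat_id B)) (\<lambda>t. nf B (map_tree (map1 (bicat_id B)) t))
      (\<lambda>c. nf2 B (tree_cell_map (bicat_id B) c)) = mor_id (omega (normals e B))"
    unfolding mor_id_omega[OF D(3)]
    by (rule omega_map_cong) (auto simp: D map_tree_id tree_cell_map_id bicat_id_at bicategory_axioms nf2_normal simp del: tree_cells_iff tree_cell_map.simps)
  ultimately show "arr_map (from_bicat e) B B (Idn Bicat B) = Idn Weak_2_Cat (obj_map (from_bicat e) B)"
    by (simp add: from_bicat_def Weak_2_Cat_simps Bicat_simps weak_functor_of_def)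
next
  fix A B :: "'u bicategory" and F
  assume "A \<in> Ob Bicat" "B \<in> Ob Bicat" "F \<in> Hom Bicat A B"
  then show "arr_map (from_bicat e) A B F \<in> Hom Weak_2_Cat (obj_map (from_bicat e) A) (obj_map (from_bicat e) B)"
    using omega_functor_weak[OF _ _ _ e] by (simp add: from_bicat_def Weak_2_Cat_simps Bicat_simps)
next
  fix A B C :: "'u bicategory" and F G
  assume "A \<in> Ob Bicat" "B \<in> Ob Bicat" "C \<in> Ob Bicat" "F \<in> Hom Bicat A B" "G \<in> Hom Bicat B C"
  then have A: "bicategory A" and B: "bicategory B" and C: "bicategory C" and F: "strong_homomorphism A B F"
    and G: "strong_homomorphism B C G" by (auto simp: Bicat_simps)
  interpret A: bicategory A by (fact A)
  interpret B: bicategory B by (fact B)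
  note D = A.two_magma_base A.two_magma_trees[OF e] A.two_magma_normals[OF e]
    B.two_magma_base B.two_magma_trees[OF e] B.two_magma_normals[OF e]
  interpret F1: two_magma_map "base A" "base B" "map0 F" "map1 F" "map2 F" by (rule fun1_map[OF A B F e])
  interpret F2: two_magma_map "trees e A" "trees e B" "map0 F" "map_tree (map1 F)" "tree_cell_map F"
    by (rule fun2_map[OF A B F e])
  interpret F3: two_magma_map "normals e A" "normals e B" "map0 F" "\<lambda>t. nf B (map_tree (map1 F) t)"
    "\<lambda>c. nf2 B (tree_cell_map F c)" by (rule fun3_map[OF A B F e])
  note th = B.map_tree_hom[OF A F] and tc = tree_cell_map_in[OF A B F e]
  let ?H = "bicat_comp A G F"
  have "omega_map (base A) (base C) (map0 ?H) (map1 ?H) (map2 ?H) =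
      mor_comp (omega (base A)) (omega_map (base B) (base C) (map0 G) (map1 G) (map2 G))
        (omega_map (base A) (base B) (map0 F) (map1 F) (map2 F))"
    by (subst mor_comp_omega_map) (use D F1.map_in in \<open>auto intro!: omega_map_cong simp: bicat_comp_at\<close>)
  moreover have "omega_map (trees e A) (trees e C) (map0 ?H) (map_tree (map1 ?H)) (tree_cell_map ?H) =
      mor_comp (omega (trees e A)) (omega_map (trees e B) (trees e C) (map0 G) (map_tree (map1 G)) (tree_cell_map G))
        (omega_map (trees e A) (trees e B) (map0 F) (map_tree (map1 F)) (tree_cell_map F))"
    by (subst mor_comp_omega_map) (use D F2.map_in in
      \<open>auto intro!: omega_map_cong simp: A bicat_comp_at map_tree_comp\<close>)
  moreover have "omega_map (normals e A) (normals e C) (map0 ?H) (\<lambda>t. nf C (map_tree (map1 ?H) t)) (\<lambda>c. nf2 C (tree_cell_map ?H c)) =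
      mor_comp (omega (normals e A))
        (omega_map (normals e B) (normals e C) (map0 G) (\<lambda>t. nf C (map_tree (map1 G) t)) (\<lambda>c. nf2 C (tree_cell_map G c)))
        (omega_map (normals e A) (normals e B) (map0 F) (\<lambda>t. nf B (map_tree (map1 F) t)) (\<lambda>c. nf2 B (tree_cell_map F c)))"
  \<comment> \<open>The composite normalizes in \<open>B\<close> between \<open>F\<close> and
    \<open>G\<close>. By \<open>nf_map\<close> and \<open>nf2_map\<close> for \<open>G\<close> this
    has no effect, since one normalizes again in \<open>C\<close>.\<close>
  proof (subst mor_comp_omega_map)
    show "omega_map (normals e A) (normals e C) (map0 ?H) (\<lambda>t. nf C (map_tree (map1 ?H) t)) (\<lambda>c. nf2 C (tree_cell_map ?H c)) =
      omega_map (normals e A) (normals e C) (\<lambda>a. map0 G (map0 F a))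
        (\<lambda>t. nf C (map_tree (map1 G) (nf B (map_tree (map1 F) t)))) (\<lambda>c. nf2 C (tree_cell_map G (nf2 B (tree_cell_map F c))))"
      by (rule omega_map_cong) (simp_all add: D A bicat_comp_at map_tree_comp tree_cell_map_comp nf_map[OF B C G e] nf2_map[OF B C G e] th tc)
  qed (use D F3.map_in in auto)
  ultimately show "arr_map (from_bicat e) A C (Cmp Bicat A B C G F) =
      Cmp Weak_2_Cat (obj_map (from_bicat e) A) (obj_map (from_bicat e) B) (obj_map (from_bicat e) C)
        (arr_map (from_bicat e) B C G) (arr_map (from_bicat e) A B F)"
    by (simp add: from_bicat_def Weak_2_Cat_simps Bicat_simps weak_functor_of_def)
qed

section \<open>The composite on bicategories\<close>

lemma inv_ident [simp]: "inv (\<lambda>a. a) = (\<lambda>a. a)"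
  using inv_id by (simp add: id_def)

text \<open>As \<open>rho\<close> sends a 1-cell to a single leaf, the bridge defining the
  associator joins the two bracketings of three leaves. The associator of \<open>B\<close> is
  coherent between these trees, so by uniqueness it is the 2-cell of the bridge, and
  \<open>lam\<close> extracts it; the unit cells are recovered likewise.\<close>

lemma (in bicategory) pre_of_weak_of:
  assumes e: "inj (e :: 'u tree \<Rightarrow> 'u)"
  shows "pre_of (weak_of e B) = B"
proof -
  let ?X = "weak_of e B"
  interpret D: two_magma "base B" by (rule two_magma_base)
  interpret T: two_magma "trees e B" by (rule two_magma_trees[OF e])
  interpret X: weak_two_category ?X
    using weak_omega_category_weak_of[OF e]
    by (simp add: weak_two_category_def weak_two_category_axioms_def skeletal_omega)
  have rext: "restrict f A = f" if "f \<in> A \<rightarrow>\<^sub>E D" for f :: "'u \<Rightarrow> 'u" and A D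
    using that by (simp add: PiE_restrict)
  have rho: "rho ?X (Suc 0) f = e (Leaf f)" if "f \<in> C1" for f using that by simp
  have comp: "comp01 ?X (e s) (e t) = e (Node s t)"
    if "wf_tree B s" "wf_tree B t" "ttgt B s = tsrc B t" for s t
    using that T.composable_0_1[of s t] inv_f_f[OF e] by (simp add: comp01_def)
  have lamb: "lam ?X (Suc (Suc 0)) (bridge_cell ?X (e s) (e t)) = x" if c: "coherent B s t x" for s t x
  proof -
    have "(e s, e t, enc2 (trees e B) (s, t, x)) \<in> bridge ?X (Suc 0)"
      using c by (auto simp: tree_bridge_def)
    then have "bridge_cell ?X (e s) (e t) = enc2 (trees e B) (s, t, x)" by (rule X.bridge_cell_eq)
    moreover have "(s, t, x) \<in> twos (trees e B)" using coherentD[OF c] by simp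
    ultimately show ?thesis
      using T.omega_enc2(3)[of "(s, t, x)" "base B" _ _ "\<lambda>(s, t, x). x" 0] by simp
  qed
  have comp1: "composable (omega (base B)) 0 (Suc 0) f g \<longleftrightarrow> hcomposable1 B f g" for f g
    using D.composable_0_1[of f g] by (simp add: hcomposable1_def)
  have comp2: "composable (omega (base B)) 0 (Suc (Suc 0)) x y \<longleftrightarrow> hcomposable2 B x y" for x y
    using D.composable_0_2[of 0 x y] by (simp add: hcomposable2_def)
  have compv: "composable (omega (base B)) (Suc 0) (Suc (Suc 0)) x y \<longleftrightarrow> vcomposable B x y" for x y
    using D.composable_1_2[of 0 x y] by (simp add: vcomposable_def)
  have alpha: "alpha (pre_of ?X) = alpha B"
  proof (intro ext)
    fix f g h
    show "alpha (pre_of ?X) f g h = alpha B f g h"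
    proof (cases "hcomposable1 B f g \<and> hcomposable1 B g h")
      case True
      then have c: "f \<in> C1" "g \<in> C1" "h \<in> C1" "t1 f = s1 g" "t1 g = s1 h" by (auto simp: hcomposable1_def)
      then have "alpha (pre_of ?X) f g h = lam ?X (Suc (Suc 0)) (bridge_cell ?X
          (e (Node (Node (Leaf f) (Leaf g)) (Leaf h))) (e (Node (Leaf f) (Node (Leaf g) (Leaf h)))))"
        using True rho comp by (simp add: pre_of_def comp1 numeral_2_eq_2 del: omega_simps)
      also have "\<dots> = alpha B f g h"
        using c coherent_alpha[of "Leaf f" "Leaf g" "Leaf h"] by (intro lamb) simp
      finally show ?thesis .
    next
      case False
      then show ?thesis using alpha_undefined by (auto simp: pre_of_def comp1)
    qed
  qed
  have lu: "lunit (pre_of ?X) = lunit B"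
  proof (rule extensionalityI[where A = C1])
    fix f assume f: "f \<in> C1"
    have "lunit (pre_of ?X) f = lam ?X (Suc (Suc 0)) (bridge_cell ?X (e (Node (Leaf (I1 (s1 f))) (Leaf f))) (e (Leaf f)))"
      using f rho comp by (simp add: pre_of_def numeral_2_eq_2)
    also have "\<dots> = lunit B f" using f coherent_lunit[of "Leaf f"] by (intro lamb) simp
    finally show "lunit (pre_of ?X) f = lunit B f" .
  qed (use lunit_in in \<open>auto simp: pre_of_def PiE_iff\<close>)
  have ru: "runit (pre_of ?X) = runit B"
  proof (rule extensionalityI[where A = C1])
    fix f assume f: "f \<in> C1"
    have "runit (pre_of ?X) f = lam ?X (Suc (Suc 0)) (bridge_cell ?X (e (Node (Leaf f) (Leaf (I1 (t1 f))))) (e (Leaf f)))"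
      using f rho comp by (simp add: pre_of_def numeral_2_eq_2)
    also have "\<dots> = runit B f" using f coherent_runit[of "Leaf f"] by (intro lamb) simp
    finally show "runit (pre_of ?X) f = runit B f" .
  qed (use runit_in in \<open>auto simp: pre_of_def PiE_iff\<close>)
  have ops: "vcomp (pre_of ?X) = vcomp B" "hcomp1 (pre_of ?X) = hcomp1 B" "hcomp2 (pre_of ?X) = hcomp2 B"
    using vcomp_undefined hcomp1_undefined hcomp2_undefined
    by (auto simp: pre_of_def fun_eq_iff comp1 comp2 compv numeral_2_eq_2)
  have "omega_dom (base B) 0 = s1" "omega_cod (base B) 0 = t1" "omega_dom (base B) (Suc 0) = s2"
    "omega_cod (base B) (Suc 0) = t2" "omega_unit (base B) 0 = I1" "omega_unit (base B) (Suc 0) = I2"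
    by (simp_all add: fun_eq_iff)
  then show ?thesis
    by (intro bicategory.equality)
      (simp_all only: alpha lu ru ops,
       simp_all add: pre_of_def numeral_2_eq_2 rext[OF dom1_in] rext[OF cod1_in] rext[OF dom2_in] rext[OF cod2_in]
         rext[OF id1_in] rext[OF id2_in])
qed

lemma pre_map_weak_functor_of:
  assumes F: "strong_homomorphism A B F"
  shows "pre_map (weak_functor_of e A B F) = F"
proof -
  interpret F: strong_homomorphism A B F by fact
  show ?thesis
    by (rule bicat_hom.equality)
      (use F.map0_in F.map1_in F.map2_in in \<open>simp_all add: pre_map_def weak_functor_of_def numeral_2_eq_2 PiE_restrict\<close>)
qed

theorem mainTheorem4:
  assumes "uncountable (UNIV :: 'u set)"
  shows "\<exists>(U :: ('u weak_omega_category, 'u omega_functor, 'u bicategory, 'u bicat_hom) functor_data)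
           (S :: ('u bicategory, 'u bicat_hom, 'u weak_omega_category, 'u omega_functor) functor_data).
         is_functor Weak_2_Cat Bicat U \<and> is_functor Bicat Weak_2_Cat S \<and>
         naturally_isomorphic Bicat Bicat (comp_functor U S) id_functor"
proof -
  obtain e :: "'u tree \<Rightarrow> 'u" where e: "inj e"
    using ex_tree_code uncountable_infinite[OF assms] by blast
  let ?U = "to_bicat :: ('u weak_omega_category, 'u omega_functor, 'u bicategory, 'u bicat_hom) functor_data"
  interpret category "Bicat :: ('u bicategory, 'u bicat_hom) category" by (rule category_Bicat)
  have obj: "obj_map (comp_functor ?U (from_bicat e)) B = B" if "B \<in> Ob Bicat" for B
    using that bicategory.pre_of_weak_of[OF _ e] bicategory.reflect_id[of B]
    by (simp add: Bicat_simps comp_functor_def to_bicat_def from_bicat_def)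
  have arr: "arr_map (comp_functor ?U (from_bicat e)) A B F = F"
    if "A \<in> Ob Bicat" "B \<in> Ob Bicat" "F \<in> Hom Bicat A B" for A B F
    using that bicategory.pre_of_weak_of[OF _ e] reflect_map_id[of A B F] pre_map_weak_functor_of[of A B F]
    by (simp add: Bicat_simps comp_functor_def to_bicat_def from_bicat_def)
  \<comment> \<open>On objects and arrows of \<open>Bicat\<close> the composite equals the identity
    functor, so identity homomorphisms serve as components.\<close>
  have "naturally_isomorphic Bicat Bicat (comp_functor ?U (from_bicat e)) id_functor"
    unfolding naturally_isomorphic_def iso_in_def
    by (rule exI[of _ "Idn Bicat"])
      (auto simp: obj arr id_functor_def Idn_in_Hom Cmp_Idn_left Cmp_Idn_right intro!: bexI[of _ "Idn Bicat _"])
  then show ?thesis using is_functor_to_bicat is_functor_from_bicat[OF assms e] by blast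
qed

end
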